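(* Let $p,q\ge 0$ be integers, $n=p+q$, $G=\mathsf{GL}_n(F)$, let $B\subset \mathsf{GL}_n(A)$ be the Iwahori subgroup of matrices that are upper triangular modulo $t$, and let $K\cong \mathsf{GL}_p(F)\times \mathsf{GL}_q(F)$ be the subgroup of block-diagonal matrices in $G$, acting on $G/B$ by left multiplication. There is a natural bijection between the set of $K$-orbits in $G/B$ and the set of affine $(p,q)$-clans (taken up to equivalence). Explicitly, the map $gB\mapsto c(\Lambda_\bullet(g))$ is constant on $K$-orbits and induces a bijection from the set of $K$-orbits in $G/B$ onto the set of equivalence classes of affine $(p,q)$-clans.
   Context: **Setting.** $\Bbbk$ is a field of characteristic not equal to two, $F=\Bbbk((t))$ is the field of formal Laurent series, $A=\Bbbk[[t]]$ the ring of formal power series, $p,q\ge 0$ integers, $n=p+q$, $[n]=\{1,\dots,n\}$, $V=F^n$. $B$ consists of all matrices in $\mathsf{GL}_n(A)$ that become upper triangular when $t=0$. $K=\left\{\begin{pmatrix}k_1&0\\0&k_2\end{pmatrix}:k_1\in \mathsf{GL}_p(F),k_2\in \mathsf{GL}_q(F)\right\}$. **Affine flags.** An $A$-lattice in $V$ is an $A$-submodule $Av_1\oplus\cdots\oplus Av_n$ with $v_1,\dots,v_n$ an $F$-basis of $V$. An affine flag is a chain of $A$-lattices $\Lambda_\bullet=(\Lambda_1\supset\Lambda_2\supset\dots\supset\Lambda_n)$ with $\Lambda_n\supset t\Lambda_1$ and $\dim_{\Bbbk}(\Lambda_j/\Lambda_{j+1})=1$ for $1\le j\le n-1$. It is extended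 to all indices $i\in\mathbb Z$ by $\Lambda_{i+n}=t\Lambda_i$. For $gB\in G/B$ let $g_i$ be the $(n+1-i)$-th column of $g$, and let $\Lambda_\bullet(g)$ be the affine flag with $\Lambda_i(g)=\mathrm{span}_A\{g_i,g_{i+1},\dots,g_n,tg_1,\dots,tg_{i-1}\}$ for $i\in[n]$; $gB\mapsto\Lambda_\bullet(g)$ is a bijection from $G/B$ to the set of affine flags. **Invariants.** $V_+$ (resp. $V_-$) is the subspace of $V=F^n$ of vectors whose last $q$ (resp. first $p$) coordinates are zero; $\pi_\pm$ are the projections onto $V_\pm$ along $V=V_+\oplus V_-$. For $i\in\mathbb Z$, $(i;+)=\dim_{\Bbbk}((\Lambda_i\cap V_+)/(\Lambda_{i+1}\cap V_+))$ and $(i;-)=\dim_{\Bbbk}((\Lambda_i\cap V_-)/(\Lambda_{i+1}\cap V_-))$; both lie in $\{0,1\}$. **Affine clans.** An affine $(p,q)$-clan is a $\mathbb Z$-indexed sequence $c=(c_i)_{i\in\mathbb Z}$ such that (i) each $c_i$ is $+$, $-$ or an integer; (ii) for $k\in\mathbb Z$, $c_{i+kn}=c_i+kn$ if $c_i$ is an integer, and $c_{i+n}=c_i$ if $c_i\in\{+,-\}$; (iii) $\#\{i\in[n]:c_i=+\}-\#\{i\in[n]:c_i=-\}=p-q$, and every integer, if it appears, appears exactly twice in the sequence. Two such sequences $c,d$ are equivalent (and not distinguished) if for all $i$: $c_i=+\iff d_i=+$ and $c_i=-\iff d_i=-$; and for all $i\ne j$: $c_i=c_j\in\mathbb Z\iff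 d_i=d_j\in\mathbb Z$. **The clan $c(\Lambda_\bullet)$ of an affine flag.** It is the sequence produced by the following procedure, for $i=1,2,\dots,n$ successively (write $\bar j\in[n]$ for the residue of $j$ modulo $n$; "a new label" means $1$ if $\{c_1,\dots,c_{i-1}\}\cap[n]$ is empty, and $1+\max(\{c_1,\dots,c_{i-1}\}\cap[n])$ otherwise): (a) If $c_i$ is already determined, move on to $i+1$. (b) If $(i;+)=1$, $(i;-)=0$, set $c_{i+rn}=+$ for all $r\in\mathbb Z$. (c) If $(i;+)=0$, $(i;-)=1$, set $c_{i+rn}=-$ for all $r\in\mathbb Z$. (d) If $(i;+)=(i;-)=0$, set $c_i$ to be a new label and $c_{i+rn}=c_i+rn$ for all $r\in\mathbb Z$. (e) If $(i;+)=(i;-)=1$, there is $v_+\in\pi_+(\Lambda_{i+1})$, $v_+\notin\Lambda_{i+1}$, with $\Lambda_i=\Lambda_{i+1}\oplus\Bbbk v_+$, and there is a unique $j>i$ (possibly $j>n$) with $v_+\in\pi_+(\Lambda_j)+\Lambda_{i+1}$ and $v_+\notin\pi_+(\Lambda_{j+1})+\Lambda_{i+1}$. If $\bar j<i$ (so that $c_j$ is already determined, and is an integer), set $c_i=c_j$ and $c_{i+rn}=c_i+rn$ for all $r$. If $\bar j>i$ (so $c_j$ is not yet determined), set $c_i=c_j$ to be a new label and $c_{i+rn}=c_{j+rn}=c_i+rn$ for all $r\in\mathbb Z$. *)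

theory Defs
  imports
    "HOL-Computational_Algebra.Formal_Laurent_Series"
    "HOL-Algebra.Group_Action"
    "HOL-Algebra.Left_Coset"
    "HOL-Algebra.AbelCoset"
    "Jordan_Normal_Form.VS_Connect"
begin

section \<open>The groups and the affine flag variety\<close>

definition GL :: "nat \<Rightarrow> 'a :: comm_ring_1 mat monoid" where
  "GL n = units_of (ring_mat TYPE('a) n ())"

text \<open>Membership in \<open>GL n\<close> over the power series ring means that the inverse is integral as well;
  setting \<open>t = 0\<close> is taking the zeroth coefficient of every entry.\<close>

definition iwahori :: "nat \<Rightarrow> 'k :: field fls mat set" where
  "iwahori n = map_mat fps_to_fls `
     {M \<in> carrier (GL n :: 'k fps mat monoid). upper_triangular (map_mat (\<lambda>f. fps_nth f 0) M)}"

definition block_diagonal :: "nat \<Rightarrow> nat \<Rightarrow> 'k :: field fls mat set" where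
  "block_diagonal p q =
     {four_block_mat k1 (0\<^sub>m p q) (0\<^sub>m q p) k2 | k1 k2. k1 \<in> carrier (GL p) \<and> k2 \<in> carrier (GL q)}"

definition affine_flag_variety :: "nat \<Rightarrow> 'k :: field fls mat set set" where
  "affine_flag_variety n = lcosets\<^bsub>GL n\<^esub> (iwahori n)"

definition K_group :: "nat \<Rightarrow> nat \<Rightarrow> 'k :: field fls mat monoid" where
  "K_group p q = (GL (p + q))\<lparr>carrier := block_diagonal p q\<rparr>"

definition left_translation :: "nat \<Rightarrow> 'k :: field fls mat \<Rightarrow> 'k fls mat set \<Rightarrow> 'k fls mat set" where
  "left_translation n k X = k <#\<^bsub>GL n\<^esub> X"

definition K_orbit :: "nat \<Rightarrow> nat \<Rightarrow> 'k :: field fls mat set \<Rightarrow> 'k fls mat set set" where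
  "K_orbit p q X = orbit (K_group p q) (left_translation (p + q)) X"

definition K_orbits :: "nat \<Rightarrow> nat \<Rightarrow> 'k :: field fls mat set set set" where
  "K_orbits p q =
     orbits (K_group p q) (affine_flag_variety (p + q)) (left_translation (p + q))"


section \<open>Affine flags\<close>

text \<open>The scalars \<open>A\<close> and \<open>\<Bbbk>\<close> as subrings of \<open>F\<close>, acting on \<open>F\<^sup>n\<close> by restriction.\<close>

abbreviation power_series_ring :: "'k :: field fls ring" where
  "power_series_ring \<equiv> class_ring\<lparr>carrier := range fps_to_fls\<rparr>"

abbreviation constant_field :: "'k :: field fls ring" where
  "constant_field \<equiv> class_ring\<lparr>carrier := range fls_const\<rparr>"

abbreviation laurent_space :: "nat \<Rightarrow> ('k :: field fls, 'k fls vec) module" where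
  "laurent_space n \<equiv> module_vec TYPE('k fls) n"

text \<open>The vector $g_i$ is the $(n+1-i)$-th column of \<open>g\<close>; columns are numbered from 0 here.\<close>

definition flag_vector :: "nat \<Rightarrow> 'k :: field fls mat \<Rightarrow> int \<Rightarrow> 'k fls vec" where
  "flag_vector n g i = col g (nat (int n - i))"

definition residue :: "nat \<Rightarrow> int \<Rightarrow> int" where
  "residue n i = (i - 1) mod int n + 1"

text \<open>For \<open>i\<close> in \<open>{1..n}\<close> the scaling factor below is \<open>1\<close> and \<open>residue n i = i\<close>; for all
  other \<open>i\<close> it implements the extension by $\Lambda_{i+n} = t\Lambda_i$.\<close>

definition affine_flag :: "nat \<Rightarrow> 'k :: field fls mat \<Rightarrow> int \<Rightarrow> 'k fls vec set" where
  "affine_flag n g i =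
     (\<lambda>v. fls_X_intpow ((i - 1) div int n) \<cdot>\<^sub>v v) `
       module.span power_series_ring (laurent_space n)
         (flag_vector n g ` {residue n i..int n} \<union>
          (\<lambda>l. fls_X \<cdot>\<^sub>v flag_vector n g l) ` {1..<residue n i})"


section \<open>The invariants of an affine flag\<close>

definition V_plus :: "nat \<Rightarrow> nat \<Rightarrow> 'k :: field fls vec set" where
  "V_plus p q = {v \<in> carrier_vec (p + q). \<forall>i \<in> {p..<p + q}. v $ i = 0}"

definition V_minus :: "nat \<Rightarrow> nat \<Rightarrow> 'k :: field fls vec set" where
  "V_minus p q = {v \<in> carrier_vec (p + q). \<forall>i < p. v $ i = 0}"

definition proj_plus :: "nat \<Rightarrow> nat \<Rightarrow> 'k :: field fls vec \<Rightarrow> 'k fls vec" where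
  "proj_plus p q v = vec (p + q) (\<lambda>i. if i < p then v $ i else 0)"

text \<open>The quotient \<open>W / U\<close> of two submodules \<open>U \<subseteq> W\<close> of \<open>V\<close>, whose elements are the cosets of \<open>U\<close>.\<close>

definition quotient_module ::
  "('a, 'v, 'm) module_scheme \<Rightarrow> 'v set \<Rightarrow> 'v set \<Rightarrow> ('a, 'v set) module" where
  "quotient_module V W U = \<lparr>
     carrier = (\<lambda>w. U +>\<^bsub>V\<^esub> w) ` W,
     mult = undefined,
     one = undefined,
     zero = U,
     add = (\<lambda>X Y. X <+>\<^bsub>V\<^esub> Y),
     smult = (\<lambda>a X. \<Union>x\<in>X. U +>\<^bsub>V\<^esub> (a \<odot>\<^bsub>V\<^esub> x))\<rparr>"

definition quotient_dim :: "nat \<Rightarrow> 'k :: field fls vec set \<Rightarrow> 'k fls vec set \<Rightarrow> nat" where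
  "quotient_dim n W U = vectorspace.dim constant_field (quotient_module (laurent_space n) W U)"

definition inv_plus :: "nat \<Rightarrow> nat \<Rightarrow> (int \<Rightarrow> 'k :: field fls vec set) \<Rightarrow> int \<Rightarrow> nat" where
  "inv_plus p q \<Lambda> i = quotient_dim (p + q) (\<Lambda> i \<inter> V_plus p q) (\<Lambda> (i + 1) \<inter> V_plus p q)"

definition inv_minus :: "nat \<Rightarrow> nat \<Rightarrow> (int \<Rightarrow> 'k :: field fls vec set) \<Rightarrow> int \<Rightarrow> nat" where
  "inv_minus p q \<Lambda> i = quotient_dim (p + q) (\<Lambda> i \<inter> V_minus p q) (\<Lambda> (i + 1) \<inter> V_minus p q)"

definition splitting_vector ::
  "nat \<Rightarrow> nat \<Rightarrow> (int \<Rightarrow> 'k :: field fls vec set) \<Rightarrow> int \<Rightarrow> 'k fls vec \<Rightarrow> bool" where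
  "splitting_vector p q \<Lambda> i v \<longleftrightarrow>
     (let kv = {fls_const a \<cdot>\<^sub>v v | a. True} in
       v \<in> proj_plus p q ` \<Lambda> (i + 1) \<and> v \<notin> \<Lambda> (i + 1) \<and>
       \<Lambda> i = \<Lambda> (i + 1) <+>\<^bsub>laurent_space (p + q)\<^esub> kv \<and>
       \<Lambda> (i + 1) \<inter> kv = {0\<^sub>v (p + q)})"

text \<open>Only meaningful when both invariants at \<open>i\<close> are 1; then \<open>j\<close> does not depend on the choice
  of \<open>v\<close>, which is unique up to a nonzero scalar and addition of elements of $\Lambda_{i+1}$.\<close>

definition partner :: "nat \<Rightarrow> nat \<Rightarrow> (int \<Rightarrow> 'k :: field fls vec set) \<Rightarrow> int \<Rightarrow> int" where
  "partner p q \<Lambda> i = (THE j. j > i \<and> (\<exists>v. splitting_vector p q \<Lambda> i v \<and>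
     v \<in> proj_plus p q ` \<Lambda> j <+>\<^bsub>laurent_space (p + q)\<^esub> \<Lambda> (i + 1) \<and>
     v \<notin> proj_plus p q ` \<Lambda> (j + 1) <+>\<^bsub>laurent_space (p + q)\<^esub> \<Lambda> (i + 1)))"


section \<open>Affine clans\<close>

datatype clan_entry = Plus | Minus | Label int

definition affine_clans :: "nat \<Rightarrow> nat \<Rightarrow> (int \<Rightarrow> clan_entry) set" where
  "affine_clans p q = {c.
     (\<forall>i k m. c i = Label m \<longrightarrow> c (i + k * int (p + q)) = Label (m + k * int (p + q))) \<and>
     (\<forall>i. c i \<in> {Plus, Minus} \<longrightarrow> c (i + int (p + q)) = c i) \<and>
     int (card {i \<in> {1..int (p + q)}. c i = Plus}) -
       int (card {i \<in> {1..int (p + q)}. c i = Minus}) = int p - int q \<and>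
     (\<forall>m. (\<exists>i. c i = Label m) \<longrightarrow> card {i. c i = Label m} = 2)}"

definition clan_equiv :: "nat \<Rightarrow> nat \<Rightarrow> ((int \<Rightarrow> clan_entry) \<times> (int \<Rightarrow> clan_entry)) set" where
  "clan_equiv p q = {(c, d). c \<in> affine_clans p q \<and> d \<in> affine_clans p q \<and>
     (\<forall>i. (c i = Plus \<longleftrightarrow> d i = Plus) \<and> (c i = Minus \<longleftrightarrow> d i = Minus)) \<and>
     (\<forall>i j. i \<noteq> j \<longrightarrow>
        ((\<exists>m. c i = Label m \<and> c j = Label m) \<longleftrightarrow> (\<exists>m. d i = Label m \<and> d j = Label m)))}"


section \<open>The clan of an affine flag\<close>

text \<open>While the procedure runs, the sequence is partial: \<open>None\<close> marks an undetermined entry.\<close>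

definition set_sign :: "nat \<Rightarrow> int \<Rightarrow> clan_entry \<Rightarrow> (int \<Rightarrow> clan_entry option) \<Rightarrow>
    int \<Rightarrow> clan_entry option" where
  "set_sign n i s c = (\<lambda>k. if k mod int n = i mod int n then Some s else c k)"

text \<open>For \<open>k = i + r n\<close> the value \<open>m + (k - i)\<close> is \<open>m + r n\<close>.\<close>

definition set_label :: "nat \<Rightarrow> int \<Rightarrow> int \<Rightarrow> (int \<Rightarrow> clan_entry option) \<Rightarrow>
    int \<Rightarrow> clan_entry option" where
  "set_label n i m c = (\<lambda>k. if k mod int n = i mod int n then Some (Label (m + (k - i))) else c k)"

definition new_label :: "nat \<Rightarrow> int \<Rightarrow> (int \<Rightarrow> clan_entry option) \<Rightarrow> int" where
  "new_label n i c =
     (let S = {m \<in> {1..int n}. \<exists>l \<in> {1..<i}. c l = Some (Label m)}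
      in if S = {} then 1 else 1 + Max S)"

text \<open>The final case is \<open>(i;+) = (i;-) = 1\<close>, since both invariants of an affine flag are 0 or 1.\<close>

definition clan_step :: "nat \<Rightarrow> nat \<Rightarrow> (int \<Rightarrow> 'k :: field fls vec set) \<Rightarrow> int \<Rightarrow>
    (int \<Rightarrow> clan_entry option) \<Rightarrow> int \<Rightarrow> clan_entry option" where
  "clan_step p q \<Lambda> i c =
    (let n = p + q; new = new_label n i c in
     if c i \<noteq> None then c
     else if inv_plus p q \<Lambda> i = 1 \<and> inv_minus p q \<Lambda> i = 0 then set_sign n i Plus c
     else if inv_plus p q \<Lambda> i = 0 \<and> inv_minus p q \<Lambda> i = 1 then set_sign n i Minus c
     else if inv_plus p q \<Lambda> i = 0 \<and> inv_minus p q \<Lambda> i = 0 then set_label n i new c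
     else
      (let j = partner p q \<Lambda> i in
       if residue n j < i then set_label n i (THE m. c j = Some (Label m)) c
       else set_label n i new (set_label n j new c)))"

definition flag_clan :: "nat \<Rightarrow> nat \<Rightarrow> (int \<Rightarrow> 'k :: field fls vec set) \<Rightarrow> int \<Rightarrow> clan_entry" where
  "flag_clan p q \<Lambda> i = the (fold (clan_step p q \<Lambda>) [1..int (p + q)] (\<lambda>_. None) i)"

end

theory Submission
  imports Defs
begin

text \<open>The group \<open>K\<close> is the centraliser of the projection \<open>P\<close> of $F^n$ onto $V_+$
  (\<open>block_diagonal_eq\<close>). Sending \<open>g\<close> to $g^{-1} P g$ therefore turns a \<open>K\<close>-orbit on \<open>G/B\<close> into
  a \<open>B\<close>-conjugacy class of idempotent matrices, and the theorem says that each such class has a normal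
  form which is encoded by a clan.

  To a matrix \<open>g\<close> belongs the family $(f_i)_{i \in \mathbb{Z}}$ of vectors with $f_i = g_i$ for
  \<open>i\<close> in \<open>{1..n}\<close> and $f_{i+n} = t f_i$. The lattice $\Lambda_i$ consists of the vectors whose
  expansion in this family starts at an index at least \<open>i\<close>. The matrix is called adapted to a clan
  \<open>c\<close> if \<open>P\<close> fixes $f_i$ when $c_i = +$, kills $f_i$ when $c_i = -$, and sends both $f_i$ and $f_j$ to
  $f_i$ when \<open>i < j\<close> carry the same label. The proof rests on three facts.

  \<^item> Every coset \<open>gB\<close> contains a matrix that is adapted to some affine clan (\<open>adapted_exists\<close> and
    \<open>adapted_affine_clan\<close>). For a linked pair \<open>i < j\<close> of indices, $f_j$ is a vector of order \<open>j\<close> whose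
    component in $V_+$ has the smaller order \<open>i\<close>, because the leading terms of its two components
    cancel. Pairing by this cancellation, with \<open>i\<close> and \<open>j\<close> as large as possible, matches
    the orders which occur both in $V_+$ and in $V_-$ with the orders which occur in neither.
    The count of signs follows from two blocks of zeros, one in \<open>g\<close> and one in its inverse.

  \<^item> Two matrices that are adapted to the same clan differ by an element of \<open>K\<close> on the left, because
    the matrix that carries one family to the other commutes with \<open>P\<close>
    (\<open>adapted_same_orbit\<close>). Conversely, left multiplication by \<open>K\<close> preserves adaptedness, and
    every affine clan has an adapted matrix (\<open>clan_realised\<close>).

  \<^item> If \<open>g\<close> is adapted to \<open>c\<close>, then the clan of its flag is equivalent to \<open>c\<close>
    (\<open>flag_clan_adapted\<close>). In the coordinates given by the family $(f_i)$ the projection \<open>P\<close> has an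
    explicit form (\<open>lam_proj\<close>), from which the invariants $(i;+)$, $(i;-)$ and the index \<open>j\<close> of
    the partner are read off.

  Together these facts show that the clan of a flag is an affine clan, that it depends only on the orbit,
  that it separates orbits and that all clans occur.\<close>

unbundle no fps_syntax

section \<open>Coordinates and the order of a vector\<close>

lemma mult_mat_zero_vec: "A \<in> carrier_mat r m \<Longrightarrow> A *\<^sub>v 0\<^sub>v m = 0\<^sub>v r"
  by (intro eq_vecI) auto

lemma smult_zero_vec: "a \<cdot>\<^sub>v 0\<^sub>v m = (0\<^sub>v m :: 'a :: semiring_0 vec)"
  by (intro eq_vecI) auto

lemma mat_mult_unit_vec:
  fixes A :: "'a :: comm_ring_1 mat"
  assumes "A \<in> carrier_mat r n" "m < n"
  shows "A *\<^sub>v unit_vec n m = col A m"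
  using assms by (intro eq_vecI) auto

text \<open>In the last premise the coefficients are the entries of the vector itself, so that bounds on these
  entries remain available during the induction.\<close>

lemma vec_induct_entries [consumes 1, case_names zero add entry]:
  fixes x :: "'a :: comm_ring_1 vec"
  assumes x: "x \<in> carrier_vec n"
    and zero: "Q (0\<^sub>v n)"
    and add: "\<And>x y. x \<in> carrier_vec n \<Longrightarrow> y \<in> carrier_vec n \<Longrightarrow> Q x \<Longrightarrow> Q y \<Longrightarrow> Q (x + y)"
    and entry: "\<And>m. m < n \<Longrightarrow> Q (x $ m \<cdot>\<^sub>v unit_vec n m)"
  shows "Q x"
proof -
  define trunc where "trunc t = vec n (\<lambda>m. if m < t then x $ m else 0)" for t
  have "Q (trunc t)" if "t \<le> n" for t
    using that
  proof (induction t)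
    case 0
    have "trunc 0 = 0\<^sub>v n" by (auto simp: trunc_def)
    thus ?case using zero by simp
  next
    case (Suc t)
    have "trunc (Suc t) = trunc t + x $ t \<cdot>\<^sub>v unit_vec n t"
      by (rule eq_vecI) (auto simp: trunc_def unit_vec_def less_Suc_eq)
    moreover have "trunc t \<in> carrier_vec n" by (simp add: trunc_def)
    ultimately show ?case using Suc add entry[of t] by simp
  qed
  moreover have "trunc n = x" using x by (auto simp: trunc_def)
  ultimately show ?thesis by (metis order_refl)
qed

text \<open>The index of the coefficient of $t^k$ in the entry \<open>m\<close>. Entry \<open>m\<close> is the coordinate with respect
  to the flag vector $g_{n-m}$, and a factor \<open>t\<close> moves an index by \<open>n\<close>.\<close>

definition index :: "nat \<Rightarrow> nat \<Rightarrow> int \<Rightarrow> int" where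
  "index n m k = int n - int m + k * int n"

text \<open>The coefficients of all \<open>n\<close> entries, arranged in one sequence. Equivalently, $F^n$ is identified
  with the Laurent series in $s = t^{1/n}$ by giving entry \<open>m\<close> the weight $s^{n-m}$; the standard
  affine flag becomes the \<open>s\<close>-adic filtration.\<close>

definition coef :: "nat \<Rightarrow> 'k :: field fls vec \<Rightarrow> int \<Rightarrow> 'k" where
  "coef n x i = fls_nth (x $ nat (int n - residue n i)) ((i - 1) div int n)"

lemma index_div_mod:
  assumes "m < n"
  shows "(index n m k - 1) div int n = k" "residue n (index n m k) = int n - int m"
proof -
  have eq: "index n m k - 1 = (int n - int m - 1) + k * int n" by (simp add: index_def)
  have bounds: "0 \<le> int n - int m - 1" "int n - int m - 1 < int n" using assms by auto
  have "(int n - int m - 1 + k * int n) div int n = k"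
    using bounds assms by simp
  thus "(index n m k - 1) div int n = k" by (simp only: eq)
  have "(int n - int m - 1 + k * int n) mod int n = int n - int m - 1"
    using bounds by (simp only: mod_mult_self1 mod_pos_pos_trivial)
  thus "residue n (index n m k) = int n - int m" by (simp only: residue_def eq)
qed

lemma residue_bounds:
  assumes "0 < n"
  shows "1 \<le> residue n i" "residue n i \<le> int n"
  unfolding residue_def using assms pos_mod_bound[of "int n" "i - 1"] pos_mod_sign[of "int n" "i - 1"]
  by linarith+

lemma index_cases:
  assumes "0 < n"
  obtains m k where "m < n" "i = index n m k"
proof
  show "nat (int n - residue n i) < n" using residue_bounds[OF assms, of i] assms by linarith
  have "i - 1 = (i - 1) mod int n + (i - 1) div int n * int n" by simp
  moreover have "int (nat (int n - residue n i)) = int n - residue n i"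
    using residue_bounds[OF assms, of i] by simp
  ultimately show "i = index n (nat (int n - residue n i)) ((i - 1) div int n)"
    by (simp add: index_def residue_def)
qed

lemma index_inject:
  assumes "m < n" "m' < n"
  shows "index n m k = index n m' k' \<longleftrightarrow> m = m' \<and> k = k'"
  using index_div_mod[OF assms(1), of k] index_div_mod[OF assms(2), of k'] by auto

lemma index_shift: "index n m k + l * int n = index n m (k + l)"
  by (simp add: index_def algebra_simps)

lemma residue_shift [simp]: "0 < n \<Longrightarrow> residue n (i + k * int n) = residue n i"
  by (simp add: residue_def) (metis add_diff_eq diff_add_eq mod_mult_self1)

lemma level_shift:
  assumes "0 < n"
  shows "(i + k * int n - 1) div int n = k + (i - 1) div int n"
proof -
  have "i + k * int n - 1 = (i - 1) + k * int n" by simp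
  thus ?thesis using assms by (simp only: div_mult_self1)
qed

lemma residue_id: "1 \<le> i \<Longrightarrow> i \<le> int n \<Longrightarrow> residue n i = i"
  by (simp add: residue_def)

lemma residue_decomp: "i = residue n i + (i - 1) div int n * int n"
  by (simp add: residue_def)

lemma residue_eq_iff:
  assumes "0 < n"
  shows "residue n i = residue n j \<longleftrightarrow> (\<exists>k. i = j + k * int n)"
proof
  assume "residue n i = residue n j"
  hence "i = j + ((i - 1) div int n - (j - 1) div int n) * int n"
    using residue_decomp[of i n] residue_decomp[of j n] by (simp add: left_diff_distrib)
  thus "\<exists>k. i = j + k * int n" by blast
qed (use assms in auto)

lemma coef_index: "m < n \<Longrightarrow> coef n x (index n m k) = fls_nth (x $ m) k"
  by (simp add: coef_def index_div_mod)

lemma coef_add: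
  assumes "0 < n" "x \<in> carrier_vec n" "y \<in> carrier_vec n"
  shows "coef n (x + y) i = coef n x i + coef n y i"
  by (rule index_cases[OF assms(1), of i]) (use assms in \<open>simp add: coef_index\<close>)

lemma coef_diff:
  assumes "0 < n" "x \<in> carrier_vec n" "y \<in> carrier_vec n"
  shows "coef n (x - y) i = coef n x i - coef n y i"
  by (rule index_cases[OF assms(1), of i]) (use assms in \<open>simp add: coef_index\<close>)

lemma coef_zero [simp]: "0 < n \<Longrightarrow> coef n (0\<^sub>v n) i = 0"
  by (rule index_cases[of n i]) (simp_all add: coef_index)

lemma coef_smult_const:
  assumes "0 < n" "x \<in> carrier_vec n"
  shows "coef n (fls_const a \<cdot>\<^sub>v x) i = a * coef n x i"
  by (rule index_cases[OF assms(1), of i]) (use assms in \<open>simp add: coef_index\<close>)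

lemma coef_shift:
  assumes "0 < n" "x \<in> carrier_vec n"
  shows "coef n (fls_X_intpow k \<cdot>\<^sub>v x) (i + k * int n) = coef n x i"
  by (rule index_cases[OF assms(1), of i])
    (use assms in \<open>simp add: coef_index index_shift fls_X_intpow_times_conv_shift\<close>)

lemma coef_eqI:
  assumes "0 < n" "x \<in> carrier_vec n" "y \<in> carrier_vec n" "\<And>i. coef n x i = coef n y i"
  shows "x = y"
proof (rule eq_vecI)
  fix m assume "m < dim_vec y"
  hence m: "m < n" using assms by simp
  show "x $ m = y $ m"
    using assms(4)[of "index n m _"] m by (intro fls_eqI) (simp add: coef_index)
qed (use assms in simp)

lemma coef_bounded_below:
  assumes n: "0 < n" and x: "x \<in> carrier_vec n"
  shows "\<exists>N. \<forall>i<N. coef n x i = 0"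
proof -
  define K where "K = Min ((\<lambda>m. fls_subdegree (x $ m)) ` {..<n})"
  have K: "K \<le> fls_subdegree (x $ m)" if "m < n" for m
    unfolding K_def using that by (intro Min_le) auto
  have "coef n x i = 0" if "i < K * int n" for i
  proof (rule index_cases[OF n, of i])
    fix m k assume m: "m < n" and i: "i = index n m k"
    have "k < K"
    proof (rule ccontr)
      assume "\<not> k < K"
      hence "K * int n \<le> k * int n" by (simp add: mult_right_mono)
      thus False using that i m unfolding index_def by linarith
    qed
    thus ?thesis using K[OF m] m i by (simp add: coef_index)
  qed
  thus ?thesis by blast
qed

text \<open>The order of vanishing in the variable \<open>s\<close>. It is a relation because the zero vector has no order.\<close>

definition has_ord :: "nat \<Rightarrow> 'k :: field fls vec \<Rightarrow> int \<Rightarrow> bool" where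
  "has_ord n x i \<longleftrightarrow> x \<in> carrier_vec n \<and> coef n x i \<noteq> 0 \<and> (\<forall>l<i. coef n x l = 0)"

lemma int_least:
  fixes P :: "int \<Rightarrow> bool"
  assumes "P i" "\<And>l. l < N \<Longrightarrow> \<not> P l"
  shows "\<exists>i. P i \<and> (\<forall>l<i. \<not> P l)"
proof -
  define k where "k = (LEAST k. P (N + int k))"
  have "N \<le> i" using assms by force
  hence "P (N + int (nat (i - N)))" using assms(1) by simp
  hence "\<exists>k. P (N + int k)" by blast
  hence k: "P (N + int k)" unfolding k_def by (rule LeastI_ex)
  have "\<not> P l" if "l < N + int k" for l
  proof (cases "l < N")
    case False
    then obtain j where j: "l = N + int j" by (metis linorder_not_less zle_iff_zadd)
    thus ?thesis using that not_less_Least[of j "\<lambda>k. P (N + int k)"] by (auto simp: k_def)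
  qed (use assms in auto)
  thus ?thesis using k by blast
qed

lemma int_greatest:
  fixes P :: "int \<Rightarrow> bool"
  assumes "P i" "\<And>l. l > N \<Longrightarrow> \<not> P l"
  shows "\<exists>i. P i \<and> (\<forall>l>i. \<not> P l)"
proof -
  have "\<exists>i. P (- i) \<and> (\<forall>l<i. \<not> P (- l))"
    by (rule int_least[of "\<lambda>i. P (- i)" "- i" "- N"]) (use assms in auto)
  thus ?thesis by (metis minus_less_iff minus_minus)
qed

lemma has_ord_exists:
  assumes n: "0 < n" and x: "x \<in> carrier_vec n" "x \<noteq> 0\<^sub>v n"
  shows "\<exists>i. has_ord n x i"
proof -
  obtain i where "coef n x i \<noteq> 0" using coef_eqI[OF n x(1), of "0\<^sub>v n"] x n by auto
  moreover obtain N where "\<forall>i<N. coef n x i = 0" using coef_bounded_below[OF n x(1)] by blast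
  ultimately show ?thesis
    using int_least[of "\<lambda>i. coef n x i \<noteq> 0" i N] x unfolding has_ord_def by auto
qed

lemma has_ord_unique: "has_ord n x i \<Longrightarrow> has_ord n x j \<Longrightarrow> i = j"
  unfolding has_ord_def by (meson linorder_neqE)

lemma has_ord_shift:
  assumes "0 < n" "has_ord n x i"
  shows "has_ord n (fls_X_intpow k \<cdot>\<^sub>v x) (i + k * int n)"
proof -
  have x: "x \<in> carrier_vec n" using assms by (simp add: has_ord_def)
  have "coef n (fls_X_intpow k \<cdot>\<^sub>v x) l = coef n x (l - k * int n)" for l
    using coef_shift[OF assms(1) x, of k "l - k * int n"] by simp
  thus ?thesis using assms by (auto simp: has_ord_def)
qed

section \<open>The matching of an affine clan\<close>

text \<open>The conditions on an affine clan apart from the count of signs. They are what the combinatorial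
  arguments use, and the count is established for the clans of flags by linear algebra.\<close>

definition clan_shape :: "nat \<Rightarrow> (int \<Rightarrow> clan_entry) \<Rightarrow> bool" where
  "clan_shape n c \<longleftrightarrow>
     (\<forall>i k m. c i = Label m \<longrightarrow> c (i + k * int n) = Label (m + k * int n)) \<and>
     (\<forall>i. c i \<in> {Plus, Minus} \<longrightarrow> c (i + int n) = c i) \<and>
     (\<forall>m. (\<exists>i. c i = Label m) \<longrightarrow> card {i. c i = Label m} = 2)"

text \<open>The other index with the same label. Signs are fixed points, so that \<open>mate c\<close> is an involution of
  the integers.\<close>

definition mate :: "(int \<Rightarrow> clan_entry) \<Rightarrow> int \<Rightarrow> int" where
  "mate c i = (if c i \<in> {Plus, Minus} then i else THE j. j \<noteq> i \<and> c j = c i)"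

lemma affine_clans_iff:
  "c \<in> affine_clans p q \<longleftrightarrow> clan_shape (p + q) c \<and>
     int (card {i \<in> {1..int (p + q)}. c i = Plus}) -
       int (card {i \<in> {1..int (p + q)}. c i = Minus}) = int p - int q"
  unfolding affine_clans_def clan_shape_def by auto

lemma mate_sign: "c i = Plus \<or> c i = Minus \<Longrightarrow> mate c i = i"
  by (auto simp: mate_def)

lemma mate_label:
  assumes "clan_shape n c" "c i = Label m"
  shows "mate c i \<noteq> i" "c (mate c i) = Label m" "c j = Label m \<longleftrightarrow> j = i \<or> j = mate c i"
proof -
  have "card {i. c i = Label m} = 2" using assms unfolding clan_shape_def by blast
  then obtain a b where ab: "{i. c i = Label m} = {a, b}" "a \<noteq> b" by (auto simp: card_2_iff)
  hence mem: "c j = Label m \<longleftrightarrow> j = a \<or> j = b" for j by blast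
  hence "\<exists>!j. j \<noteq> i \<and> c j = c i" using assms(2) ab(2) by metis
  hence "mate c i \<noteq> i \<and> c (mate c i) = c i"
    unfolding mate_def using assms(2) theI'[of "\<lambda>j. j \<noteq> i \<and> c j = c i"] by simp
  thus *: "mate c i \<noteq> i" "c (mate c i) = Label m" using assms(2) by auto
  show "c j = Label m \<longleftrightarrow> j = i \<or> j = mate c i" using mem assms(2) * by metis
qed

lemma mateI:
  assumes "clan_shape n c" "c i = Label m" "c j = Label m" "i \<noteq> j"
  shows "mate c i = j"
  using mate_label(3)[OF assms(1,2), of j] assms by auto

lemma mate_mate:
  assumes "clan_shape n c"
  shows "mate c (mate c i) = i"
proof (cases "c i")
  case (Label m)
  thus ?thesis using mate_label[OF assms] mateI[OF assms] by metis
qed (simp_all add: mate_sign)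

lemma mate_eq_self_iff:
  assumes "clan_shape n c"
  shows "mate c i = i \<longleftrightarrow> c i = Plus \<or> c i = Minus"
  using mate_label(1)[OF assms] by (cases "c i") (auto simp: mate_sign)

lemma clan_mate_eq:
  assumes "clan_shape n c"
  shows "c (mate c i) = c i"
  using mate_label(2)[OF assms] by (cases "c i") (auto simp: mate_sign)

lemma sign_shift:
  assumes c: "clan_shape n c" and s: "c i = Plus \<or> c i = Minus"
  shows "c (i + k * int n) = c i"
proof -
  have step: "c (j + int n) = c i" if "c j = c i" for j
    using c s that unfolding clan_shape_def by auto
  have up: "c (i + int k * int n) = c i" for k
  proof (induction k)
    case (Suc k)
    from step[OF this] show ?case by (simp add: algebra_simps)
  qed simp
  \<comment> \<open>A label at \<open>j\<close> would force a label at \<open>j + n\<close>.\<close>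
  have prev: "c j = c i" if "c (j + int n) = c i" for j
  proof (cases "c j")
    case (Label m)
    hence "c (j + 1 * int n) = Label (m + 1 * int n)" using c unfolding clan_shape_def by blast
    thus ?thesis using that s by auto
  qed (use c that s in \<open>auto simp: clan_shape_def\<close>)
  have down: "c (i - int k * int n) = c i" for k
  proof (induction k)
    case (Suc k)
    show ?case by (rule prev) (use Suc in \<open>simp add: algebra_simps\<close>)
  qed simp
  show ?thesis using up[of "nat k"] down[of "nat (- k)"] by (cases "0 \<le> k") auto
qed

lemma label_shift:
  assumes "clan_shape n c" "c i = Label m"
  shows "c (i + k * int n) = Label (m + k * int n)"
  using assms unfolding clan_shape_def by blast

lemma clan_shift_iff:
  assumes c: "clan_shape n c"
  shows "c (i + k * int n) = Plus \<longleftrightarrow> c i = Plus" "c (i + k * int n) = Minus \<longleftrightarrow> c i = Minus"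
  using sign_shift[OF c, of i k] label_shift[OF c, of i _ k] by (cases "c i"; force)+

lemma mate_shift:
  assumes c: "clan_shape n c"
  shows "mate c (i + k * int n) = mate c i + k * int n"
proof (cases "c i")
  case (Label m)
  show ?thesis
    by (rule mateI[OF c label_shift[OF c Label]])
      (use label_shift[OF c mate_label(2)[OF c Label]] mate_label(1)[OF c Label] in auto)
qed (use mate_sign sign_shift[OF c] in force)+

text \<open>The labels of an index and of its translate by \<open>k n\<close> differ by \<open>k n\<close>, so that distinct translates
  are never matched.\<close>

lemma mate_not_congruent:
  assumes c: "clan_shape n c" and n: "0 < n" and i: "mate c i = i + k * int n"
  shows "k = 0"
proof (cases "c i")
  case (Label m)
  have "Label (m + k * int n) = Label m"
    using label_shift[OF c Label, of k] mate_label(2)[OF c Label] i by simp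
  thus ?thesis using n by simp
qed (use mate_sign[of c i] n i in auto)

text \<open>Equivalent clans have different labels in general, but the same signs and the same matching. These
  are therefore all that has to be compared.\<close>

lemma clan_equiv_iff:
  "(c, d) \<in> clan_equiv p q \<longleftrightarrow> c \<in> affine_clans p q \<and> d \<in> affine_clans p q \<and>
     (\<forall>i. (c i = Plus \<longleftrightarrow> d i = Plus) \<and> (c i = Minus \<longleftrightarrow> d i = Minus)) \<and> mate c = mate d"
  (is "_ \<longleftrightarrow> ?cd \<and> ?dd \<and> ?signs \<and> _")
proof (cases "?cd \<and> ?dd \<and> ?signs")
  case True
  hence c: "clan_shape (p + q) c" and d: "clan_shape (p + q) d" by (auto simp: affine_clans_iff)
  have same: "(\<exists>m. e i = Label m \<and> e j = Label m) \<longleftrightarrow> mate e i = j"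
    if e: "clan_shape (p + q) e" "i \<noteq> j" for e :: "int \<Rightarrow> clan_entry" and i j
  proof (cases "e i")
    case (Label m)
    have "(\<exists>m. e i = Label m \<and> e j = Label m) \<longleftrightarrow> e j = Label m" using Label by auto
    thus ?thesis using mate_label(1)[OF e(1) Label] mate_label(3)[OF e(1) Label, of j] e(2) by auto
  qed (use mate_sign[of e i] e(2) in auto)
  have "(\<forall>i j. i \<noteq> j \<longrightarrow>
        ((\<exists>m. c i = Label m \<and> c j = Label m) \<longleftrightarrow> (\<exists>m. d i = Label m \<and> d j = Label m))) \<longleftrightarrow>
     (\<forall>i j. i \<noteq> j \<longrightarrow> (mate c i = j \<longleftrightarrow> mate d i = j))"
    by (intro all_cong1 imp_cong refl) (simp only: same[OF c] same[OF d] simp_thms)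
  also have "\<dots> \<longleftrightarrow> (\<forall>i. mate c i = mate d i)" by metis
  also have "\<dots> \<longleftrightarrow> mate c = mate d" by (simp add: fun_eq_iff)
  finally show ?thesis using True unfolding clan_equiv_def by auto
next
  case False
  thus ?thesis unfolding clan_equiv_def by auto
qed

lemma equiv_clan_equiv: "equiv (affine_clans p q) (clan_equiv p q)"
  by (rule equivI) (auto simp: refl_on_def sym_on_def trans_on_def clan_equiv_iff)

lemma has_ord_unit_vec:
  assumes n: "0 < n" and m: "m < n"
  shows "has_ord n (unit_vec n m :: 'k :: field fls vec) (int n - int m)"
proof -
  have coef_unit: "coef n (unit_vec n m) (index n r k) = (if m = r \<and> k = 0 then 1 else 0 :: 'k)"
    if "r < n" for r k
    using that m by (auto simp: coef_index unit_vec_def)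
  have "coef n (unit_vec n m) l = (0 :: 'k)" if l: "l < int n - int m" for l
    by (rule index_cases[OF n, of l]) (use l in \<open>auto simp: coef_unit\<close>, simp add: index_def)
  moreover have "coef n (unit_vec n m) (int n - int m) = (1 :: 'k)"
    using coef_unit[OF m, of 0] by (simp add: index_def)
  ultimately show ?thesis by (simp add: has_ord_def)
qed

section \<open>The orders of an idempotent\<close>

lemma fls_times_nth_vanish:
  fixes a b :: "'k :: field fls"
  assumes "\<And>j. j < K \<Longrightarrow> fls_nth a j = 0" "\<And>j. j \<le> k - K \<Longrightarrow> fls_nth b j = 0"
  shows "fls_nth (a * b) k = 0"
proof (cases "a = 0 \<or> b = 0")
  case False
  hence "K \<le> fls_subdegree a" "k - K < fls_subdegree b"
    using assms by (auto intro!: fls_subdegree_geI fls_subdegree_greaterI)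
  thus ?thesis using False by (intro fls_eq0_below_subdegree) auto
qed auto

text \<open>The finitely many entries of a matrix have poles of bounded order, so multiplication lowers the
  order of a vector by at most a constant.\<close>

lemma coef_mult_bounded:
  fixes A :: "'k :: field fls mat"
  assumes n: "0 < n" and A: "A \<in> carrier_mat n n"
  shows "\<exists>C. \<forall>x \<in> carrier_vec n. \<forall>i.
    (\<forall>l<i. coef n x l = 0) \<longrightarrow> (\<forall>l<i - C. coef n (A *\<^sub>v x) l = 0)"
proof -
  define K where "K = Min ((\<lambda>(r, m). fls_subdegree (A $$ (r, m))) ` ({..<n} \<times> {..<n}))"
  have K: "fls_nth (A $$ (r, m)) k = 0" if "r < n" "m < n" "k < K" for r m k
  proof -
    have "K \<le> fls_subdegree (A $$ (r, m))" unfolding K_def using that(1,2) by (intro Min_le) auto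
    thus ?thesis using that by (intro fls_eq0_below_subdegree) auto
  qed
  \<comment> \<open>An entry of subdegree at least \<open>K\<close> raises indices by at least \<open>K n\<close>, up to less than \<open>n\<close> for the change of row.\<close>
  have "coef n (A *\<^sub>v x) l = 0"
    if x: "x \<in> carrier_vec n" and i: "\<forall>l<i. coef n x l = 0" and l: "l < i - (1 - K) * int n" for x i l
  proof (rule index_cases[OF n, of l])
    fix r k assume r: "r < n" and lk: "l = index n r k"
    have "fls_nth (A $$ (r, m) * x $ m) k = 0" if m: "m < n" for m
    proof (rule fls_times_nth_vanish[of K])
      fix j assume "j \<le> k - K"
      hence "j * int n \<le> (k - K) * int n" by (rule mult_right_mono) simp
      hence "index n m j < i" using r m l unfolding lk index_def by (simp add: algebra_simps)
      thus "fls_nth (x $ m) j = 0" using i m coef_index[OF m, of x j] by simp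
    qed (use K r m in auto)
    hence "(\<Sum>m = 0..<n. fls_nth (A $$ (r, m) * x $ m) k) = 0" by simp
    thus ?thesis using r x A unfolding lk by (simp add: coef_index scalar_prod_def fls_nth_sum)
  qed
  thus ?thesis by blast
qed

lemma has_ord_carrier: "has_ord n x i \<Longrightarrow> x \<in> carrier_vec n"
  by (simp add: has_ord_def)

lemma higher_ord:
  assumes "0 < n" "x \<in> carrier_vec n" "x \<noteq> 0\<^sub>v n" "\<And>l. l \<le> i \<Longrightarrow> coef n x l = 0"
  shows "\<exists>j>i. has_ord n x j"
proof -
  obtain j where j: "has_ord n x j" using has_ord_exists[OF assms(1-3)] by blast
  hence "j > i" using assms(4)[of j] unfolding has_ord_def by (meson linorder_not_less)
  thus ?thesis using j by blast
qed

lemma cancel_leading: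
  assumes "0 < n" "has_ord n v i" "has_ord n w i"
  shows "\<exists>a. a \<noteq> 0 \<and> (\<forall>l\<le>i. coef n (v - fls_const a \<cdot>\<^sub>v w) l = 0)"
proof (intro exI conjI allI impI)
  let ?a = "coef n v i / coef n w i"
  show "?a \<noteq> 0" using assms by (simp add: has_ord_def)
  fix l assume "l \<le> i"
  moreover have "coef n (v - fls_const ?a \<cdot>\<^sub>v w) l = coef n v l - ?a * coef n w l"
    using assms by (simp add: has_ord_def coef_diff coef_smult_const)
  ultimately show "coef n (v - fls_const ?a \<cdot>\<^sub>v w) l = 0"
    using assms by (cases "l = i") (auto simp: has_ord_def)
qed

lemma has_ord_cong:
  assumes "has_ord n x i" "y \<in> carrier_vec n" "a \<noteq> 0" "\<And>l. l \<le> i \<Longrightarrow> coef n y l = a * coef n x l"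
  shows "has_ord n y i"
  using assms by (auto simp: has_ord_def)

text \<open>An idempotent \<open>E\<close> splits $F^n$ into its image, the plus part, and its kernel, the minus part. The
  predicates \<open>pos\<close> and \<open>neg\<close> below describe the orders that occur in these two parts. If \<open>descends i j\<close>
  holds, some vector of order \<open>j\<close> has a plus component of the smaller order \<open>i\<close>; then the leading
  terms of its two components cancel.\<close>

locale idempotent_matrix =
  fixes n :: nat and E :: "'k :: field fls mat"
  assumes n: "0 < n" and E: "E \<in> carrier_mat n n" and idem: "E * E = E"
begin

lemma E_carrier [simp]: "x \<in> carrier_vec n \<Longrightarrow> E *\<^sub>v x \<in> carrier_vec n"
  using E by simp

lemma E_E [simp]: "x \<in> carrier_vec n \<Longrightarrow> E *\<^sub>v (E *\<^sub>v x) = E *\<^sub>v x"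
  using E idem by (metis assoc_mult_mat_vec)

lemma E_diff: "x \<in> carrier_vec n \<Longrightarrow> y \<in> carrier_vec n \<Longrightarrow> E *\<^sub>v (x - y) = E *\<^sub>v x - E *\<^sub>v y"
  using E by (simp add: mult_minus_distrib_mat_vec)

lemma E_smult: "x \<in> carrier_vec n \<Longrightarrow> E *\<^sub>v (a \<cdot>\<^sub>v x) = a \<cdot>\<^sub>v (E *\<^sub>v x)"
  using E by (simp add: mult_mat_vec)

lemmas coefs = coef_diff[OF n] coef_smult_const[OF n]

definition pos :: "int \<Rightarrow> bool" where
  "pos i \<longleftrightarrow> (\<exists>x. has_ord n x i \<and> E *\<^sub>v x = x)"

definition neg :: "int \<Rightarrow> bool" where
  "neg i \<longleftrightarrow> (\<exists>x. has_ord n x i \<and> E *\<^sub>v x = 0\<^sub>v n)"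

definition descends :: "int \<Rightarrow> int \<Rightarrow> bool" where
  "descends i j \<longleftrightarrow> i < j \<and> (\<exists>v. has_ord n v j \<and> has_ord n (E *\<^sub>v v) i)"

text \<open>Maximality is required on both sides so that the relation is a matching. By \<open>pos_neg_linked\<close> and
  \<open>not_pos_neg_linked\<close> it can be reached from either side.\<close>

definition linked :: "int \<Rightarrow> int \<Rightarrow> bool" where
  "linked i j \<longleftrightarrow> descends i j \<and> (\<forall>j'>j. \<not> descends i j') \<and> (\<forall>i'>i. \<not> descends i' j)"

lemma descends_less: "descends i j \<Longrightarrow> i < j"
  by (simp add: descends_def)

text \<open>Since \<open>i < j\<close>, the minus component \<open>v - E v\<close> has the same order \<open>i\<close> as the plus component.\<close>

lemma descends_pos_neg:
  assumes "descends i j"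
  shows "pos i" "neg i"
proof -
  obtain v where v: "i < j" "has_ord n v j" "has_ord n (E *\<^sub>v v) i" using assms by (auto simp: descends_def)
  note c = has_ord_carrier[OF v(2)]
  show "pos i" unfolding pos_def using v c E_E by blast
  have "has_ord n (v - E *\<^sub>v v) i"
    by (rule has_ord_cong[OF v(3), of _ "- 1"]) (use v c in \<open>auto simp: coefs has_ord_def\<close>)
  moreover have "E *\<^sub>v (v - E *\<^sub>v v) = 0\<^sub>v n" using c by (simp add: E_diff)
  ultimately show "neg i" unfolding neg_def by blast
qed

lemma descends_bounded: "\<exists>C. \<forall>i j. descends i j \<longrightarrow> j \<le> i + C"
proof -
  obtain C where C: "\<And>x i l. x \<in> carrier_vec n \<Longrightarrow> \<forall>l<i. coef n x l = 0 \<Longrightarrow> l < i - C \<Longrightarrow>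
      coef n (E *\<^sub>v x) l = 0"
    using coef_mult_bounded[OF n E] by blast
  have "j \<le> i + C" if "descends i j" for i j
    using that C unfolding descends_def has_ord_def by (meson diff_less_eq linorder_not_less less_diff_eq)
  thus ?thesis by blast
qed

text \<open>Cancelling the leading terms of a plus vector and a minus vector of order \<open>i\<close> gives a vector of
  larger order with a plus component of order \<open>i\<close>.\<close>

lemma pos_neg_descends:
  assumes "pos i" "neg i"
  shows "\<exists>j. descends i j"
proof -
  obtain u w where u: "has_ord n u i" "E *\<^sub>v u = u" and w: "has_ord n w i" "E *\<^sub>v w = 0\<^sub>v n"
    using assms by (auto simp: pos_def neg_def)
  note c = has_ord_carrier[OF u(1)] has_ord_carrier[OF w(1)]
  obtain a where a: "\<And>l. l \<le> i \<Longrightarrow> coef n (u - fls_const a \<cdot>\<^sub>v w) l = 0"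
    using cancel_leading[OF n u(1) w(1)] by blast
  let ?v = "u - fls_const a \<cdot>\<^sub>v w"
  have Ev: "E *\<^sub>v ?v = u" using c u w by (simp add: E_diff E_smult smult_zero_vec)
  have "?v \<noteq> 0\<^sub>v n"
  proof
    assume "?v = 0\<^sub>v n"
    hence "u = 0\<^sub>v n" using Ev E by (auto simp: mult_mat_vec_def scalar_prod_def)
    thus False using u(1) n by (simp add: has_ord_def)
  qed
  then obtain j where "j > i" "has_ord n ?v j" using higher_ord[OF n _ _ a] c by auto
  thus ?thesis unfolding descends_def using Ev u(1) by metis
qed

text \<open>If the plus component had order \<open>j\<close>, then \<open>j\<close> would be an order in the plus part; if it had a
  larger order or were zero, the minus component would have order \<open>j\<close>.\<close>

lemma not_pos_neg_descends:
  assumes "\<not> pos j" "\<not> neg j" "has_ord n v j"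
  shows "\<exists>i<j. has_ord n (E *\<^sub>v v) i"
proof -
  note c = has_ord_carrier[OF assms(3)]
  have "E *\<^sub>v v \<noteq> 0\<^sub>v n" using assms by (auto simp: neg_def)
  then obtain i where i: "has_ord n (E *\<^sub>v v) i" using has_ord_exists[OF n E_carrier[OF c]] by blast
  have "i \<noteq> j" using assms(1) i c E_E unfolding pos_def by blast
  moreover have "\<not> j < i"
  proof
    assume "j < i"
    hence "has_ord n (v - E *\<^sub>v v) j"
      using i c by (intro has_ord_cong[OF assms(3), of _ 1]) (auto simp: coefs has_ord_def)
    moreover have "E *\<^sub>v (v - E *\<^sub>v v) = 0\<^sub>v n" using c by (simp add: E_diff)
    ultimately show False using assms(2) unfolding neg_def by blast
  qed
  ultimately show ?thesis using i by (metis linorder_neqE)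
qed

text \<open>Cancelling the leading terms of two vectors of order \<open>j\<close> raises the order. If the plus component
  keeps its order \<open>i\<close> in the process, then \<open>i\<close> is also reached from a larger index. This is how
  maximality of \<open>j\<close> is contradicted below.\<close>

lemma descends_raise:
  assumes v: "has_ord n v j" and w: "has_ord n w j"
    and Ev: "\<And>a. a \<noteq> 0 \<Longrightarrow> has_ord n (E *\<^sub>v v - fls_const a \<cdot>\<^sub>v (E *\<^sub>v w)) i" and ij: "i < j"
  shows "\<exists>j'>j. descends i j'"
proof -
  note c = has_ord_carrier[OF v] has_ord_carrier[OF w]
  obtain a where a: "a \<noteq> 0" "\<And>l. l \<le> j \<Longrightarrow> coef n (v - fls_const a \<cdot>\<^sub>v w) l = 0"
    using cancel_leading[OF n v w] by blast
  let ?v = "v - fls_const a \<cdot>\<^sub>v w"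
  have E': "has_ord n (E *\<^sub>v ?v) i" using Ev[OF a(1)] c by (simp add: E_diff E_smult)
  have "?v \<noteq> 0\<^sub>v n"
  proof
    assume "?v = 0\<^sub>v n"
    hence "E *\<^sub>v ?v = 0\<^sub>v n" using E by (auto simp: mult_mat_vec_def scalar_prod_def)
    thus False using E' n by (simp add: has_ord_def)
  qed
  then obtain j' where "j' > j" "has_ord n ?v j'" using higher_ord[OF n _ _ a(2)] c by auto
  thus ?thesis unfolding descends_def using E' ij by (metis less_trans)
qed

text \<open>A plus or minus vector of order \<open>j\<close> could be used to cancel the leading term of \<open>v\<close>. Its plus
  component vanishes or has order \<open>j > i\<close>, so that the plus component of \<open>v\<close> keeps its order.\<close>

lemma max_descends_not_pos_neg:
  assumes "descends i j" "\<forall>j'>j. \<not> descends i j'"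
  shows "\<not> pos j" "\<not> neg j"
proof -
  obtain v where v: "i < j" "has_ord n v j" "has_ord n (E *\<^sub>v v) i" using assms by (auto simp: descends_def)
  note c = has_ord_carrier[OF v(2)]
  show "\<not> pos j"
  proof
    assume "pos j"
    then obtain w where w: "has_ord n w j" "E *\<^sub>v w = w" by (auto simp: pos_def)
    have "has_ord n (E *\<^sub>v v - fls_const a \<cdot>\<^sub>v (E *\<^sub>v w)) i" for a
      by (rule has_ord_cong[OF v(3), of _ 1])
        (use v w c has_ord_carrier[OF w(1)] in \<open>auto simp: coefs has_ord_def\<close>)
    thus False using descends_raise[OF v(2) w(1) _ v(1)] assms(2) by blast
  qed
  show "\<not> neg j"
  proof
    assume "neg j"
    then obtain w where w: "has_ord n w j" "E *\<^sub>v w = 0\<^sub>v n" by (auto simp: neg_def)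
    have "has_ord n (E *\<^sub>v v - fls_const a \<cdot>\<^sub>v (E *\<^sub>v w)) i" for a
      by (rule has_ord_cong[OF v(3), of _ 1])
        (use v w c n has_ord_carrier[OF w(1)] in \<open>auto simp: coefs has_ord_def\<close>)
    thus False using descends_raise[OF v(2) w(1) _ v(1)] assms(2) by blast
  qed
qed

lemma pos_neg_linked:
  assumes "pos i" "neg i"
  shows "\<exists>j. linked i j"
proof -
  obtain C where C: "\<And>i j. descends i j \<Longrightarrow> j \<le> i + C" using descends_bounded by blast
  obtain j0 where "descends i j0" using pos_neg_descends[OF assms] by blast
  then obtain j where j: "descends i j" "\<forall>j'>j. \<not> descends i j'"
    using int_greatest[of "descends i" j0 "i + C"] C by force
  then obtain v where v: "i < j" "has_ord n v j" "has_ord n (E *\<^sub>v v) i" by (auto simp: descends_def)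
  \<comment> \<open>A plus component of larger order can be subtracted without changing the order of \<open>E v\<close>.\<close>
  have "\<not> descends i' j" if "i' > i" for i'
  proof
    assume "descends i' j"
    then obtain w where w: "has_ord n w j" "has_ord n (E *\<^sub>v w) i'" by (auto simp: descends_def)
    have "has_ord n (E *\<^sub>v v - fls_const a \<cdot>\<^sub>v (E *\<^sub>v w)) i" for a
      by (rule has_ord_cong[OF v(3), of _ 1])
        (use v w that has_ord_carrier[OF w(1)] has_ord_carrier[OF v(2)] in \<open>auto simp: coefs has_ord_def\<close>)
    thus False using descends_raise[OF v(2) w(1) _ v(1)] j(2) by blast
  qed
  thus ?thesis unfolding linked_def using j by blast
qed

lemma not_pos_neg_linked:
  assumes "\<not> pos j" "\<not> neg j"
  shows "\<exists>i. linked i j"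
proof -
  have "\<exists>v :: 'k fls vec. has_ord n v j"
  proof (rule index_cases[OF n, of j])
    fix m k assume m: "m < n" and j: "j = index n m k"
    from has_ord_shift[OF n has_ord_unit_vec[OF n m], of k] show ?thesis
      unfolding j index_def by blast
  qed
  then obtain v0 :: "'k fls vec" where v0: "has_ord n v0 j" by blast
  have "\<exists>i. descends i j" using not_pos_neg_descends[OF assms v0] v0 unfolding descends_def by blast
  then obtain i where i: "descends i j" "\<forall>i'>i. \<not> descends i' j"
    using int_greatest[of "\<lambda>i. descends i j" _ j] descends_less by fastforce
  then obtain v where v: "i < j" "has_ord n v j" "has_ord n (E *\<^sub>v v) i" by (auto simp: descends_def)
  \<comment> \<open>Subtracting a multiple of a vector of larger order keeps the order of \<open>v\<close> but can raise that of \<open>E v\<close>.\<close>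
  have "\<not> descends i j'" if "j' > j" for j'
  proof
    assume "descends i j'"
    then obtain w where w: "has_ord n w j'" "has_ord n (E *\<^sub>v w) i" by (auto simp: descends_def)
    note c = has_ord_carrier[OF v(2)] has_ord_carrier[OF w(1)]
    obtain a where a: "\<And>l. l \<le> i \<Longrightarrow> coef n (E *\<^sub>v v - fls_const a \<cdot>\<^sub>v (E *\<^sub>v w)) l = 0"
      using cancel_leading[OF n v(3) w(2)] by blast
    let ?v = "v - fls_const a \<cdot>\<^sub>v w"
    have "has_ord n ?v j"
      by (rule has_ord_cong[OF v(2), of _ 1]) (use v w that c in \<open>auto simp: coefs has_ord_def\<close>)
    then obtain i' where i': "i' < j" "has_ord n (E *\<^sub>v ?v) i'" "has_ord n ?v j"
      using not_pos_neg_descends[OF assms] by blast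
    have "\<not> i' \<le> i" using a[of i'] i' c by (auto simp: E_diff E_smult has_ord_def)
    thus False using i(2) i' unfolding descends_def by (meson linorder_not_le)
  qed
  thus ?thesis unfolding linked_def using i by blast
qed

lemma linked_unique:
  "linked i j \<Longrightarrow> linked i j' \<Longrightarrow> j = j'" "linked i j \<Longrightarrow> linked i' j \<Longrightarrow> i = i'"
  unfolding linked_def by (metis linorder_neqE)+

lemma linkedD:
  assumes "linked i j"
  shows "i < j" "pos i" "neg i" "\<not> pos j" "\<not> neg j"
  using assms descends_less descends_pos_neg max_descends_not_pos_neg unfolding linked_def by blast+

end

section \<open>A basis adapted to an idempotent\<close>

context idempotent_matrix
begin

lemma pos_shift: "pos (i + k * int n) \<longleftrightarrow> pos i"
proof -
  have "pos (j + k * int n)" if j: "pos j" for j k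
  proof -
    obtain x where x: "has_ord n x j" "E *\<^sub>v x = x" using j by (auto simp: pos_def)
    have "E *\<^sub>v (fls_X_intpow k \<cdot>\<^sub>v x) = fls_X_intpow k \<cdot>\<^sub>v x"
      using x has_ord_carrier[OF x(1)] by (simp add: E_smult)
    thus ?thesis unfolding pos_def using has_ord_shift[OF n x(1)] by blast
  qed
  from this[of i k] this[of "i + k * int n" "- k"] show ?thesis by auto
qed

lemma neg_shift: "neg (i + k * int n) \<longleftrightarrow> neg i"
proof -
  have "neg (j + k * int n)" if j: "neg j" for j k
  proof -
    obtain x where x: "has_ord n x j" "E *\<^sub>v x = 0\<^sub>v n" using j by (auto simp: neg_def)
    have "E *\<^sub>v (fls_X_intpow k \<cdot>\<^sub>v x) = 0\<^sub>v n"
      using x has_ord_carrier[OF x(1)] by (simp add: E_smult smult_zero_vec)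
    thus ?thesis unfolding neg_def using has_ord_shift[OF n x(1)] by blast
  qed
  from this[of i k] this[of "i + k * int n" "- k"] show ?thesis by auto
qed

lemma descends_shift: "descends (i + k * int n) (j + k * int n) \<longleftrightarrow> descends i j"
proof -
  have "descends (i + k * int n) (j + k * int n)" if d: "descends i j" for i j k
  proof -
    obtain v where v: "i < j" "has_ord n v j" "has_ord n (E *\<^sub>v v) i"
      using d by (auto simp: descends_def)
    have "has_ord n (E *\<^sub>v (fls_X_intpow k \<cdot>\<^sub>v v)) (i + k * int n)"
      using has_ord_shift[OF n v(3), of k] has_ord_carrier[OF v(2)] by (simp add: E_smult)
    thus ?thesis unfolding descends_def using has_ord_shift[OF n v(2)] v(1) by auto
  qed
  from this[of i j k] this[of "i + k * int n" "j + k * int n" "- k"] show ?thesis by auto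
qed

lemma linked_shift: "linked (i + k * int n) (j + k * int n) \<longleftrightarrow> linked i j"
proof -
  have "linked (i + k * int n) (j + k * int n)" if l: "linked i j" for i j k
    unfolding linked_def
  proof (intro conjI allI impI)
    show "descends (i + k * int n) (j + k * int n)" using l by (simp add: linked_def descends_shift)
    fix j' assume "j + k * int n < j'"
    moreover have "descends (i + k * int n) j' \<longleftrightarrow> descends i (j' - k * int n)"
      using descends_shift[of i k "j' - k * int n"] by simp
    ultimately show "\<not> descends (i + k * int n) j'" using l by (simp add: linked_def)
  next
    fix i' assume "i + k * int n < i'"
    moreover have "descends i' (j + k * int n) \<longleftrightarrow> descends (i' - k * int n) j"
      using descends_shift[of "i' - k * int n" k j] by simp
    ultimately show "\<not> descends i' (j + k * int n)" using l by (simp add: linked_def)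
  qed
  from this[of i j k] this[of "i + k * int n" "j + k * int n" "- k"] show ?thesis by auto
qed

text \<open>The smaller index of a linked pair serves as the label of both. This choice is compatible with
  translation by \<open>n\<close>.\<close>

definition clan :: "int \<Rightarrow> clan_entry" where
  "clan i = (if pos i then if neg i then Label i else Plus
     else if neg i then Minus else Label (THE l. linked l i))"

lemma clan_upper: "linked i j \<Longrightarrow> clan i = Label i"
  using linkedD[of i j] by (simp add: clan_def)

lemma clan_lower: "linked i j \<Longrightarrow> clan j = Label i"
  using linkedD[of i j] linked_unique(2) by (auto simp: clan_def intro!: the_equality)

lemma clan_cases:
  obtains "clan i = Plus" "pos i" "\<not> neg i" | "clan i = Minus" "\<not> pos i" "neg i"
  | j where "linked i j" | j where "linked j i"
  using pos_neg_linked[of i] not_pos_neg_linked[of i] by (auto simp: clan_def split: if_splits)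

lemma clan_eq_Label_iff: "clan i = Label m \<longleftrightarrow> (\<exists>j. linked m j \<and> (i = m \<or> i = j))"
proof (cases rule: clan_cases[of i])
  case (3 j)
  moreover have "\<not> linked m i" using linkedD(2)[OF 3] linkedD(4) by blast
  ultimately show ?thesis using clan_upper[OF 3] by auto
next
  case (4 j)
  moreover have "\<not> linked i l" for l using linkedD(4)[OF 4] linkedD(2) by blast
  moreover have "linked l i \<longleftrightarrow> l = j" for l using 4 linked_unique(2) by blast
  ultimately show ?thesis using clan_lower[OF 4] by auto
next
  case 1
  hence "\<not> linked i l" "\<not> linked l i" for l using linkedD(3,4) by blast+
  thus ?thesis using 1 by auto
next
  case 2
  hence "\<not> linked i l" "\<not> linked l i" for l using linkedD(2,5) by blast+
  thus ?thesis using 2 by auto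
qed

lemma clan_shape_clan: "clan_shape n clan"
  unfolding clan_shape_def
proof (intro conjI allI impI)
  fix i k m assume "clan i = Label m"
  thus "clan (i + k * int n) = Label (m + k * int n)"
    unfolding clan_eq_Label_iff using linked_shift by auto
next
  fix i assume "clan i \<in> {Plus, Minus}"
  thus "clan (i + int n) = clan i"
    using pos_shift[of i 1] neg_shift[of i 1] by (auto simp: clan_def split: if_splits)
next
  fix m assume "\<exists>i. clan i = Label m"
  then obtain j where j: "linked m j" by (auto simp: clan_eq_Label_iff)
  hence "linked m l \<longleftrightarrow> l = j" for l using linked_unique(1) by blast
  hence "{i. clan i = Label m} = {m, j}" by (auto simp: clan_eq_Label_iff)
  thus "card {i. clan i = Label m} = 2" using linkedD(1)[OF j] by simp
qed

lemma mate_linked: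
  assumes "linked i j"
  shows "mate clan i = j" "mate clan j = i"
  using mateI[OF clan_shape_clan clan_upper[OF assms] clan_lower[OF assms]]
    mateI[OF clan_shape_clan clan_lower[OF assms] clan_upper[OF assms]] linkedD(1)[OF assms] by auto

text \<open>The requirements on the vector chosen at \<open>i\<close>. At the larger index of a linked pair there are none,
  because the vector chosen at the smaller index provides both basis vectors of the pair.\<close>

definition good :: "int \<Rightarrow> 'k fls vec \<Rightarrow> bool" where
  "good i w \<longleftrightarrow> w \<in> carrier_vec n \<and>
    (clan i = Plus \<longrightarrow> has_ord n w i \<and> E *\<^sub>v w = w) \<and>
    (clan i = Minus \<longrightarrow> has_ord n w i \<and> E *\<^sub>v w = 0\<^sub>v n) \<and>
    (\<forall>j. linked i j \<longrightarrow> has_ord n w j \<and> has_ord n (E *\<^sub>v w) i)"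

lemma good_exists: "\<exists>w. good i w"
proof (cases rule: clan_cases[of i])
  case (3 j)
  then obtain v where v: "has_ord n v j" "has_ord n (E *\<^sub>v v) i" by (auto simp: linked_def descends_def)
  moreover have "linked i l \<longleftrightarrow> l = j" for l using 3 linked_unique(1) by blast
  ultimately have "good i v" using clan_upper[OF 3] has_ord_carrier[OF v(1)]
    unfolding good_def by simp
  thus ?thesis ..
next
  case (4 j)
  moreover have "\<not> linked i l" for l using linkedD(4)[OF 4] linkedD(2) by blast
  ultimately have "good i (0\<^sub>v n)" using clan_lower[OF 4] unfolding good_def by simp
  thus ?thesis ..
next
  case 1
  hence "\<not> linked i j" for j using linkedD(3) by blast
  moreover obtain w where "has_ord n w i" "E *\<^sub>v w = w" using 1 pos_def by blast
  ultimately have "good i w" using 1 has_ord_carrier[of n w i] unfolding good_def by simp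
  thus ?thesis ..
next
  case 2
  hence "\<not> linked i j" for j using linkedD(2) by blast
  moreover obtain w where "has_ord n w i" "E *\<^sub>v w = 0\<^sub>v n" using 2 neg_def by blast
  ultimately have "good i w" using 2 has_ord_carrier[of n w i] unfolding good_def by simp
  thus ?thesis ..
qed

lemma good_shift:
  assumes g: "good i w"
  shows "good (i + k * int n) (fls_X_intpow k \<cdot>\<^sub>v w)"
proof -
  have w: "w \<in> carrier_vec n" using g by (simp add: good_def)
  note z = smult_zero_vec[of "fls_X_intpow k :: 'k fls" n]
  note up = has_ord_shift[OF n, of _ _ k] and Ew = E_smult[OF w, of "fls_X_intpow k"]
    and signs = clan_shift_iff[OF clan_shape_clan, of i k]
  show ?thesis unfolding good_def Ew
  proof (intro conjI impI allI)
    show "fls_X_intpow k \<cdot>\<^sub>v w \<in> carrier_vec n" using w by simp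
  next
    assume "clan (i + k * int n) = Plus"
    hence "has_ord n w i" "E *\<^sub>v w = w" using g by (simp_all only: good_def signs simp_thms)
    thus "has_ord n (fls_X_intpow k \<cdot>\<^sub>v w) (i + k * int n)"
      "fls_X_intpow k \<cdot>\<^sub>v (E *\<^sub>v w) = fls_X_intpow k \<cdot>\<^sub>v w" using up by (blast, simp only:)
  next
    assume "clan (i + k * int n) = Minus"
    hence "has_ord n w i" "E *\<^sub>v w = 0\<^sub>v n" using g by (simp_all only: good_def signs simp_thms)
    thus "has_ord n (fls_X_intpow k \<cdot>\<^sub>v w) (i + k * int n)"
      "fls_X_intpow k \<cdot>\<^sub>v (E *\<^sub>v w) = 0\<^sub>v n" using up z by (blast, simp only:)
  next
    fix j assume "linked (i + k * int n) j"
    hence "linked i (j - k * int n)" using linked_shift[of i k "j - k * int n"] by simp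
    hence "has_ord n w (j - k * int n)" "has_ord n (E *\<^sub>v w) i" using g by (auto simp: good_def)
    from up[OF this(1)] up[OF this(2)]
    show "has_ord n (fls_X_intpow k \<cdot>\<^sub>v w) j"
      "has_ord n (fls_X_intpow k \<cdot>\<^sub>v (E *\<^sub>v w)) (i + k * int n)" by simp_all
  qed
qed

text \<open>Choosing only at the residues and translating makes the family compatible with multiplication
  by \<open>t\<close>.\<close>

definition chosen :: "int \<Rightarrow> 'k fls vec" where
  "chosen i = fls_X_intpow ((i - 1) div int n) \<cdot>\<^sub>v (SOME w. good (residue n i) w)"

lemma good_chosen: "good i (chosen i)"
proof -
  have "good (residue n i) (SOME w. good (residue n i) w)" by (rule someI_ex[OF good_exists])
  from good_shift[OF this, of "(i - 1) div int n"] show ?thesis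
    unfolding chosen_def residue_decomp[of i n, symmetric] .
qed

lemma chosen_shift: "chosen (i + k * int n) = fls_X_intpow k \<cdot>\<^sub>v chosen i"
  using n by (simp add: chosen_def level_shift smult_smult_assoc fls_X_intpow_times_fls_X_intpow)

text \<open>The vector \<open>v\<close> chosen for a linked pair \<open>i < j\<close> has order \<open>j\<close>, and \<open>E v\<close> has order \<open>i\<close>.\<close>

definition basis :: "int \<Rightarrow> 'k fls vec" where
  "basis i = (if clan i = Plus \<or> clan i = Minus then chosen i
     else if i < mate clan i then E *\<^sub>v chosen i else chosen (mate clan i))"

lemma basis_linked:
  assumes "linked i j"
  shows "basis i = E *\<^sub>v chosen i" "basis j = chosen i"
  using mate_linked[OF assms] linkedD(1)[OF assms] clan_upper[OF assms] clan_lower[OF assms]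
  by (simp_all add: basis_def)

lemma has_ord_basis: "has_ord n (basis i) i"
proof (cases rule: clan_cases[of i])
  case (3 j)
  thus ?thesis using basis_linked(1)[OF 3] good_chosen[of i] by (simp add: good_def)
next
  case (4 j)
  thus ?thesis using basis_linked(2)[OF 4] good_chosen[of j] by (simp add: good_def)
qed (use good_chosen[of i] in \<open>simp_all add: good_def basis_def\<close>)

lemma basis_shift: "basis (i + k * int n) = fls_X_intpow k \<cdot>\<^sub>v basis i"
proof -
  have "chosen i \<in> carrier_vec n" using good_chosen[of i] by (simp add: good_def)
  thus ?thesis unfolding basis_def
    using clan_shift_iff[OF clan_shape_clan, of i k] mate_shift[OF clan_shape_clan, of i k]
      chosen_shift E_smult by simp
qed

lemma E_basis:
  "E *\<^sub>v basis i = (if clan i = Minus then 0\<^sub>v n else basis (min i (mate clan i)))"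
proof (cases rule: clan_cases[of i])
  case (3 j)
  thus ?thesis using basis_linked(1)[OF 3] good_chosen[of i] mate_linked(1)[OF 3] linkedD(1)[OF 3]
    clan_upper[OF 3] by (simp add: good_def min_def)
next
  case (4 j)
  thus ?thesis using basis_linked[OF 4] mate_linked(2)[OF 4] linkedD(1)[OF 4] clan_lower[OF 4]
    by (simp add: min_def)
qed (use good_chosen[of i] mate_sign[of clan i] in \<open>simp_all add: good_def basis_def\<close>)

end

section \<open>The Iwahori subgroup and its flags\<close>

lemma carrier_GL:
  "M \<in> carrier (GL n) \<longleftrightarrow> M \<in> carrier_mat n n \<and> (\<exists>N \<in> carrier_mat n n. M * N = 1\<^sub>m n \<and> N * M = 1\<^sub>m n)"
  unfolding GL_def units_of_carrier Units_def by (auto simp: ring_mat_simps)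

lemma GL_carrier_mat: "x \<in> carrier (GL n) \<Longrightarrow> x \<in> carrier_mat n n"
  by (simp add: carrier_GL)

lemma mult_GL [simp]: "mult (GL n) = (*)"
  by (simp add: GL_def units_of_mult ring_mat_simps)

lemma GL_closed:
  assumes "M \<in> carrier (GL n)" "N \<in> carrier (GL n)"
  shows "M * N \<in> carrier (GL n)"
proof -
  obtain M' N' where M: "M \<in> carrier_mat n n" "M' \<in> carrier_mat n n" "M * M' = 1\<^sub>m n" "M' * M = 1\<^sub>m n"
    and N: "N \<in> carrier_mat n n" "N' \<in> carrier_mat n n" "N * N' = 1\<^sub>m n" "N' * N = 1\<^sub>m n"
    using assms by (auto simp: carrier_GL)
  have "M * N * (N' * M') = M * ((N * N') * M')"
    using M(1,2) N(1,2) by (simp add: assoc_mult_mat[of _ n n _ n _ n])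
  moreover have "N' * M' * (M * N) = N' * ((M' * M) * N)"
    using M(1,2) N(1,2) by (simp add: assoc_mult_mat[of _ n n _ n _ n])
  ultimately show ?thesis unfolding carrier_GL using M N by (intro conjI bexI[of _ "N' * M'"]) auto
qed

lemma fls_times_nth_leading:
  fixes a b :: "'k :: field fls"
  assumes "\<And>j. j < 0 \<Longrightarrow> fls_nth a j = 0" "\<And>j. j < k \<Longrightarrow> fls_nth b j = 0"
  shows "fls_nth (a * b) k = fls_nth a 0 * fls_nth b k"
proof -
  have "fls_nth ((a - fls_const (fls_nth a 0)) * b) k = 0"
    by (rule fls_times_nth_vanish[of 1]) (use assms in \<open>auto simp: less_le\<close>)
  thus ?thesis by (simp add: left_diff_distrib)
qed

interpretation constant_term: comm_ring_hom "\<lambda>f :: 'k :: field fps. fps_nth f 0"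
  by unfold_locales auto

interpretation fps_to_fls: comm_ring_hom "fps_to_fls :: 'k :: field fps \<Rightarrow> 'k fls"
  by unfold_locales (auto simp: fls_times_fps_to_fls)

text \<open>Setting \<open>t = 0\<close> is a ring homomorphism, so that the reduction of an Iwahori matrix is an invertible
  upper triangular matrix; hence its diagonal entries are not zero.\<close>

lemma iwahoriE:
  assumes "b \<in> iwahori n"
  obtains M N where "M \<in> carrier_mat n n" "N \<in> carrier_mat n n" "M * N = 1\<^sub>m n" "N * M = 1\<^sub>m n"
    "b = map_mat fps_to_fls M" "\<And>r m. r < n \<Longrightarrow> m < r \<Longrightarrow> fps_nth (M $$ (r, m)) 0 = 0"
    "\<And>m. m < n \<Longrightarrow> fps_nth (M $$ (m, m)) 0 \<noteq> 0"
proof -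
  obtain M where M: "M \<in> carrier (GL n)" "upper_triangular (map_mat (\<lambda>f. fps_nth f 0) M)"
      "b = map_mat fps_to_fls M"
    using assms by (auto simp: iwahori_def)
  then obtain N where N: "M \<in> carrier_mat n n" "N \<in> carrier_mat n n" "M * N = 1\<^sub>m n" "N * M = 1\<^sub>m n"
    by (auto simp: carrier_GL)
  let ?M = "map_mat (\<lambda>f. fps_nth f 0) M" and ?N = "map_mat (\<lambda>f. fps_nth f 0) N"
  have "?M * ?N = 1\<^sub>m n"
    using constant_term.mat_hom_mult[OF N(1,2)] N(3) constant_term.mat_hom_one by metis
  hence "det ?M * det ?N = 1" using N by (metis det_mult det_one map_carrier_mat)
  moreover have "det ?M = prod_list (diag_mat ?M)"
    using M(2) N(1) by (intro det_upper_triangular[of _ n]) auto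
  ultimately have "prod_list (diag_mat ?M) * det ?N = 1" by metis
  hence "prod_list (diag_mat ?M) \<noteq> 0" by (metis mult_zero_left zero_neq_one)
  hence "0 \<notin> set (diag_mat ?M)" by (simp add: prod_list_zero_iff)
  hence "fps_nth (M $$ (m, m)) 0 \<noteq> 0" if "m < n" for m
    using that N(1) by (force simp: diag_mat_def image_iff)
  moreover have "fps_nth (M $$ (r, m)) 0 = 0" if "r < n" "m < r" for r m
    using M(2) that N(1) by (auto simp: upper_triangular_def)
  ultimately show ?thesis using that N M(3) by blast
qed

lemma iwahori_GL: "b \<in> iwahori n \<Longrightarrow> b \<in> carrier (GL n)"
proof (elim iwahoriE)
  fix M N :: "'a fps mat"
  assume N: "M \<in> carrier_mat n n" "N \<in> carrier_mat n n" "M * N = 1\<^sub>m n" "N * M = 1\<^sub>m n"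
    and b: "b = map_mat fps_to_fls M"
  show "b \<in> carrier (GL n)" unfolding carrier_GL
  proof (intro conjI bexI[of _ "map_mat fps_to_fls N"])
    show "b * map_mat fps_to_fls N = 1\<^sub>m n" "map_mat fps_to_fls N * b = 1\<^sub>m n"
      unfolding b using fps_to_fls.mat_hom_mult[OF N(1,2)] fps_to_fls.mat_hom_mult[OF N(2,1)] N
        fps_to_fls.mat_hom_one by metis+
  qed (use N b in auto)
qed

text \<open>At the indices up to the order of \<open>x\<close> only the constant terms of the diagonal entries contribute to
  the coefficients of \<open>b x\<close>: the entries below the diagonal have no constant term, and all other
  products involve coefficients of \<open>x\<close> below its order.\<close>

lemma has_ord_iwahori:
  assumes n: "0 < n" and b: "b \<in> iwahori n" and x: "has_ord n x i"
  shows "has_ord n (b *\<^sub>v x) i"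
  using b
proof (rule iwahoriE)
  fix M N :: "'a fps mat"
  assume M: "M \<in> carrier_mat n n" and b: "b = map_mat fps_to_fls M"
    and low: "\<And>r m. r < n \<Longrightarrow> m < r \<Longrightarrow> fps_nth (M $$ (r, m)) 0 = 0"
    and diag: "\<And>m. m < n \<Longrightarrow> fps_nth (M $$ (m, m)) 0 \<noteq> 0"
  have xc: "x \<in> carrier_vec n" using x by (simp add: has_ord_def)
  have leading: "coef n (b *\<^sub>v x) (index n r k) = fps_nth (M $$ (r, r)) 0 * coef n x (index n r k)"
    if r: "r < n" and le: "index n r k \<le> i" for r k
  proof -
    have "fls_nth (fps_to_fls (M $$ (r, m)) * x $ m) k = fps_nth (M $$ (r, m)) 0 * coef n x (index n m k)"
      if m: "m < n" for m
    proof -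
      have "fls_nth (x $ m) j = 0" if "j < k" for j
      proof -
        have "j * int n \<le> (k - 1) * int n" using that by (intro mult_right_mono) auto
        hence "index n m j < i" using le r m unfolding index_def by (simp add: algebra_simps)
        thus ?thesis using x coef_index[OF m, of x j] by (simp add: has_ord_def)
      qed
      thus ?thesis by (subst fls_times_nth_leading) (auto simp: coef_index[OF m])
    qed
    hence "coef n (b *\<^sub>v x) (index n r k) = (\<Sum>m = 0..<n. fps_nth (M $$ (r, m)) 0 * coef n x (index n m k))"
      using r xc M by (simp add: coef_index b scalar_prod_def fls_nth_sum)
    also have "\<dots> = (\<Sum>m = 0..<n. if m = r then fps_nth (M $$ (r, r)) 0 * coef n x (index n r k) else 0)"
    proof (rule sum.cong[OF refl])
      fix m assume "m \<in> {0..<n}"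
      moreover have "coef n x (index n m k) = 0" if "r < m"
        using that le x unfolding index_def by (simp add: has_ord_def)
      ultimately show "fps_nth (M $$ (r, m)) 0 * coef n x (index n m k) =
          (if m = r then fps_nth (M $$ (r, r)) 0 * coef n x (index n r k) else 0)"
        using low[OF r, of m] by (cases m r rule: linorder_cases) auto
    qed
    also have "\<dots> = fps_nth (M $$ (r, r)) 0 * coef n x (index n r k)" using r by simp
    finally show ?thesis .
  qed
  have "coef n (b *\<^sub>v x) l = 0 \<longleftrightarrow> coef n x l = 0" if "l \<le> i" for l
    by (rule index_cases[OF n, of l]) (use leading that diag in auto)
  thus ?thesis using x M b by (auto simp: has_ord_def)
qed

text \<open>The orders of the columns say that the entries are integral, that the reduction is upper triangular
  and that its diagonal entries are not zero. The determinant is then a unit among the power series, and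
  the adjugate matrix yields an integral inverse.\<close>

lemma iwahoriI:
  assumes n: "0 < n" and b: "b \<in> carrier_mat n n"
    and ord: "\<And>m. m < n \<Longrightarrow> has_ord n (col b m) (int n - int m)"
  shows "b \<in> iwahori n"
proof -
  define M where "M = map_mat fls_regpart b"
  have M: "M \<in> carrier_mat n n" using b by (simp add: M_def)
  have coef_b: "coef n (col b m) (index n r k) = fls_nth (b $$ (r, m)) k" if "r < n" "m < n" for r m k
    using that b by (simp add: coef_index)
  have neg: "fls_nth (b $$ (r, m)) k = 0" if "r < n" "m < n" "k < 0" for r m k
  proof -
    have "k * int n \<le> (-1) * int n" using that by (intro mult_right_mono) auto
    hence "index n r k < int n - int m" using that by (simp add: index_def)
    thus ?thesis using ord[of m] that coef_b[of r m k] by (simp add: has_ord_def)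
  qed
  have "b $$ (r, m) = fps_to_fls (fls_regpart (b $$ (r, m)))" if "r < n" "m < n" for r m
    by (rule fls_eqI) (use neg[OF that] in auto)
  hence bM: "b = map_mat fps_to_fls M" using b by (auto simp: M_def)
  have low: "fps_nth (M $$ (r, m)) 0 = 0" if "r < n" "m < r" for r m
    using that b ord[of m] coef_b[of r m 0] by (simp add: M_def has_ord_def index_def)
  have diag: "fps_nth (M $$ (m, m)) 0 \<noteq> 0" if "m < n" for m
    using that b ord[of m] coef_b[of m m 0] by (simp add: M_def has_ord_def index_def)
  let ?M = "map_mat (\<lambda>f. fps_nth f 0) M"
  have ut: "upper_triangular ?M" using low M by (auto simp: upper_triangular_def)
  hence "det ?M = prod_list (diag_mat ?M)" using M by (intro det_upper_triangular[of _ n]) auto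
  hence "det ?M \<noteq> 0" using diag M by (auto simp: diag_mat_def prod_list_zero_iff)
  hence unit: "det M * inverse (det M) = 1" by (simp add: inverse_mult_eq_1')
  let ?N = "inverse (det M) \<cdot>\<^sub>m adj_mat M"
  note adj = adj_mat[OF M]
  have "inverse (det M) \<cdot>\<^sub>m (det M \<cdot>\<^sub>m 1\<^sub>m n) = 1\<^sub>m n"
    by (rule eq_matI) (use unit in \<open>auto simp: mult.commute\<close>)
  hence "M * ?N = 1\<^sub>m n" "?N * M = 1\<^sub>m n"
    using mult_smult_distrib[OF M adj(1)] mult_smult_assoc_mat[OF adj(1) M] adj(2,3) by simp_all
  hence "M \<in> carrier (GL n)" using M adj(1) by (auto simp: carrier_GL)
  thus ?thesis unfolding iwahori_def using bM ut by blast
qed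

text \<open>In this description the group laws for the Iwahori subgroup are immediate.\<close>

lemma iwahori_iff:
  fixes b :: "'k :: field fls mat"
  assumes n: "0 < n"
  shows "b \<in> iwahori n \<longleftrightarrow> b \<in> carrier_mat n n \<and> (\<forall>x i. has_ord n x i \<longrightarrow> has_ord n (b *\<^sub>v x) i)"
proof
  assume "b \<in> iwahori n"
  thus "b \<in> carrier_mat n n \<and> (\<forall>x i. has_ord n x i \<longrightarrow> has_ord n (b *\<^sub>v x) i)"
    using has_ord_iwahori[OF n] GL_carrier_mat[OF iwahori_GL] by blast
next
  assume b: "b \<in> carrier_mat n n \<and> (\<forall>x i. has_ord n x i \<longrightarrow> has_ord n (b *\<^sub>v x) i)"
  show "b \<in> iwahori n"
  proof (rule iwahoriI[OF n])
    fix m assume m: "m < n"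
    have "b *\<^sub>v unit_vec n m = col b m" using b m by (intro mat_mult_unit_vec) auto
    thus "has_ord n (col b m) (int n - int m)" using b has_ord_unit_vec[OF n m] by metis
  qed (use b in blast)
qed

lemma iwahori_mult:
  fixes b b' :: "'k :: field fls mat"
  assumes n: "0 < n" and b: "b \<in> iwahori n" and b': "b' \<in> iwahori n"
  shows "b * b' \<in> iwahori n"
  unfolding iwahori_iff[OF n]
proof (intro conjI allI impI)
  note c = GL_carrier_mat[OF iwahori_GL[OF b]] GL_carrier_mat[OF iwahori_GL[OF b']]
  show "b * b' \<in> carrier_mat n n" using c by (rule mult_carrier_mat)
  fix x :: "'k fls vec" and i assume x: "has_ord n x i"
  show "has_ord n (b * b' *\<^sub>v x) i"
    unfolding assoc_mult_mat_vec[OF c has_ord_carrier[OF x]] by (intro has_ord_iwahori n b b' x)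
qed

lemma iwahori_inverse:
  fixes b b' :: "'k :: field fls mat"
  assumes n: "0 < n" and b: "b \<in> iwahori n" and b': "b' \<in> carrier_mat n n" "b * b' = 1\<^sub>m n"
  shows "b' \<in> iwahori n"
  unfolding iwahori_iff[OF n]
proof (intro conjI allI impI b'(1))
  fix x :: "'k fls vec" and i assume x: "has_ord n x i"
  note xc = has_ord_carrier[OF x] and bc = GL_carrier_mat[OF iwahori_GL[OF b]]
  have bb: "b *\<^sub>v (b' *\<^sub>v x) = x"
    unfolding assoc_mult_mat_vec[OF bc b'(1) xc, symmetric] b'(2) using xc by simp
  have b'x: "b' *\<^sub>v x \<in> carrier_vec n" using b'(1) xc by (rule mult_mat_vec_carrier)
  have "b' *\<^sub>v x \<noteq> 0\<^sub>v n"
  proof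
    assume "b' *\<^sub>v x = 0\<^sub>v n"
    hence "x = 0\<^sub>v n" using bb mult_mat_zero_vec[OF bc] by simp
    thus False using x n by (simp add: has_ord_def)
  qed
  then obtain l where l: "has_ord n (b' *\<^sub>v x) l" using has_ord_exists[OF n b'x] by blast
  from has_ord_iwahori[OF n b this] have "l = i" unfolding bb using x has_ord_unique by blast
  thus "has_ord n (b' *\<^sub>v x) i" using l by simp
qed

lemma one_iwahori: "0 < n \<Longrightarrow> 1\<^sub>m n \<in> iwahori n"
  by (simp add: iwahori_iff has_ord_def)

text \<open>The lattices of the flag of the identity matrix.\<close>

definition std_lattice :: "nat \<Rightarrow> int \<Rightarrow> 'k :: field fls vec set" where
  "std_lattice n i = {x \<in> carrier_vec n. \<forall>l<i. coef n x l = 0}"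

lemma std_latticeD: "x \<in> std_lattice n i \<Longrightarrow> x \<in> carrier_vec n"
  by (simp add: std_lattice_def)

lemma iwahori_std_lattice:
  fixes b :: "'k :: field fls mat"
  assumes n: "0 < n" and b: "b \<in> iwahori n"
  shows "(\<lambda>x. b *\<^sub>v x) ` std_lattice n i = std_lattice n i"
proof -
  obtain b' where b': "b' \<in> carrier_mat n n" "b * b' = 1\<^sub>m n"
    using iwahori_GL[OF b] by (auto simp: carrier_GL)
  have stable: "a *\<^sub>v x \<in> std_lattice n i" if a: "a \<in> iwahori n" and x: "x \<in> std_lattice n i"
    for a :: "'k fls mat" and x
  proof (cases "x = 0\<^sub>v n")
    case True
    thus ?thesis using mult_mat_zero_vec[OF GL_carrier_mat[OF iwahori_GL[OF a]]] x by simp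
  next
    case False
    then obtain l where l: "has_ord n x l" using has_ord_exists[OF n std_latticeD[OF x]] by blast
    hence "i \<le> l" using x by (auto simp: has_ord_def std_lattice_def not_less[symmetric])
    thus ?thesis using has_ord_iwahori[OF n a l] by (simp add: has_ord_def std_lattice_def)
  qed
  show ?thesis
  proof (intro equalityI subsetI)
    fix y :: "'k fls vec" assume y: "y \<in> std_lattice n i"
    have "b *\<^sub>v (b' *\<^sub>v y) = y"
      unfolding assoc_mult_mat_vec[OF GL_carrier_mat[OF iwahori_GL[OF b]] b'(1) std_latticeD[OF y], symmetric] b'(2)
      using std_latticeD[OF y] by simp
    thus "y \<in> (\<lambda>x. b *\<^sub>v x) ` std_lattice n i" using stable[OF iwahori_inverse[OF n b b'] y] by (metis image_eqI)
  qed (use stable[OF b] in auto)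
qed

lemma std_lattice_shift:
  assumes n: "0 < n"
  shows "(\<lambda>x. fls_X_intpow k \<cdot>\<^sub>v x) ` std_lattice n i = (std_lattice n (i + k * int n) :: 'k :: field fls vec set)"
proof -
  have mem: "fls_X_intpow k \<cdot>\<^sub>v x \<in> std_lattice n (i + k * int n)" if "x \<in> std_lattice n i"
    for i k and x :: "'k fls vec"
  proof -
    have x: "x \<in> carrier_vec n" using that by (rule std_latticeD)
    have "coef n (fls_X_intpow k \<cdot>\<^sub>v x) l = coef n x (l - k * int n)" for l
      using coef_shift[OF n x, of k "l - k * int n"] by simp
    thus ?thesis using that x by (simp add: std_lattice_def)
  qed
  show ?thesis
  proof (intro equalityI subsetI)
    fix y :: "'k fls vec" assume y: "y \<in> std_lattice n (i + k * int n)"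
    have "fls_X_intpow (- k) \<cdot>\<^sub>v y \<in> std_lattice n i" using mem[OF y, of "- k"] by simp
    moreover have "y = fls_X_intpow k \<cdot>\<^sub>v (fls_X_intpow (- k) \<cdot>\<^sub>v y)"
      by (simp only: smult_smult_assoc fls_X_intpow_times_fls_X_intpow) simp
    ultimately show "y \<in> (\<lambda>x. fls_X_intpow k \<cdot>\<^sub>v x) ` std_lattice n i" by blast
  qed (use mem in auto)
qed

lemma in_range_fps_to_fls:
  fixes a :: "'k :: field fls"
  assumes "\<And>k. k < 0 \<Longrightarrow> fls_nth a k = 0"
  shows "a \<in> range fps_to_fls"
proof -
  have "a = fps_to_fls (fls_regpart a)" by (rule fls_eqI) (use assms in auto)
  thus ?thesis by blast
qed

text \<open>The span of a set of vectors is determined by its definition only once the scalars and the vectors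
  are known to form a module.\<close>

lemma module_power_series_ring:
  "Module.module (power_series_ring :: 'k :: field fls ring) (laurent_space n)"
proof (rule module_criteria)
  have neg: "\<exists>y\<in>range fps_to_fls. x + y = 0" if x: "x \<in> range fps_to_fls" for x :: "'k fls"
  proof -
    obtain f where f: "x = fps_to_fls f" using x by blast
    have "x + fps_to_fls (- f) = 0" by (simp add: f)
    thus ?thesis by blast
  qed
  have zero: "(0 :: 'k fls) \<in> range fps_to_fls" "(1 :: 'k fls) \<in> range fps_to_fls"
    by (auto simp: image_iff intro: exI[of _ 0] exI[of _ 1])
  have add: "x + y \<in> range fps_to_fls" "x * y \<in> range fps_to_fls"
    if "x \<in> range fps_to_fls" "y \<in> range fps_to_fls" for x y :: "'k fls"
    using that by (auto simp flip: fls_times_fps_to_fls fps_to_fls_plus)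
  show "cring (power_series_ring :: 'k fls ring)"
  proof (rule cringI)
    show "abelian_group (power_series_ring :: 'k fls ring)"
      by (rule abelian_groupI) (use zero add neg in \<open>simp_all add: ac_simps\<close>)
    show "comm_monoid (power_series_ring :: 'k fls ring)"
      by (rule comm_monoidI) (use zero add in \<open>simp_all add: ac_simps\<close>)
  qed (simp add: distrib_right)
qed (auto simp: module_vec_simps smult_smult_assoc smult_add_distrib_vec add_smult_distrib_vec
    intro!: comm_add_vec bexI[of _ "- _"])

lemma submodule_lattice:
  assumes n: "0 < n" and g: "g \<in> carrier_mat n n"
  shows "submodule (power_series_ring :: 'k :: field fls ring) ((\<lambda>x. g *\<^sub>v x) ` std_lattice n i) (laurent_space n)"
proof (rule submodule.intro)
  note [simp] = module_vec_simps
  show "(\<lambda>x. g *\<^sub>v x) ` std_lattice n i \<subseteq> carrier (laurent_space n)"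
    using g by (auto dest: std_latticeD)
  show "v \<oplus>\<^bsub>laurent_space n\<^esub> w \<in> (\<lambda>x. g *\<^sub>v x) ` std_lattice n i"
    if vw: "v \<in> (\<lambda>x. g *\<^sub>v x) ` std_lattice n i" "w \<in> (\<lambda>x. g *\<^sub>v x) ` std_lattice n i" for v w
  proof -
    obtain x y where xy: "x \<in> std_lattice n i" "y \<in> std_lattice n i" "v = g *\<^sub>v x" "w = g *\<^sub>v y"
      using vw by blast
    moreover have "x + y \<in> std_lattice n i" using xy n by (auto simp: std_lattice_def coef_add)
    moreover have "g *\<^sub>v (x + y) = v + w"
      using xy g by (simp add: mult_add_distrib_mat_vec[OF g] std_latticeD)
    ultimately show ?thesis by (metis image_eqI module_vec_simps(1))
  qed
  have "g *\<^sub>v 0\<^sub>v n = 0\<^sub>v n" "0\<^sub>v n \<in> std_lattice n i"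
    using mult_mat_zero_vec[OF g] n by (auto simp: std_lattice_def)
  thus "\<zero>\<^bsub>laurent_space n\<^esub> \<in> (\<lambda>x. g *\<^sub>v x) ` std_lattice n i" by (metis image_eqI module_vec_simps(2))
  show "c \<odot>\<^bsub>laurent_space n\<^esub> v \<in> (\<lambda>x. g *\<^sub>v x) ` std_lattice n i"
    if cv: "c \<in> carrier power_series_ring" "v \<in> (\<lambda>x. g *\<^sub>v x) ` std_lattice n i" for c v
  proof -
    obtain f x where f: "c = fps_to_fls f" and x: "x \<in> std_lattice n i" "v = g *\<^sub>v x"
      using cv by auto
    note xc = std_latticeD[OF x(1)]
    have "coef n (c \<cdot>\<^sub>v x) l = 0" if l: "l < i" for l
    proof (rule index_cases[OF n, of l])
      fix m k assume m: "m < n" and lk: "l = index n m k"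
      have "fls_nth (c * x $ m) k = 0"
      proof (rule fls_times_nth_vanish[of 0])
        fix j assume "j \<le> k - 0"
        hence "j * int n \<le> k * int n" by (intro mult_right_mono) auto
        hence "index n m j < i" using l lk by (simp add: index_def)
        thus "fls_nth (x $ m) j = 0" using x(1) coef_index[OF m, of x j] by (simp add: std_lattice_def)
      qed (simp add: f)
      thus ?thesis using m xc by (simp add: lk coef_index)
    qed
    hence "c \<cdot>\<^sub>v x \<in> std_lattice n i" using xc by (simp add: std_lattice_def)
    moreover have "g *\<^sub>v (c \<cdot>\<^sub>v x) = c \<cdot>\<^sub>v v" using x xc g by (simp add: mult_mat_vec)
    ultimately show ?thesis by (metis image_eqI module_vec_simps(4))
  qed
qed (rule module_power_series_ring)

text \<open>A vector \<open>x\<close> lies in the standard lattice with index \<open>r\<close> if and only if its entries are integral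
  at the columns of $g_r, \dots, g_n$ and divisible by \<open>t\<close> at the other columns.\<close>

lemma span_flag_vectors:
  fixes g :: "'k :: field fls mat"
  assumes n: "0 < n" and g: "g \<in> carrier_mat n n" and r: "1 \<le> r" "r \<le> int n"
  shows "module.span power_series_ring (laurent_space n)
      (flag_vector n g ` {r..int n} \<union> (\<lambda>l. fls_X \<cdot>\<^sub>v flag_vector n g l) ` {1..<r}) =
    (\<lambda>x. g *\<^sub>v x) ` std_lattice n r" (is "module.span _ _ ?S = ?N")
proof
  interpret Module.module "power_series_ring :: 'k fls ring" "laurent_space n"
    by (rule module_power_series_ring)
  have col: "col g m = g *\<^sub>v unit_vec n m" if "m < n" for m
    using mat_mult_unit_vec[OF g that] ..
  have unit: "unit_vec n m \<in> (std_lattice n i :: 'k fls vec set)" if "m < n" "i \<le> int n - int m" for m i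
    using has_ord_unit_vec[OF n that(1), where ?'k = 'k] that(2) by (simp add: has_ord_def std_lattice_def)
  have gen: "flag_vector n g l \<in> ?N" if "l \<in> {r..int n}" for l
    unfolding flag_vector_def using that r unit[of "nat (int n - l)" r] col[of "nat (int n - l)"] by auto
  have genX: "fls_X \<cdot>\<^sub>v flag_vector n g l \<in> ?N" if l: "l \<in> {1..<r}" for l
  proof -
    let ?m = "nat (int n - l)"
    have m: "?m < n" using l r by auto
    have "unit_vec n ?m \<in> (std_lattice n (r - int n) :: 'k fls vec set)" using l r by (intro unit) auto
    hence "fls_X_intpow 1 \<cdot>\<^sub>v unit_vec n ?m \<in> (std_lattice n r :: 'k fls vec set)"
      using std_lattice_shift[OF n, of 1 "r - int n"] by auto
    moreover have "g *\<^sub>v (fls_X_intpow 1 \<cdot>\<^sub>v unit_vec n ?m) = fls_X \<cdot>\<^sub>v flag_vector n g l"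
      unfolding flag_vector_def col[OF m] using g by (simp add: mult_mat_vec fls_X_conv_shift_1)
    ultimately show ?thesis by (metis image_eqI)
  qed
  have SN: "?S \<subseteq> ?N" using gen genX by auto
  thus "span ?S \<subseteq> ?N" by (rule span_is_subset) (rule submodule_lattice[OF n g])
  have SC: "?S \<subseteq> carrier (laurent_space n)"
  proof (rule subset_trans[OF SN])
    show "?N \<subseteq> carrier (laurent_space n)" using g by (auto simp: module_vec_simps dest: std_latticeD)
  qed
  interpret span: submodule power_series_ring "span ?S" "laurent_space n" by (rule span_is_submodule[OF SC])
  have S: "?S \<subseteq> span ?S" by (rule in_own_span[OF SC])
  show "?N \<subseteq> span ?S"
  proof
    fix v assume "v \<in> ?N"
    then obtain x where x: "x \<in> std_lattice n r" and v: "v = g *\<^sub>v x" by blast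
    note xc = std_latticeD[OF x]
    have summand: "x $ m \<cdot>\<^sub>v col g m \<in> span ?S" if m: "m < n" for m
    proof -
      have flag: "flag_vector n g (int n - int m) = col g m" using m by (simp add: flag_vector_def)
      show ?thesis
      proof (cases "r \<le> int n - int m")
        case True
        have "fls_nth (x $ m) k = 0" if "k < 0" for k
        proof -
          have "k * int n \<le> (-1) * int n" using that by (intro mult_right_mono) auto
          hence "index n m k < r" using r by (simp add: index_def)
          thus ?thesis using x coef_index[OF m, of x k] by (simp add: std_lattice_def)
        qed
        hence "x $ m \<in> range fps_to_fls" by (rule in_range_fps_to_fls)
        moreover have "flag_vector n g (int n - int m) \<in> ?S" using True by auto
        hence "col g m \<in> span ?S" unfolding flag by (rule subsetD[OF S])
        ultimately show ?thesis using span.smult_closed[of "x $ m" "col g m"] by (simp add: module_vec_simps)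
      next
        case False
        have "fls_nth (x $ m) k = 0" if "k < 1" for k
        proof -
          have "k * int n \<le> 0 * int n" using that by (intro mult_right_mono) auto
          hence "index n m k < r" using False by (simp add: index_def)
          thus ?thesis using x coef_index[OF m, of x k] by (simp add: std_lattice_def)
        qed
        \<comment> \<open>One factor \<open>t\<close> is moved from the entry to the generator.\<close>
        hence "fls_X_intpow (-1) * x $ m \<in> range fps_to_fls"
          by (intro in_range_fps_to_fls) (simp only: fls_X_intpow_times_conv_shift, simp)
        moreover have "fls_X \<cdot>\<^sub>v flag_vector n g (int n - int m) \<in> ?S" using False m by auto
        hence "fls_X \<cdot>\<^sub>v col g m \<in> span ?S" unfolding flag by (rule subsetD[OF S])
        ultimately have "(fls_X_intpow (-1) * x $ m) \<cdot>\<^sub>v (fls_X \<cdot>\<^sub>v col g m) \<in> span ?S"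
          using span.smult_closed[of "fls_X_intpow (-1) * x $ m" "fls_X \<cdot>\<^sub>v col g m"] by (simp add: module_vec_simps)
        moreover have "fls_X_intpow (-1) * x $ m * fls_X = x $ m"
          by (simp only: fls_X_intpow_times_conv_shift fls_X_times_conv_shift) simp
        ultimately show ?thesis by (simp only: smult_smult_assoc)
      qed
    qed
    have "g *\<^sub>v x \<in> span ?S"
      using xc
    proof (induction rule: vec_induct_entries)
      case zero
      show ?case using span.zero_closed mult_mat_zero_vec[OF g] by (simp only: module_vec_simps)
    next
      case (add y z)
      thus ?case using span.m_closed[of "g *\<^sub>v y" "g *\<^sub>v z"]
        by (simp only: mult_add_distrib_mat_vec[OF g] module_vec_simps)
    next
      case (entry m)
      show ?case using summand[OF entry] unfolding mult_mat_vec[OF g unit_vec_carrier] col[OF entry] .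
    qed
    thus "v \<in> span ?S" using v by simp
  qed
qed

lemma affine_flag_eq:
  assumes n: "0 < n" and g: "g \<in> carrier_mat n n"
  shows "affine_flag n g i = (\<lambda>x. g *\<^sub>v x) ` std_lattice n i"
proof -
  let ?d = "(i - 1) div int n"
  have "affine_flag n g i = (\<lambda>v. fls_X_intpow ?d \<cdot>\<^sub>v v) ` (\<lambda>x. g *\<^sub>v x) ` std_lattice n (residue n i)"
    unfolding affine_flag_def span_flag_vectors[OF n g residue_bounds[OF n]] ..
  also have "\<dots> = (\<lambda>x. g *\<^sub>v x) ` (\<lambda>x. fls_X_intpow ?d \<cdot>\<^sub>v x) ` std_lattice n (residue n i)"
    unfolding image_image using g by (intro image_cong refl) (simp add: mult_mat_vec std_latticeD)
  also have "\<dots> = (\<lambda>x. g *\<^sub>v x) ` std_lattice n i"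
    unfolding std_lattice_shift[OF n] residue_decomp[symmetric] ..
  finally show ?thesis .
qed

lemma affine_flag_iwahori:
  assumes n: "0 < n" and g: "g \<in> carrier_mat n n" and b: "b \<in> iwahori n"
  shows "affine_flag n (g * b) = affine_flag n g"
proof
  fix i
  have bc: "b \<in> carrier_mat n n" using iwahori_GL[OF b] by (simp add: carrier_GL)
  have "affine_flag n (g * b) i = (\<lambda>x. g *\<^sub>v x) ` (\<lambda>x. b *\<^sub>v x) ` std_lattice n i"
    unfolding affine_flag_eq[OF n mult_carrier_mat[OF g bc]] image_image
    using g bc by (intro image_cong refl) (simp add: assoc_mult_mat_vec std_latticeD)
  thus "affine_flag n (g * b) i = affine_flag n g i"
    unfolding iwahori_std_lattice[OF n b] affine_flag_eq[OF n g] .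
qed

section \<open>Matrices adapted to a clan\<close>

definition plus_matrix :: "nat \<Rightarrow> nat \<Rightarrow> 'k :: field fls mat" where
  "plus_matrix p q = mat (p + q) (p + q) (\<lambda>(i, j). if i = j \<and> i < p then 1 else 0)"

text \<open>The family $(f_i)$ with $f_i = g_i$ for \<open>i\<close> in \<open>{1..n}\<close> and $f_{i+n} = t f_i$.\<close>

definition periodic_family :: "nat \<Rightarrow> 'k :: field fls mat \<Rightarrow> int \<Rightarrow> 'k fls vec" where
  "periodic_family n g i = fls_X_intpow ((i - 1) div int n) \<cdot>\<^sub>v flag_vector n g (residue n i)"

text \<open>Since signs are fixed by \<open>mate c\<close>, the index \<open>min i (mate c i)\<close> is \<open>i\<close> itself for a plus and for
  the smaller index of a matched pair, and it is the smaller index for the larger one.\<close>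

definition adapted :: "nat \<Rightarrow> nat \<Rightarrow> 'k :: field fls mat \<Rightarrow> (int \<Rightarrow> clan_entry) \<Rightarrow> bool" where
  "adapted p q g c \<longleftrightarrow> (\<forall>i. plus_matrix p q *\<^sub>v periodic_family (p + q) g i =
     (if c i = Minus then 0\<^sub>v (p + q) else periodic_family (p + q) g (min i (mate c i))))"

lemma plus_matrix_carrier [simp]: "plus_matrix p q \<in> carrier_mat (p + q) (p + q)"
  by (simp add: plus_matrix_def)

lemma plus_matrix_vec:
  assumes "v \<in> carrier_vec (p + q)"
  shows "plus_matrix p q *\<^sub>v v = proj_plus p q v"
proof (rule eq_vecI)
  fix i assume "i < dim_vec (proj_plus p q v)"
  hence i: "i < p + q" by (simp add: proj_plus_def)
  have "(plus_matrix p q *\<^sub>v v) $ i = (\<Sum>j = 0..<p + q. plus_matrix p q $$ (i, j) * v $ j)"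
    using i assms by (simp add: plus_matrix_def scalar_prod_def)
  also have "\<dots> = (\<Sum>j = 0..<p + q. if j = i then (if i < p then v $ i else 0) else 0)"
    by (rule sum.cong) (use i in \<open>auto simp: plus_matrix_def\<close>)
  finally have "(plus_matrix p q *\<^sub>v v) $ i = (\<Sum>j = 0..<p + q. if j = i then (if i < p then v $ i else 0) else 0)" .
  thus "(plus_matrix p q *\<^sub>v v) $ i = proj_plus p q v $ i" using i by (simp add: proj_plus_def)
qed (simp add: proj_plus_def plus_matrix_def)

lemma plus_matrix_fixes_iff:
  "v \<in> carrier_vec (p + q) \<Longrightarrow> plus_matrix p q *\<^sub>v v = v \<longleftrightarrow> v \<in> V_plus p q"
  by (auto simp: plus_matrix_vec proj_plus_def V_plus_def vec_eq_iff)

lemma plus_matrix_kills_iff: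
  "v \<in> carrier_vec (p + q) \<Longrightarrow> plus_matrix p q *\<^sub>v v = 0\<^sub>v (p + q) \<longleftrightarrow> v \<in> V_minus p q"
  by (auto simp: plus_matrix_vec proj_plus_def V_minus_def vec_eq_iff)

lemma mat_eqI_vec:
  fixes A :: "'a :: comm_ring_1 mat"
  assumes "A \<in> carrier_mat n n" "B \<in> carrier_mat n n" "\<And>v. v \<in> carrier_vec n \<Longrightarrow> A *\<^sub>v v = B *\<^sub>v v"
  shows "A = B"
proof (rule mat_col_eqI)
  fix j assume "j < dim_col B"
  hence j: "j < n" using assms by simp
  have "col M j = M *\<^sub>v unit_vec n j" if "M \<in> carrier_mat n n" for M :: "'a mat"
    using mat_mult_unit_vec[OF that j] ..
  thus "col A j = col B j" using assms by simp
qed (use assms in auto)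

lemma plus_matrix_idem: "plus_matrix p q * plus_matrix p q = plus_matrix p q"
proof (rule mat_eqI_vec)
  fix v :: "'a fls vec" assume v: "v \<in> carrier_vec (p + q)"
  have "plus_matrix p q *\<^sub>v (plus_matrix p q *\<^sub>v v) = plus_matrix p q *\<^sub>v v"
    using v by (simp add: plus_matrix_vec proj_plus_def) (auto simp: vec_eq_iff)
  thus "plus_matrix p q * plus_matrix p q *\<^sub>v v = plus_matrix p q *\<^sub>v v"
    using assoc_mult_mat_vec[OF plus_matrix_carrier plus_matrix_carrier v] by simp
qed (use mult_carrier_mat[OF plus_matrix_carrier plus_matrix_carrier] in auto)

context
  fixes n :: nat
  assumes n: "0 < n"
begin

lemma periodic_family_carrier [simp]: "g \<in> carrier_mat n n \<Longrightarrow> periodic_family n g i \<in> carrier_vec n"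
  unfolding periodic_family_def flag_vector_def by (metis carrier_matD(1) col_dim smult_carrier_vec)

lemma periodic_family_index: "m < n \<Longrightarrow> periodic_family n g (index n m k) = fls_X_intpow k \<cdot>\<^sub>v col g m"
  by (simp add: periodic_family_def flag_vector_def index_div_mod)

lemma periodic_family_mult:
  assumes "A \<in> carrier_mat n n" "g \<in> carrier_mat n n"
  shows "periodic_family n (A * g) i = A *\<^sub>v periodic_family n g i"
proof (rule index_cases[OF n, of i])
  fix m k assume m: "m < n" and i: "i = index n m k"
  have "col (A * g) m = A *\<^sub>v col g m" using assms m by (intro eq_vecI) auto
  thus ?thesis using assms m by (simp add: i periodic_family_index mult_mat_vec)
qed

text \<open>The family contains the columns of \<open>g\<close>, which form a basis.\<close>

lemma mat_eqI_family:
  assumes A: "A \<in> carrier_mat n n" and B: "B \<in> carrier_mat n n" and g: "g \<in> carrier (GL n)"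
    and eq: "\<And>i. A *\<^sub>v periodic_family n g i = B *\<^sub>v periodic_family n g i"
  shows "A = B"
proof -
  obtain h where h: "g \<in> carrier_mat n n" "h \<in> carrier_mat n n" "g * h = 1\<^sub>m n"
    using g by (auto simp: carrier_GL)
  have "A * g = B * g"
  proof (rule mat_col_eqI)
    fix m assume "m < dim_col (B * g)"
    hence m: "m < n" using h by simp
    have "col (M * g) m = periodic_family n (M * g) (index n m 0)" for M
      using m by (auto simp: periodic_family_index)
    thus "col (A * g) m = col (B * g) m"
      using eq periodic_family_mult[OF A h(1)] periodic_family_mult[OF B h(1)] by simp
  qed (use A B in auto)
  hence "A * (g * h) = B * (g * h)"
    using assoc_mult_mat[OF A h(1,2)] assoc_mult_mat[OF B h(1,2)] by simp
  thus ?thesis using A B h by simp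
qed

definition matrix_of_family :: "(int \<Rightarrow> 'k :: field fls vec) \<Rightarrow> 'k fls mat" where
  "matrix_of_family F = mat n n (\<lambda>(r, m). F (int n - int m) $ r)"

lemma periodic_family_matrix:
  assumes "\<And>i. F i \<in> carrier_vec n" "\<And>i k. F (i + k * int n) = fls_X_intpow k \<cdot>\<^sub>v F i"
  shows "periodic_family n (matrix_of_family F) i = F i"
proof (rule index_cases[OF n, of i])
  fix m k assume m: "m < n" and i: "i = index n m k"
  have "col (matrix_of_family F) m = F (int n - int m)"
    using m carrier_vecD[OF assms(1)] by (intro eq_vecI) (auto simp: matrix_of_family_def)
  moreover have "F (index n m k) = fls_X_intpow k \<cdot>\<^sub>v F (int n - int m)" using assms(2) by (simp add: index_def)
  ultimately show ?thesis using m by (simp add: i periodic_family_index)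
qed

lemma matrix_of_family_carrier: "matrix_of_family F \<in> carrier_mat n n"
  by (simp add: matrix_of_family_def)

lemma periodic_family_one_nth:
  assumes "m < n" "r < n" "m \<noteq> r"
  shows "periodic_family n (1\<^sub>m n) (index n m k) $ r = 0"
  using assms by (simp add: periodic_family_index)

end

text \<open>The idempotent in question is $E = g^{-1} P g$. Its adapted basis consists of vectors of orders
  \<open>1, \<dots>, n\<close> and is therefore the set of columns of an Iwahori matrix.\<close>

lemma adapted_exists:
  fixes g :: "'k :: field fls mat"
  assumes n: "n = p + q" "0 < n" and g: "g \<in> carrier (GL n)"
  shows "\<exists>b \<in> iwahori n. \<exists>c. clan_shape n c \<and> adapted p q (g * b) c"
proof -
  note n0 = n(2) and npq = n(1)
  obtain h where h: "g \<in> carrier_mat n n" "h \<in> carrier_mat n n" "g * h = 1\<^sub>m n" "h * g = 1\<^sub>m n"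
    using g by (auto simp: carrier_GL)
  let ?P = "plus_matrix p q :: 'k fls mat"
  have P: "?P \<in> carrier_mat n n" unfolding npq by (rule plus_matrix_carrier)
  define E where "E = h * (?P * g)"
  have Pg: "?P * g \<in> carrier_mat n n" using P h(1) by (rule mult_carrier_mat)
  have E: "E \<in> carrier_mat n n" unfolding E_def using h(2) Pg by (rule mult_carrier_mat)
  have gE: "g * E = ?P * g"
    unfolding E_def assoc_mult_mat[OF h(1,2) Pg, symmetric] h(3) by (rule left_mult_one_mat[OF Pg])
  have "E * E = h * (?P * g) * E" by (simp only: E_def)
  also have "\<dots> = h * (?P * g * E)" by (rule assoc_mult_mat[OF h(2) Pg E])
  also have "\<dots> = h * (?P * ?P * g)"
    by (simp only: assoc_mult_mat[OF P h(1) E] gE assoc_mult_mat[OF P P h(1)])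
  also have "\<dots> = E" by (simp only: plus_matrix_idem E_def)
  finally have "E * E = E" .
  then interpret idempotent_matrix n E by unfold_locales (use n E in auto)
  define b where "b = matrix_of_family n basis"
  have b: "b \<in> carrier_mat n n" unfolding b_def by (rule matrix_of_family_carrier[OF n0])
  have fam_b: "periodic_family n b i = basis i" for i
    unfolding b_def by (rule periodic_family_matrix[OF n0]) (use basis_shift has_ord_basis has_ord_carrier in blast)+
  have "has_ord n (col b m) (int n - int m)" if "m < n" for m
    using fam_b[of "index n m 0"] periodic_family_index[OF n0 that, of b 0] b has_ord_basis[of "int n - int m"]
    by (simp add: index_def)
  hence bB: "b \<in> iwahori n" by (intro iwahoriI n0 b) auto
  have "adapted p q (g * b) clan"
    unfolding adapted_def npq[symmetric] periodic_family_mult[OF n0 h(1) b] fam_b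
  proof
    fix i
    have bc: "basis j \<in> carrier_vec n" for j using has_ord_basis by (rule has_ord_carrier)
    have "?P *\<^sub>v (g *\<^sub>v basis i) = (g * E) *\<^sub>v basis i"
      unfolding gE using P h bc by (simp add: assoc_mult_mat_vec)
    also have "\<dots> = g *\<^sub>v (E *\<^sub>v basis i)" using h E bc by (simp add: assoc_mult_mat_vec)
    also have "\<dots> = (if clan i = Minus then 0\<^sub>v n else g *\<^sub>v basis (min i (mate clan i)))"
      unfolding E_basis using h(1) by (auto intro!: eq_vecI)
    finally show "?P *\<^sub>v (g *\<^sub>v basis i) = (if clan i = Minus then 0\<^sub>v n else g *\<^sub>v basis (min i (mate clan i)))" .
  qed
  thus ?thesis using bB clan_shape_clan by blast
qed

text \<open>Some summand in the Leibniz formula for the determinant is not zero. Its permutation maps the rows in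
  \<open>R\<close> injectively to columns outside \<open>C\<close>.\<close>

lemma zero_block_bound:
  fixes A :: "'a :: field mat"
  assumes A: "A \<in> carrier_mat n n" "B \<in> carrier_mat n n" "A * B = 1\<^sub>m n"
    and R: "R \<subseteq> {0..<n}" and C: "C \<subseteq> {0..<n}"
    and zero: "\<And>r m. r \<in> R \<Longrightarrow> m \<in> C \<Longrightarrow> A $$ (r, m) = 0"
  shows "card R + card C \<le> n"
proof -
  have "det A * det B = 1" using A by (metis det_mult det_one)
  hence "det A \<noteq> 0" by auto
  hence "(\<Sum>\<pi> \<in> {\<pi>. \<pi> permutes {0..<n}}. signof \<pi> * (\<Prod>i = 0..<n. A $$ (i, \<pi> i))) \<noteq> 0"
    using A(1) by (simp add: det_def')
  then obtain \<pi> where \<pi>: "\<pi> permutes {0..<n}" "signof \<pi> * (\<Prod>i = 0..<n. A $$ (i, \<pi> i)) \<noteq> 0"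
    by (metis (no_types, lifting) mem_Collect_eq sum.neutral)
  hence nz: "A $$ (i, \<pi> i) \<noteq> 0" if "i < n" for i using that by auto
  have "\<pi> ` R \<subseteq> {0..<n} - C"
  proof
    fix m assume "m \<in> \<pi> ` R"
    then obtain r where r: "r \<in> R" "m = \<pi> r" by blast
    hence "m \<in> {0..<n}" using R permutes_in_image[OF \<pi>(1)] by blast
    moreover have "m \<notin> C" using zero[OF r(1)] nz[of r] R r by auto
    ultimately show "m \<in> {0..<n} - C" by blast
  qed
  hence "card (\<pi> ` R) \<le> card ({0..<n} - C)" by (intro card_mono) auto
  moreover have "card (\<pi> ` R) = card R"
    using permutes_inj[OF \<pi>(1)] by (simp add: card_image inj_on_def)
  moreover have "card ({0..<n} - C) = n - card C" using C by (simp add: card_Diff_subset finite_subset)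
  moreover have "card C \<le> n" using card_mono[OF _ C] by simp
  ultimately show ?thesis by linarith
qed

text \<open>The representatives modulo \<open>n\<close> of the smaller indices of matched pairs. Together with \<open>downs\<close>,
  \<open>plusses\<close> and \<open>minusses\<close> they partition \<open>{1..n}\<close>.\<close>

definition ups :: "nat \<Rightarrow> (int \<Rightarrow> clan_entry) \<Rightarrow> int set" where
  "ups n c = {i \<in> {1..int n}. i < mate c i}"

definition downs :: "nat \<Rightarrow> (int \<Rightarrow> clan_entry) \<Rightarrow> int set" where
  "downs n c = {i \<in> {1..int n}. mate c i < i}"

definition plusses :: "nat \<Rightarrow> (int \<Rightarrow> clan_entry) \<Rightarrow> int set" where
  "plusses n c = {i \<in> {1..int n}. c i = Plus}"

definition minusses :: "nat \<Rightarrow> (int \<Rightarrow> clan_entry) \<Rightarrow> int set" where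
  "minusses n c = {i \<in> {1..int n}. c i = Minus}"

lemma mate_residue:
  assumes n: "0 < n" and c: "clan_shape n c"
  shows "mate c (residue n i) = mate c i - (i - residue n i)"
proof -
  have "mate c i = mate c (residue n i) + (i - 1) div int n * int n"
    using mate_shift[OF c, of "residue n i" "(i - 1) div int n"] by (simp only: residue_decomp[symmetric])
  thus ?thesis using residue_decomp[of i n] by linarith
qed

text \<open>Matching followed by reduction modulo \<open>n\<close> is an involution that exchanges the two sets.\<close>

lemma card_ups_downs:
  assumes n: "0 < n" and c: "clan_shape n c"
  shows "card (ups n c) = card (downs n c)"
proof (rule bij_betw_same_card[OF bij_betw_byWitness[where f = "\<lambda>i. residue n (mate c i)"
      and f' = "\<lambda>i. residue n (mate c i)"]])
  let ?r = "\<lambda>i. residue n (mate c i)"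
  have mr: "mate c (?r i) = i - (mate c i - ?r i)" for i
    using mate_residue[OF n c, of "mate c i"] mate_mate[OF c] by simp
  have "residue n (i - (mate c i - ?r i)) = residue n i" for i
  proof -
    have "i - (mate c i - ?r i) = i + (- ((mate c i - 1) div int n)) * int n"
      using residue_decomp[of "mate c i" n] by linarith
    thus ?thesis using residue_shift[OF n] by presburger
  qed
  hence inv: "?r (?r i) = i" if "i \<in> {1..int n}" for i
    using that mr[of i] residue_id[of i n] by simp
  show "\<forall>i\<in>ups n c. ?r (?r i) = i" "\<forall>i\<in>downs n c. ?r (?r i) = i"
    using inv by (auto simp: ups_def downs_def)
  show "?r ` ups n c \<subseteq> downs n c" "?r ` downs n c \<subseteq> ups n c"
    using mr residue_bounds[OF n] by (auto simp: ups_def downs_def)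
qed

lemma card_partition:
  assumes c: "clan_shape n c"
  shows "card (plusses n c \<union> ups n c) = card (plusses n c) + card (ups n c)"
    "card (minusses n c \<union> downs n c) = card (minusses n c) + card (downs n c)"
    "(plusses n c \<union> ups n c) \<inter> (minusses n c \<union> downs n c) = {}"
    "(plusses n c \<union> ups n c) \<union> (minusses n c \<union> downs n c) = {1..int n}"
    "card (plusses n c \<union> ups n c) + card (minusses n c \<union> downs n c) = n"
proof -
  note defs = plusses_def minusses_def ups_def downs_def
  have fin: "finite (plusses n c)" "finite (minusses n c)" "finite (ups n c)" "finite (downs n c)"
    unfolding defs by (rule finite_subset[OF _ finite_atLeastAtMost_int[of 1 "int n"]], blast)+
  have disj: "plusses n c \<inter> ups n c = {}" "minusses n c \<inter> downs n c = {}"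
    by (auto simp: defs mate_sign)
  show "card (plusses n c \<union> ups n c) = card (plusses n c) + card (ups n c)"
    "card (minusses n c \<union> downs n c) = card (minusses n c) + card (downs n c)"
    using fin disj by (simp_all add: card_Un_disjoint)
  show *: "(plusses n c \<union> ups n c) \<inter> (minusses n c \<union> downs n c) = {}"
    by (auto simp: defs mate_sign)
  show **: "(plusses n c \<union> ups n c) \<union> (minusses n c \<union> downs n c) = {1..int n}"
  proof (intro equalityI subsetI)
    fix i assume i: "i \<in> {1..int n}"
    show "i \<in> (plusses n c \<union> ups n c) \<union> (minusses n c \<union> downs n c)"
      using i mate_eq_self_iff[OF c, of i] by (cases i "mate c i" rule: linorder_cases) (auto simp: defs)
  qed (auto simp: defs)
  have "card ((plusses n c \<union> ups n c) \<union> (minusses n c \<union> downs n c)) =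
      card (plusses n c \<union> ups n c) + card (minusses n c \<union> downs n c)"
    using fin * by (intro card_Un_disjoint) auto
  thus "card (plusses n c \<union> ups n c) + card (minusses n c \<union> downs n c) = n" using ** by simp
qed

text \<open>The columns of \<open>g\<close> at the plusses and at the smaller indices lie in $V_+$ and have zeros in the last
  \<open>q\<close> rows. Dually, the rows of $g^{-1}$ at the minusses and at the larger indices vanish on $V_+$,
  since \<open>P\<close> maps no vector of the family to a multiple of one with such an index. This bounds the
  sizes of these two sets by \<open>p\<close> and \<open>q\<close>. As the sets partition \<open>{1..n}\<close>, equality
  holds, and the matched pairs cancel in the difference.\<close>

lemma adapted_affine_clan:
  fixes g :: "'k :: field fls mat"
  assumes n: "n = p + q" "0 < n" and g: "g \<in> carrier (GL n)" and c: "clan_shape n c"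
    and ad: "adapted p q g c"
  shows "c \<in> affine_clans p q"
proof -
  note n0 = n(2)
  obtain h where h: "g \<in> carrier_mat n n" "h \<in> carrier_mat n n" "g * h = 1\<^sub>m n" "h * g = 1\<^sub>m n"
    using g by (auto simp: carrier_GL)
  let ?P = "plus_matrix p q :: 'k fls mat"
  have P: "?P \<in> carrier_mat n n" unfolding n(1) by (rule plus_matrix_carrier)
  have Pg: "?P * g \<in> carrier_mat n n" using P h(1) by (rule mult_carrier_mat)
  have ad': "?P *\<^sub>v periodic_family n g i =
     (if c i = Minus then 0\<^sub>v n else periodic_family n g (min i (mate c i)))" for i
    using ad unfolding adapted_def n(1)[symmetric] by blast
  have col_g: "col g m = periodic_family n g (int n - int m)" if "m < n" for m
    using periodic_family_index[OF n0 that, of g 0] by (simp add: index_def)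
  define cols where "cols S = (\<lambda>i. nat (int n - i)) ` S" for S
  have card_cols: "card (cols S) = card S" if "S \<subseteq> {1..int n}" for S
    unfolding cols_def
  proof (intro card_image inj_onI)
    fix x y assume "x \<in> S" "y \<in> S" "nat (int n - x) = nat (int n - y)"
    moreover from this have "x \<le> int n" "y \<le> int n" using that by auto
    ultimately show "x = y" by simp
  qed
  have cols: "m < n \<and> int n - int m \<in> S" if "m \<in> cols S" "S \<subseteq> {1..int n}" for m S
  proof -
    obtain i where i: "m = nat (int n - i)" "i \<in> S" using \<open>m \<in> cols S\<close> by (auto simp: cols_def)
    hence "1 \<le> i" "i \<le> int n" using \<open>S \<subseteq> {1..int n}\<close> by auto
    thus ?thesis using i by auto
  qed
  have cols_subset: "cols S \<subseteq> {0..<n}" if S: "S \<subseteq> {1..int n}" for S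
  proof
    fix m assume "m \<in> cols S"
    from cols[OF this S] show "m \<in> {0..<n}" by simp
  qed
  let ?U = "plusses n c \<union> ups n c" and ?D = "minusses n c \<union> downs n c"
  have sub: "?U \<subseteq> {1..int n}" "?D \<subseteq> {1..int n}"
    by (auto simp: plusses_def minusses_def ups_def downs_def)
  \<comment> \<open>The block of zeros in \<open>g\<close>.\<close>
  have "card {p..<n} + card (cols ?U) \<le> n"
  proof (rule zero_block_bound[OF h(1,2,3)])
    fix r m assume r: "r \<in> {p..<n}" and m: "m \<in> cols ?U"
    note m' = cols[OF m sub(1)]
    have key: "c i \<noteq> Minus \<and> min i (mate c i) = i" if "i \<in> ?U" for i
    proof (cases "c i = Plus")
      case True
      thus ?thesis using mate_sign[of c i] by simp
    next
      case False
      hence "i < mate c i" using that by (simp add: plusses_def ups_def)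
      moreover from this have "c i \<noteq> Minus" using mate_sign[of c i] by auto
      ultimately show ?thesis by simp
    qed
    define i where "i = int n - int m"
    have "c i \<noteq> Minus" "min i (mate c i) = i" using key[of i] m' unfolding i_def by blast+
    hence "?P *\<^sub>v periodic_family n g i = periodic_family n g i" using ad'[of i] by (simp only: if_False)
    moreover have "col g m = periodic_family n g i" unfolding i_def using m' by (intro col_g) blast
    ultimately have "?P *\<^sub>v col g m = col g m" by (simp only:)
    moreover have "col g m \<in> carrier_vec (p + q)"
      unfolding n(1)[symmetric] using col_dim[of g m] unfolding carrier_matD(1)[OF h(1)] .
    ultimately have "col g m \<in> V_plus p q" using plus_matrix_fixes_iff by blast
    hence "col g m $ r = 0" using r n(1) by (simp add: V_plus_def)
    thus "g $$ (r, m) = 0" using r m' h(1) by simp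
  qed (use cols_subset[OF sub(1)] in auto)
  hence 1: "card (plusses n c) + card (ups n c) \<le> p"
    using card_cols[OF sub(1)] card_partition(1)[OF c] n by simp
  \<comment> \<open>The block of zeros in the inverse of \<open>g\<close>.\<close>
  have "card (cols ?D) + card {0..<p} \<le> n"
  proof (rule zero_block_bound[OF h(2,1,4)])
    fix r m assume r: "r \<in> cols ?D" and m: "m \<in> {0..<p}"
    note r' = cols[OF r sub(2)]
    have mn: "m < n" using m n by auto
    \<comment> \<open>Column \<open>s\<close> of this matrix is zero or a monomial unit vector whose index is a plus or a smaller index.\<close>
    have row0: "(h * (?P * g)) $$ (r, s) = 0" if s: "s < n" for s
    proof -
      let ?i = "int n - int s"
      have "col (h * (?P * g)) s = h *\<^sub>v (?P *\<^sub>v col g s)"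
        using s by (simp add: col_mult2[OF h(2) Pg] col_mult2[OF P h(1)])
      also have "\<dots> = (if c ?i = Minus then 0\<^sub>v n else periodic_family n (1\<^sub>m n) (min ?i (mate c ?i)))"
      proof -
        have "h *\<^sub>v 0\<^sub>v n = 0\<^sub>v n" by (rule mult_mat_zero_vec[OF h(2)])
        thus ?thesis unfolding col_g[OF s] ad' using periodic_family_mult[OF n0 h(2,1)] h(4) by simp
      qed
      also have "\<dots> $ r = 0"
      proof (cases "c ?i = Minus")
        case False
        let ?l = "min ?i (mate c ?i)"
        have l: "?l \<le> mate c ?l" "c ?l \<noteq> Minus"
          using mate_mate[OF c, of ?i] clan_mate_eq[OF c, of ?i] False by (auto simp: min_def)
        obtain m' k where m': "m' < n" "?l = index n m' k" using index_cases[OF n0] by blast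
        have "m' \<noteq> r"
        proof
          assume "m' = r"
          hence eq: "?l = (int n - int r) + k * int n" using m'(2) by (simp add: index_def)
          have "mate c ?l = mate c (int n - int r) + k * int n" "c ?l = Minus \<longleftrightarrow> c (int n - int r) = Minus"
            unfolding eq using mate_shift[OF c] clan_shift_iff[OF c] by auto
          thus False using l r' unfolding eq by (auto simp: minusses_def downs_def)
        qed
        hence "periodic_family n (1\<^sub>m n) ?l $ r = (0 :: 'k fls)"
          unfolding m'(2) using m'(1) r' by (intro periodic_family_one_nth[OF n0]) auto
        thus ?thesis using False by (simp only: if_False)
      qed (use r' in auto)
      finally show ?thesis using s r' h P by simp
    qed
    have "h * (?P * g) * h = h * (?P * (g * h))"
      by (simp only: assoc_mult_mat[OF h(2) Pg h(2)] assoc_mult_mat[OF P h(1,2)])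
    hence "h * ?P = (h * (?P * g)) * h" using h(3) P by simp
    hence "(h * ?P) $$ (r, m) = (\<Sum>s = 0..<n. (h * (?P * g)) $$ (r, s) * h $$ (s, m))"
      using h P r' mn by (simp add: scalar_prod_def)
    also have "\<dots> = 0" using row0 by simp
    finally have "(\<Sum>s = 0..<n. h $$ (r, s) * ?P $$ (s, m)) = 0"
      using h P r' mn by (simp add: scalar_prod_def)
    moreover have "(\<Sum>s = 0..<n. h $$ (r, s) * ?P $$ (s, m)) = (\<Sum>s = 0..<n. if s = m then h $$ (r, m) else 0)"
      using m mn n by (intro sum.cong) (auto simp: plus_matrix_def)
    ultimately show "h $$ (r, m) = 0" using mn by simp
  qed (use cols_subset[OF sub(2)] n in auto)
  hence 2: "card (minusses n c) + card (downs n c) \<le> q"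
    using card_cols[OF sub(2)] card_partition(2)[OF c] n by simp
  have "int (card (plusses n c)) - int (card (minusses n c)) = int p - int q"
    using 1 2 card_partition(1,2,5)[OF c] card_ups_downs[OF n0 c] n(1) by linarith
  thus ?thesis
    unfolding affine_clans_iff n(1)[symmetric] plusses_def minusses_def by (rule conjI[OF c])
qed

section \<open>Orbits of the block-diagonal group\<close>

lemma plus_matrix_block: "plus_matrix p q = four_block_mat (1\<^sub>m p) (0\<^sub>m p q) (0\<^sub>m q p) (0\<^sub>m q q)"
  by (rule eq_matI) (auto simp: plus_matrix_def)

lemma block_commutes:
  assumes "k1 \<in> carrier_mat p p" "k2 \<in> carrier_mat q q"
  defines "k \<equiv> four_block_mat k1 (0\<^sub>m p q) (0\<^sub>m q p) k2"
  shows "k * plus_matrix p q = plus_matrix p q * k"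
  unfolding k_def plus_matrix_block using assms(1,2)
  by (simp add: mult_four_block_mat[of _ p p _ q _ q _ _ p _ q])

lemma commutes_block:
  fixes k :: "'k :: field fls mat"
  assumes k: "k \<in> carrier_mat (p + q) (p + q)" and comm: "k * plus_matrix p q = plus_matrix p q * k"
  shows "\<exists>k1 \<in> carrier_mat p p. \<exists>k2 \<in> carrier_mat q q. k = four_block_mat k1 (0\<^sub>m p q) (0\<^sub>m q p) k2"
proof -
  have right: "(k * plus_matrix p q) $$ (i, j) = (if j < p then k $$ (i, j) else 0)"
    if ij: "i < p + q" "j < p + q" for i j
  proof -
    have "(k * plus_matrix p q) $$ (i, j) = (\<Sum>s = 0..<p + q. k $$ (i, s) * plus_matrix p q $$ (s, j))"
      using ij k by (simp add: scalar_prod_def plus_matrix_def)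
    also have "\<dots> = (\<Sum>s = 0..<p + q. if s = j then (if j < p then k $$ (i, j) else 0) else 0)"
      by (rule sum.cong) (use ij in \<open>auto simp: plus_matrix_def\<close>)
    also have "\<dots> = (if j < p then k $$ (i, j) else 0)" using ij by simp
    finally show ?thesis .
  qed
  have left: "(plus_matrix p q * k) $$ (i, j) = (if i < p then k $$ (i, j) else 0)"
    if ij: "i < p + q" "j < p + q" for i j
  proof -
    have "(plus_matrix p q * k) $$ (i, j) = (\<Sum>s = 0..<p + q. plus_matrix p q $$ (i, s) * k $$ (s, j))"
      using ij k by (simp add: scalar_prod_def plus_matrix_def)
    also have "\<dots> = (\<Sum>s = 0..<p + q. if s = i then (if i < p then k $$ (i, j) else 0) else 0)"
      by (rule sum.cong) (use ij in \<open>auto simp: plus_matrix_def\<close>)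
    also have "\<dots> = (if i < p then k $$ (i, j) else 0)" using ij by simp
    finally show ?thesis .
  qed
  have off: "k $$ (i, j) = 0" if "i < p + q" "j < p + q" "(i < p) \<noteq> (j < p)" for i j
    using left[OF that(1,2)] right[OF that(1,2)] comm that(3) by (auto split: if_splits)
  have "k = four_block_mat (mat p p (\<lambda>(i, j). k $$ (i, j))) (0\<^sub>m p q) (0\<^sub>m q p)
      (mat q q (\<lambda>(i, j). k $$ (i + p, j + p)))"
    by (rule eq_matI) (use k off in auto)
  thus ?thesis by (intro bexI) auto
qed

lemma four_block_diag_inject:
  assumes "A \<in> carrier_mat p p" "D \<in> carrier_mat q q" "A' \<in> carrier_mat p p" "D' \<in> carrier_mat q q"
    and eq: "four_block_mat A (0\<^sub>m p q) (0\<^sub>m q p) D = four_block_mat A' (0\<^sub>m p q) (0\<^sub>m q p) D'"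
  shows "A = A'" "D = D'"
proof -
  have entry: "four_block_mat A (0\<^sub>m p q) (0\<^sub>m q p) D $$ (i, j) =
      four_block_mat A' (0\<^sub>m p q) (0\<^sub>m q p) D' $$ (i, j)" for i j
    using eq by simp
  show "A = A'"
  proof (rule eq_matI)
    fix i j assume "i < dim_row A'" "j < dim_col A'"
    thus "A $$ (i, j) = A' $$ (i, j)" using entry[of i j] assms(1-4) by simp
  qed (use assms in auto)
  show "D = D'"
  proof (rule eq_matI)
    fix i j assume "i < dim_row D'" "j < dim_col D'"
    thus "D $$ (i, j) = D' $$ (i, j)" using entry[of "i + p" "j + p"] assms(1-4) by simp
  qed (use assms in auto)
qed

lemma one_block: "1\<^sub>m (p + q) = four_block_mat (1\<^sub>m p) (0\<^sub>m p q) (0\<^sub>m q p) (1\<^sub>m q)"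
  by (rule eq_matI) auto

text \<open>A matrix that commutes with the projection has vanishing off-diagonal blocks, and so does its
  inverse; the diagonal blocks of the two are then inverse to each other.\<close>

lemma block_diagonal_eq:
  "(block_diagonal p q :: 'k :: field fls mat set) =
    {k \<in> carrier (GL (p + q)). k * plus_matrix p q = plus_matrix p q * k}"
proof (intro equalityI subsetI)
  fix k :: "'k fls mat" assume "k \<in> block_diagonal p q"
  then obtain k1 k2 where k: "k = four_block_mat k1 (0\<^sub>m p q) (0\<^sub>m q p) k2"
      "k1 \<in> carrier (GL p)" "k2 \<in> carrier (GL q)"
    by (auto simp: block_diagonal_def)
  then obtain l1 l2 where l: "k1 \<in> carrier_mat p p" "l1 \<in> carrier_mat p p" "k1 * l1 = 1\<^sub>m p" "l1 * k1 = 1\<^sub>m p"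
      "k2 \<in> carrier_mat q q" "l2 \<in> carrier_mat q q" "k2 * l2 = 1\<^sub>m q" "l2 * k2 = 1\<^sub>m q"
    by (auto simp: carrier_GL)
  let ?l = "four_block_mat l1 (0\<^sub>m p q) (0\<^sub>m q p) l2"
  have "k * ?l = 1\<^sub>m (p + q)" "?l * k = 1\<^sub>m (p + q)"
    unfolding k(1) one_block using l by (simp_all add: mult_four_block_mat[of _ p p _ q _ q _ _ p _ q])
  moreover have "?l \<in> carrier_mat (p + q) (p + q)" "k \<in> carrier_mat (p + q) (p + q)"
    unfolding k(1) using l by (auto intro: four_block_carrier_mat)
  ultimately have "k \<in> carrier (GL (p + q))" unfolding carrier_GL by blast
  thus "k \<in> {k \<in> carrier (GL (p + q)). k * plus_matrix p q = plus_matrix p q * k}"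
    using block_commutes[OF l(1,5)] k(1) by blast
next
  fix k :: "'k fls mat"
  assume "k \<in> {k \<in> carrier (GL (p + q)). k * plus_matrix p q = plus_matrix p q * k}"
  then obtain l where k: "k \<in> carrier_mat (p + q) (p + q)" "l \<in> carrier_mat (p + q) (p + q)"
      "k * l = 1\<^sub>m (p + q)" "l * k = 1\<^sub>m (p + q)" "k * plus_matrix p q = plus_matrix p q * k"
    by (auto simp: carrier_GL)
  let ?P = "plus_matrix p q :: 'k fls mat"
  note P = plus_matrix_carrier[of p q, where ?'a = 'k]
  note lP = mult_carrier_mat[OF k(2) P] and Pl = mult_carrier_mat[OF P k(2)]
  have "l * ?P = l * ?P * (k * l)" unfolding k(3) using right_mult_one_mat[OF lP] by simp
  also have "\<dots> = l * ?P * k * l" by (rule assoc_mult_mat[OF lP k(1,2), symmetric])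
  also have "l * ?P * k = l * (k * ?P)" unfolding assoc_mult_mat[OF k(2) P k(1)] k(5) ..
  also have "\<dots> = ?P" unfolding assoc_mult_mat[OF k(2,1) P, symmetric] k(4) by (rule left_mult_one_mat[OF P])
  finally have lcomm: "l * ?P = ?P * l" .
  obtain k1 k2 where kb: "k1 \<in> carrier_mat p p" "k2 \<in> carrier_mat q q"
      "k = four_block_mat k1 (0\<^sub>m p q) (0\<^sub>m q p) k2"
    using commutes_block[OF k(1,5)] by blast
  obtain l1 l2 where lb: "l1 \<in> carrier_mat p p" "l2 \<in> carrier_mat q q"
      "l = four_block_mat l1 (0\<^sub>m p q) (0\<^sub>m q p) l2"
    using commutes_block[OF k(2) lcomm] by blast
  have "four_block_mat (k1 * l1) (0\<^sub>m p q) (0\<^sub>m q p) (k2 * l2) = k * l"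
    "four_block_mat (l1 * k1) (0\<^sub>m p q) (0\<^sub>m q p) (l2 * k2) = l * k"
    unfolding kb(3) lb(3) using kb(1,2) lb(1,2)
    by (simp_all add: mult_four_block_mat[of _ p p _ q _ q _ _ p _ q])
  hence eqs: "four_block_mat (k1 * l1) (0\<^sub>m p q) (0\<^sub>m q p) (k2 * l2) = four_block_mat (1\<^sub>m p) (0\<^sub>m p q) (0\<^sub>m q p) (1\<^sub>m q)"
    "four_block_mat (l1 * k1) (0\<^sub>m p q) (0\<^sub>m q p) (l2 * k2) = four_block_mat (1\<^sub>m p) (0\<^sub>m p q) (0\<^sub>m q p) (1\<^sub>m q)"
    unfolding k(3,4) one_block by simp_all
  note one = one_carrier_mat[where ?'a = "'k fls"]
  note inj = four_block_diag_inject[OF mult_carrier_mat[OF kb(1) lb(1)] mult_carrier_mat[OF kb(2) lb(2)] one one eqs(1)]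
    four_block_diag_inject[OF mult_carrier_mat[OF lb(1) kb(1)] mult_carrier_mat[OF lb(2) kb(2)] one one eqs(2)]
  have "k1 \<in> carrier (GL p)" "k2 \<in> carrier (GL q)" unfolding carrier_GL using kb(1,2) lb(1,2) inj by blast+
  thus "k \<in> block_diagonal p q" unfolding block_diagonal_def using kb(3) by blast
qed

lemma adapted_left_mult:
  fixes g k :: "'k :: field fls mat"
  assumes n: "n = p + q" "0 < n" and g: "g \<in> carrier_mat n n" and k: "k \<in> block_diagonal p q"
    and ad: "adapted p q g c"
  shows "adapted p q (k * g) c"
proof -
  let ?P = "plus_matrix p q :: 'k fls mat"
  have P: "?P \<in> carrier_mat n n" unfolding n(1) by (rule plus_matrix_carrier)
  have k': "k \<in> carrier_mat n n" "k * ?P = ?P * k"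
    using k unfolding block_diagonal_eq n(1) by (auto simp: carrier_GL)
  have "?P *\<^sub>v (k *\<^sub>v periodic_family n g i) =
      (if c i = Minus then 0\<^sub>v n else k *\<^sub>v periodic_family n g (min i (mate c i)))" for i
  proof -
    note fc = periodic_family_carrier[OF n(2) g]
    have "?P *\<^sub>v (k *\<^sub>v periodic_family n g i) = k *\<^sub>v (?P *\<^sub>v periodic_family n g i)"
      unfolding assoc_mult_mat_vec[OF P k'(1) fc, symmetric] assoc_mult_mat_vec[OF k'(1) P fc, symmetric] k'(2) ..
    also have "?P *\<^sub>v periodic_family n g i =
        (if c i = Minus then 0\<^sub>v n else periodic_family n g (min i (mate c i)))"
      using ad unfolding adapted_def n(1)[symmetric] by blast
    also have "k *\<^sub>v \<dots> = (if c i = Minus then 0\<^sub>v n else k *\<^sub>v periodic_family n g (min i (mate c i)))"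
      using mult_mat_zero_vec[OF k'(1)] by simp
    finally show ?thesis .
  qed
  thus ?thesis unfolding adapted_def n(1)[symmetric] periodic_family_mult[OF n(2) k'(1) g] by blast
qed

text \<open>The matrix $k = g' g^{-1}$ carries the family of \<open>g\<close> to that of $g'$. As the projection acts on both
  families by the same rule, \<open>k\<close> commutes with it.\<close>

lemma adapted_same_orbit:
  fixes g g' :: "'k :: field fls mat"
  assumes n: "n = p + q" "0 < n" and g: "g \<in> carrier (GL n)" and g': "g' \<in> carrier (GL n)"
    and ad: "adapted p q g c" and ad': "adapted p q g' c'"
    and cc: "mate c = mate c'" "\<And>i. c i = Minus \<longleftrightarrow> c' i = Minus"
  shows "\<exists>k \<in> block_diagonal p q. g' = k * g"
proof -
  let ?P = "plus_matrix p q :: 'k fls mat"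
  have P: "?P \<in> carrier_mat n n" unfolding n(1) by (rule plus_matrix_carrier)
  obtain h where h: "g \<in> carrier_mat n n" "h \<in> carrier_mat n n" "g * h = 1\<^sub>m n" "h * g = 1\<^sub>m n"
    using g by (auto simp: carrier_GL)
  have gc': "g' \<in> carrier_mat n n" using g' by (simp add: carrier_GL)
  define k where "k = g' * h"
  have k: "k \<in> carrier_mat n n" unfolding k_def using gc' h(2) by (rule mult_carrier_mat)
  have kg: "k * g = g'" unfolding k_def assoc_mult_mat[OF gc' h(2,1)] h(4) by (rule right_mult_one_mat[OF gc'])
  have "h \<in> carrier (GL n)" unfolding carrier_GL using h by blast
  hence kGL: "k \<in> carrier (GL n)" unfolding k_def using g' by (intro GL_closed)
  have fam: "k *\<^sub>v periodic_family n g i = periodic_family n g' i" for i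
    unfolding periodic_family_mult[OF n(2) k h(1), symmetric] kg ..
  have "k * ?P = ?P * k"
  proof (rule mat_eqI_family[OF n(2) _ _ g])
    fix i
    note fc = periodic_family_carrier[OF n(2) h(1)]
    have "(k * ?P) *\<^sub>v periodic_family n g i = k *\<^sub>v (?P *\<^sub>v periodic_family n g i)"
      by (rule assoc_mult_mat_vec[OF k P fc])
    also have "?P *\<^sub>v periodic_family n g i =
        (if c i = Minus then 0\<^sub>v n else periodic_family n g (min i (mate c i)))"
      using ad unfolding adapted_def n(1)[symmetric] by blast
    also have "k *\<^sub>v \<dots> = (if c' i = Minus then 0\<^sub>v n else periodic_family n g' (min i (mate c' i)))"
      using mult_mat_zero_vec[OF k] fam cc by simp
    also have "\<dots> = ?P *\<^sub>v periodic_family n g' i"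
      using ad' unfolding adapted_def n(1)[symmetric] by simp
    also have "\<dots> = (?P * k) *\<^sub>v periodic_family n g i"
      unfolding assoc_mult_mat_vec[OF P k fc] fam ..
    finally show "(k * ?P) *\<^sub>v periodic_family n g i = (?P * k) *\<^sub>v periodic_family n g i" .
  qed (use mult_carrier_mat[OF k P] mult_carrier_mat[OF P k] in blast)+
  hence "k \<in> block_diagonal p q" using kGL unfolding block_diagonal_eq n(1) by simp
  thus ?thesis using kg by blast
qed

lemma affine_clan_card:
  assumes n: "n = p + q" "0 < n" and c: "c \<in> affine_clans p q"
  shows "card (plusses n c \<union> ups n c) = p" "card (minusses n c \<union> downs n c) = q"
proof -
  have cs: "clan_shape n c" and eq: "int (card (plusses n c)) - int (card (minusses n c)) = int p - int q"
    using c unfolding affine_clans_iff n(1)[symmetric] plusses_def minusses_def by blast+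
  show "card (plusses n c \<union> ups n c) = p" "card (minusses n c \<union> downs n c) = q"
    using eq card_partition(1,2,5)[OF cs] card_ups_downs[OF n(2) cs] n(1) by linarith+
qed

text \<open>Distribute the unit vectors over the residues so that the plusses and the smaller indices obtain those
  of $V_+$, and extend this to a periodic family \<open>e\<close>. Adding to each vector at a larger index the one at its mate
  gives the columns of an adapted matrix, and subtracting again gives the inverse matrix.\<close>

lemma clan_realised:
  assumes n: "n = p + q" "0 < n" and c: "c \<in> affine_clans p q"
  shows "\<exists>g :: 'k :: field fls mat. g \<in> carrier (GL n) \<and> adapted p q g c"
proof -
  note n0 = n(2)
  let ?U = "plusses n c \<union> ups n c" and ?D = "minusses n c \<union> downs n c"
  have cs: "clan_shape n c" using c unfolding affine_clans_iff n(1)[symmetric] by blast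
  note part = card_partition[OF cs]
  have finU: "finite ?U" "finite ?D" using part(4) by (metis finite_Un finite_atLeastAtMost_int)+
  obtain \<alpha> where \<alpha>: "bij_betw \<alpha> ?U {0..<p}"
    using finite_same_card_bij[OF finU(1), of "{0..<p}"] affine_clan_card(1)[OF n c] by auto
  obtain \<beta> where \<beta>: "bij_betw \<beta> ?D {p..<n}"
    using finite_same_card_bij[OF finU(2), of "{p..<n}"] affine_clan_card(2)[OF n c] n(1) by auto
  define \<gamma> where "\<gamma> = (\<lambda>i. if i \<in> ?U then \<alpha> i else \<beta> i)"
  have "bij_betw \<gamma> (?U \<union> ?D) ({0..<p} \<union> {p..<n})"
  proof (rule bij_betw_combine)
    show "bij_betw \<gamma> ?U {0..<p}" using \<alpha> by (rule bij_betw_cong[THEN iffD1, rotated]) (simp add: \<gamma>_def)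
    show "bij_betw \<gamma> ?D {p..<n}" using \<beta>
      by (rule bij_betw_cong[THEN iffD1, rotated]) (use part(3) in \<open>auto simp: \<gamma>_def\<close>)
  qed auto
  moreover have "{0..<p} \<union> {p..<n} = {0..<n}" using n(1) by auto
  ultimately have \<gamma>: "bij_betw \<gamma> {1..int n} {0..<n}" unfolding part(4) by simp
  have \<gamma>_less: "\<gamma> (residue n i) < n" for i
    using bij_betwE[OF \<gamma>] residue_bounds[OF n0, of i] by auto
  have \<gamma>_plus: "\<gamma> i < p \<longleftrightarrow> i \<in> ?U" if "i \<in> {1..int n}" for i
  proof (cases "i \<in> ?U")
    case True
    thus ?thesis using bij_betwE[OF \<alpha>] by (simp add: \<gamma>_def)
  next
    case False
    hence "i \<in> ?D" using that part(4) by blast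
    hence "p \<le> \<beta> i" using bij_betwE[OF \<beta>] by simp
    thus ?thesis using False by (simp add: \<gamma>_def)
  qed
  define e :: "int \<Rightarrow> 'k fls vec" where
    "e i = fls_X_intpow ((i - 1) div int n) \<cdot>\<^sub>v unit_vec n (\<gamma> (residue n i))" for i
  have e_carrier: "e i \<in> carrier_vec n" for i by (simp add: e_def)
  have e_shift: "e (i + k * int n) = fls_X_intpow k \<cdot>\<^sub>v e i" for i k
    unfolding e_def level_shift[OF n0] residue_shift[OF n0]
    by (simp only: smult_smult_assoc fls_X_intpow_times_fls_X_intpow)
  have e_small: "e i = unit_vec n (\<gamma> i)" if "i \<in> {1..int n}" for i
    using that by (simp add: e_def residue_id)
  define F where "F i = (if mate c i < i then e i + e (mate c i) else e i)" for i
  have F_carrier: "F i \<in> carrier_vec n" for i using e_carrier by (simp add: F_def)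
  have F_shift: "F (i + k * int n) = fls_X_intpow k \<cdot>\<^sub>v F i" for i k
    unfolding F_def mate_shift[OF cs] e_shift using e_carrier[of i] e_carrier[of "mate c i"]
    by (simp add: smult_add_distrib_vec)
  define g where "g = matrix_of_family n F"
  have g: "g \<in> carrier_mat n n" unfolding g_def by (rule matrix_of_family_carrier[OF n0])
  have fam: "periodic_family n g i = F i" for i
    unfolding g_def by (rule periodic_family_matrix[OF n0 F_carrier F_shift])
  define s :: "int \<Rightarrow> 'k fls vec" where "s i = periodic_family n (1\<^sub>m n) i" for i
  have s_carrier: "s i \<in> carrier_vec n" for i unfolding s_def by (rule periodic_family_carrier[OF n0]) simp
  have gs: "g *\<^sub>v s i = F i" for i
    unfolding s_def periodic_family_mult[OF n0 g one_carrier_mat, symmetric] right_mult_one_mat[OF g] by (rule fam)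
  \<comment> \<open>The coordinates of \<open>e i\<close> with respect to the family \<open>F\<close>.\<close>
  define G where "G i = (if mate c i < i then s i - s (mate c i) else s i)" for i
  have gG: "g *\<^sub>v G i = e i" for i
  proof (cases "mate c i < i")
    case True
    have "\<not> mate c (mate c i) < mate c i" using True mate_mate[OF cs] by simp
    hence "g *\<^sub>v G i = (e i + e (mate c i)) - e (mate c i)"
      using True by (simp add: G_def mult_minus_distrib_mat_vec[OF g s_carrier s_carrier] gs F_def)
    also have "\<dots> = e i" using e_carrier[of i] e_carrier[of "mate c i"] by (intro eq_vecI) auto
    finally show ?thesis .
  qed (simp add: G_def gs F_def)
  define h where "h = mat n n (\<lambda>(r, m). G (the_inv_into {1..int n} \<gamma> m) $ r)"
  have h: "h \<in> carrier_mat n n" by (simp add: h_def)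
  have "g * h = 1\<^sub>m n"
  proof (rule mat_col_eqI)
    fix m assume "m < dim_col (1\<^sub>m n)"
    hence m: "m < n" by simp
    define i where "i = the_inv_into {1..int n} \<gamma> m"
    have i: "i \<in> {1..int n}" "\<gamma> i = m"
      unfolding i_def using \<gamma> m
      by (auto simp only: bij_betw_def atLeastLessThan_iff intro!: the_inv_into_into f_the_inv_into_f)
    have "dim_vec (G i) = n" using carrier_vecD[OF s_carrier] by (simp add: G_def)
    hence "col h m = G i"
      using m unfolding i_def by (intro eq_vecI) (simp_all add: h_def)
    hence "col (g * h) m = e i" using m by (simp add: col_mult2[OF g h] gG)
    thus "col (g * h) m = col (1\<^sub>m n) m" using i m by (simp add: e_small)
  qed (use g h in auto)
  hence "g \<in> carrier (GL n)"
    unfolding carrier_GL using mat_mult_left_right_inverse[OF g h] g h by blast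
  moreover have "adapted p q g c"
    unfolding adapted_def n(1)[symmetric] fam
  proof
    fix i
    let ?P = "plus_matrix p q :: 'k fls mat"
    have P: "?P \<in> carrier_mat n n" unfolding n(1) by (rule plus_matrix_carrier)
    have unit: "?P *\<^sub>v unit_vec n m = (if m < p then unit_vec n m else 0\<^sub>v n)" if "m < n" for m
      using plus_matrix_vec[of "unit_vec n m" p q] n(1) that
      by (auto simp: proj_plus_def vec_eq_iff)
    have Pe: "?P *\<^sub>v e j = (if residue n j \<in> ?U then e j else 0\<^sub>v n)" for j
    proof -
      have "residue n j \<in> {1..int n}" using residue_bounds[OF n0] by simp
      thus ?thesis unfolding e_def
        using mult_mat_vec[OF P] unit[OF \<gamma>_less[of j]] \<gamma>_plus[of "residue n j"] by (simp add: smult_zero_vec)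
    qed
    have sgn: "residue n j \<in> ?U \<longleftrightarrow> c j = Plus \<or> j < mate c j" for j
    proof -
      have "c (residue n j) = Plus \<longleftrightarrow> c j = Plus"
        using clan_shift_iff(1)[OF cs, of "residue n j" "(j - 1) div int n"] by (simp flip: residue_decomp)
      moreover have "mate c (residue n j) = mate c j - (j - residue n j)" by (rule mate_residue[OF n0 cs])
      ultimately show ?thesis using residue_bounds[OF n0, of j] by (auto simp: plusses_def ups_def)
    qed
    consider "c i = Plus" | "c i = Minus" | "i < mate c i" "c i \<noteq> Minus" "c i \<noteq> Plus"
      | "mate c i < i" "c i \<noteq> Minus" "c i \<noteq> Plus"
      using mate_eq_self_iff[OF cs, of i] by (meson linorder_neqE)
    thus "?P *\<^sub>v F i = (if c i = Minus then 0\<^sub>v n else F (min i (mate c i)))"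
    proof cases
      case 4
      have "?P *\<^sub>v F i = ?P *\<^sub>v e i + ?P *\<^sub>v e (mate c i)"
        using 4 mult_add_distrib_mat_vec[OF P e_carrier e_carrier] by (simp add: F_def)
      also have "?P *\<^sub>v e i = 0\<^sub>v n" using 4 Pe[of i] sgn[of i] by simp
      also have "?P *\<^sub>v e (mate c i) = e (mate c i)" using 4 Pe[of "mate c i"] sgn[of "mate c i"] mate_mate[OF cs, of i] by simp
      also have "0\<^sub>v n + e (mate c i) = e (mate c i)" using e_carrier by simp
      finally show ?thesis using 4 mate_mate[OF cs, of i] by (simp add: F_def min_def)
    qed (use Pe[of i] sgn[of i] mate_sign[of c i] in \<open>simp_all add: F_def\<close>)
  qed
  ultimately show ?thesis by blast
qed

section \<open>Dimensions of quotients\<close>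

lemma field_constant_field: "field (constant_field :: 'k :: field fls ring)"
proof -
  have add: "fls_const a + fls_const b \<in> range (fls_const :: 'k \<Rightarrow> _)"
      "fls_const a * fls_const b \<in> range (fls_const :: 'k \<Rightarrow> _)" for a b
    by (simp_all add: fls_plus_const fls_const_mult_const)
  have zero: "(0 :: 'k fls) = fls_const 0" "(1 :: 'k fls) = fls_const 1" by simp_all
  have neg: "\<exists>y. fls_const y + fls_const a = (0 :: 'k fls)" for a :: 'k
    by (rule exI[of _ "- a"]) (simp add: fls_plus_const)
  have inv: "\<exists>y. fls_const y * fls_const a = (1 :: 'k fls)" if "a \<noteq> 0" for a :: 'k
    by (rule exI[of _ "inverse a"]) (use that in \<open>simp add: fls_const_mult_const\<close>)
  have "cring (constant_field :: 'k fls ring)"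
  proof (rule cringI)
    show "abelian_group (constant_field :: 'k fls ring)"
      by (rule abelian_groupI) (use add zero neg in \<open>auto simp: ac_simps\<close>)
    show "comm_monoid (constant_field :: 'k fls ring)"
      by (rule comm_monoidI) (use add zero in \<open>auto simp: ac_simps\<close>)
  qed (simp add: distrib_right)
  thus ?thesis
  proof (rule cring.cring_fieldI2)
    fix x :: "'k fls" assume "x \<in> carrier constant_field" "x \<noteq> \<zero>\<^bsub>constant_field\<^esub>"
    then obtain a where a: "x = fls_const a" "a \<noteq> 0" by auto
    show "\<exists>y \<in> carrier constant_field. x \<otimes>\<^bsub>constant_field\<^esub> y = \<one>\<^bsub>constant_field\<^esub>"
      using inv[OF a(2)] a(1) by (auto simp: mult.commute)
  qed simp
qed

text \<open>The cosets of the kernel \<open>U\<close> are the level sets of \<open>\<phi>\<close>. The quotient is therefore the image of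
  \<open>\<phi>\<close>, which is zero or the whole ground field.\<close>

lemma quotient_dim_functional:
  fixes \<phi> :: "'k :: field fls vec \<Rightarrow> 'k"
  assumes W: "W \<subseteq> carrier_vec n" "0\<^sub>v n \<in> W"
    and add: "\<And>v w. v \<in> W \<Longrightarrow> w \<in> W \<Longrightarrow> v + w \<in> W \<and> \<phi> (v + w) = \<phi> v + \<phi> w"
    and smult: "\<And>a w. w \<in> W \<Longrightarrow> fls_const a \<cdot>\<^sub>v w \<in> W \<and> \<phi> (fls_const a \<cdot>\<^sub>v w) = a * \<phi> w"
    and U: "U = {w \<in> W. \<phi> w = 0}"
  shows "quotient_dim n W U = (if \<exists>w \<in> W. \<phi> w \<noteq> 0 then 1 else 0)"
proof -
  define S where "S a = {w \<in> W. \<phi> w = a}" for a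
  let ?M = "quotient_module (laurent_space n) W U"
  let ?K = "constant_field :: 'k fls ring"
  define A where "A = \<phi> ` W"
  have minus: "- w \<in> W \<and> \<phi> (- w) = - \<phi> w" if "w \<in> W" for w
  proof -
    have "fls_const (- 1) \<cdot>\<^sub>v w = - w" by (rule eq_vecI) (simp_all add: fls_const_uminus[symmetric])
    thus ?thesis using smult[OF that, of "- 1"] by simp
  qed
  have "\<phi> (0\<^sub>v n + 0\<^sub>v n) = \<phi> (0\<^sub>v n) + \<phi> (0\<^sub>v n)" using add[OF W(2) W(2)] by blast
  hence phi0: "\<phi> (0\<^sub>v n) = 0" unfolding left_zero_vec[OF zero_carrier_vec] by (simp only: add_cancel_right_right)
  have A: "0 \<in> A" "\<And>a b. a \<in> A \<Longrightarrow> b \<in> A \<Longrightarrow> a + b \<in> A" "\<And>a b. b \<in> A \<Longrightarrow> a * b \<in> A"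
  proof -
    show "0 \<in> A" unfolding A_def using W(2) phi0 by (metis image_eqI)
    show "a + b \<in> A" if ab: "a \<in> A" "b \<in> A" for a b
    proof -
      obtain v w where "v \<in> W" "w \<in> W" "a = \<phi> v" "b = \<phi> w" using ab unfolding A_def by blast
      thus ?thesis unfolding A_def using add[of v w] by (intro image_eqI[of _ _ "v + w"]) simp_all
    qed
    show "a * b \<in> A" if b: "b \<in> A" for a b
    proof -
      obtain w where "w \<in> W" "b = \<phi> w" using b unfolding A_def by blast
      thus ?thesis unfolding A_def using smult[of w a]
        by (intro image_eqI[of _ _ "fls_const a \<cdot>\<^sub>v w"]) simp_all
    qed
  qed
  have cancel: "x = (x + - w) + w" if "x \<in> W" "w \<in> W" for x w
    using carrier_vecD[OF subsetD[OF W(1) that(1)]] carrier_vecD[OF subsetD[OF W(1) that(2)]]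
    by (intro eq_vecI) simp_all
  have coset: "a_r_coset (laurent_space n) U w = S (\<phi> w)" if w: "w \<in> W" for w
  proof (intro equalityI subsetI)
    fix x assume "x \<in> a_r_coset (laurent_space n) U w"
    then obtain u where "u \<in> U" "x = u + w" by (auto simp: a_r_coset_def' module_vec_simps)
    thus "x \<in> S (\<phi> w)" using add[of u w] w by (auto simp: S_def U)
  next
    fix x assume "x \<in> S (\<phi> w)"
    hence x: "x \<in> W" "\<phi> x = \<phi> w" by (auto simp: S_def)
    have "x + - w \<in> U" using add[OF x(1), of "- w"] minus[OF w] x by (simp add: U)
    moreover have "x = (x + - w) + w" by (rule cancel[OF x(1) w])
    ultimately show "x \<in> a_r_coset (laurent_space n) U w"
      by (auto simp: a_r_coset_def' module_vec_simps)
  qed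
  have S_inj: "S a = S b \<longleftrightarrow> a = b" if "a \<in> A" for a b
    using that unfolding S_def A_def by blast
  have car: "carrier ?M = S ` A"
    unfolding quotient_module_def A_def using coset by (auto simp: image_iff)
  have zero: "\<zero>\<^bsub>?M\<^esub> = S 0" unfolding quotient_module_def by (simp add: U S_def)
  have plus: "S a \<oplus>\<^bsub>?M\<^esub> S b = S (a + b)" if a: "a \<in> A" and b: "b \<in> A" for a b
  proof -
    have "set_add (laurent_space n) (S a) (S b) = S (a + b)"
    proof (intro equalityI subsetI)
      fix x assume "x \<in> set_add (laurent_space n) (S a) (S b)"
      then obtain v w where "v \<in> S a" "w \<in> S b" "x = v + w"
        by (auto simp: set_add_def' module_vec_simps)
      thus "x \<in> S (a + b)" using add[of v w] by (auto simp: S_def)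
    next
      fix x assume "x \<in> S (a + b)"
      hence x: "x \<in> W" "\<phi> x = a + b" by (auto simp: S_def)
      obtain w where w: "w \<in> W" "\<phi> w = b" using b by (auto simp: A_def)
      have "x + - w \<in> S a" using add[OF x(1), of "- w"] minus[OF w(1)] x w by (simp add: S_def)
      moreover have "x = (x + - w) + w" by (rule cancel[OF x(1) w(1)])
      moreover have "w \<in> S b" using w by (simp add: S_def)
      ultimately show "x \<in> set_add (laurent_space n) (S a) (S b)"
        by (auto simp: set_add_def' module_vec_simps)
    qed
    thus ?thesis by (simp add: quotient_module_def)
  qed
  have scale: "fls_const a \<odot>\<^bsub>?M\<^esub> S b = S (a * b)" if b: "b \<in> A" for a b
  proof -
    have "(\<Union>x\<in>S b. a_r_coset (laurent_space n) U (fls_const a \<odot>\<^bsub>laurent_space n\<^esub> x)) = (\<Union>x\<in>S b. S (a * b))"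
      by (intro SUP_cong refl) (use smult coset in \<open>auto simp: S_def module_vec_simps\<close>)
    also have "\<dots> = S (a * b)" using b by (auto simp: A_def S_def)
    finally show ?thesis by (simp add: quotient_module_def)
  qed
  have K: "carrier ?K = range fls_const" "\<And>a b. fls_const a \<oplus>\<^bsub>?K\<^esub> fls_const b = fls_const (a + b)"
     "\<And>a b. fls_const a \<otimes>\<^bsub>?K\<^esub> fls_const b = fls_const (a * b)" "\<one>\<^bsub>?K\<^esub> = fls_const 1"
    by (simp_all add: fls_plus_const fls_const_mult_const)
  have vs: "vectorspace ?K ?M"
  proof (rule vs_criteria)
    show "\<forall>v\<in>carrier ?M. \<exists>w\<in>carrier ?M. v \<oplus>\<^bsub>?M\<^esub> w = \<zero>\<^bsub>?M\<^esub>"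
    proof
      fix v assume "v \<in> carrier ?M"
      then obtain a where a: "a \<in> A" "v = S a" unfolding car by blast
      hence "- a \<in> A" using A(3)[of a "- 1"] by simp
      moreover have "v \<oplus>\<^bsub>?M\<^esub> S (- a) = \<zero>\<^bsub>?M\<^esub>" using plus[OF a(1) \<open>- a \<in> A\<close>] a zero by simp
      ultimately show "\<exists>w\<in>carrier ?M. v \<oplus>\<^bsub>?M\<^esub> w = \<zero>\<^bsub>?M\<^esub>" unfolding car by blast
    qed
  qed (use field_constant_field A in \<open>auto simp only: car zero plus scale K image_iff ac_simps distrib_left distrib_right mult_1_left mult_1_right add_0_right add_0_left\<close>)
  interpret vectorspace ?K ?M by (rule vs)
  have span_empty: "span {} = {S 0}" unfolding span_def lincomb_def using zero by auto
  have dim: "quotient_dim n W U = (LEAST k. \<exists>B. finite B \<and> card B = k \<and> B \<subseteq> carrier ?M \<and> span B = carrier ?M)"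
    unfolding quotient_dim_def dim_def ..
  show ?thesis
  proof (cases "\<exists>w \<in> W. \<phi> w \<noteq> 0")
    case False
    hence "A = {0}" using A(1) unfolding A_def by auto
    hence "span {} = carrier ?M" unfolding span_empty car by simp
    hence "\<exists>B. finite B \<and> card B = 0 \<and> B \<subseteq> carrier ?M \<and> span B = carrier ?M"
      by (intro exI[of _ "{}"]) simp
    hence "quotient_dim n W U = 0" unfolding dim by (intro Least_eq_0) simp
    thus ?thesis using False by simp
  next
    case True
    then obtain d where d: "d \<in> A" "d \<noteq> 0" unfolding A_def by auto
    have all: "a \<in> A" for a using A(3)[OF d(1), of "a / d"] d(2) by simp
    let ?B = "{S 1}"
    have B: "?B \<subseteq> carrier ?M" unfolding car using all by blast
    interpret span: submodule ?K "span ?B" ?M by (rule span_is_submodule[OF B])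
    have "S a \<in> span ?B" for a
    proof -
      have "S 1 \<in> span ?B" using in_own_span[OF B] by blast
      hence "fls_const a \<odot>\<^bsub>?M\<^esub> S 1 \<in> span ?B" by (intro span.smult_closed) simp_all
      thus ?thesis using scale[OF all, of a 1] by simp
    qed
    hence gen: "span ?B = carrier ?M" using span.subset unfolding car by blast
    have "(LEAST k. \<exists>B. finite B \<and> card B = k \<and> B \<subseteq> carrier ?M \<and> span B = carrier ?M) = 1"
    proof (rule Least_equality)
      show "\<exists>B. finite B \<and> card B = 1 \<and> B \<subseteq> carrier ?M \<and> span B = carrier ?M"
        using B gen by (intro exI[of _ ?B]) simp
      fix k assume "\<exists>B. finite B \<and> card B = k \<and> B \<subseteq> carrier ?M \<and> span B = carrier ?M"
      then obtain B where B': "finite B" "card B = k" "span B = carrier ?M" by blast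
      have "k \<noteq> 0"
      proof
        assume "k = 0"
        hence "{S 0} = carrier ?M" using B' span_empty by simp
        hence "S 1 = S 0" unfolding car using all by blast
        thus False using S_inj[OF all] by simp
      qed
      thus "1 \<le> k" by simp
    qed
    thus ?thesis using True unfolding dim by simp
  qed
qed

section \<open>The invariants of an adapted flag\<close>

locale adapted_flag =
  fixes p q :: nat and g h :: "'k :: field fls mat" and c :: "int \<Rightarrow> clan_entry"
  assumes n0: "0 < p + q"
    and g: "g \<in> carrier_mat (p + q) (p + q)" and h: "h \<in> carrier_mat (p + q) (p + q)"
    and gh: "g * h = 1\<^sub>m (p + q)" and hg: "h * g = 1\<^sub>m (p + q)"
    and c: "clan_shape (p + q) c" and ad: "adapted p q g c"
begin

abbreviation n :: nat where "n \<equiv> p + q"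

abbreviation f :: "int \<Rightarrow> 'k fls vec" where "f \<equiv> periodic_family n g"

abbreviation \<Lambda> :: "int \<Rightarrow> 'k fls vec set" where "\<Lambda> \<equiv> affine_flag n g"

text \<open>The coordinates with respect to the family \<open>f\<close>.\<close>

definition lam :: "'k fls vec \<Rightarrow> int \<Rightarrow> 'k" where
  "lam v i = coef n (h *\<^sub>v v) i"

lemma f_carrier: "f i \<in> carrier_vec n"
  by (rule periodic_family_carrier[OF n0 g])

lemma lam_add: "v \<in> carrier_vec n \<Longrightarrow> w \<in> carrier_vec n \<Longrightarrow> lam (v + w) i = lam v i + lam w i"
  unfolding lam_def mult_add_distrib_mat_vec[OF h] using h by (intro coef_add[OF n0]) auto

lemma lam_diff: "v \<in> carrier_vec n \<Longrightarrow> w \<in> carrier_vec n \<Longrightarrow> lam (v - w) i = lam v i - lam w i"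
  unfolding lam_def mult_minus_distrib_mat_vec[OF h] using h by (intro coef_diff[OF n0]) auto

lemma lam_smult: "v \<in> carrier_vec n \<Longrightarrow> lam (fls_const a \<cdot>\<^sub>v v) i = a * lam v i"
  unfolding lam_def mult_mat_vec[OF h] using h by (intro coef_smult_const[OF n0]) auto

lemma lam_zero: "lam (0\<^sub>v n) i = 0"
  unfolding lam_def mult_mat_zero_vec[OF h] by (rule coef_zero[OF n0])

text \<open>By \<open>affine_flag_eq\<close> the flag is the image of the standard flag under \<open>g\<close>, which \<open>h\<close> undoes.\<close>

lemma affine_flag_iff: "v \<in> \<Lambda> i \<longleftrightarrow> v \<in> carrier_vec n \<and> (\<forall>l<i. lam v l = 0)"
proof
  assume "v \<in> \<Lambda> i"
  then obtain x where x: "x \<in> std_lattice n i" "v = g *\<^sub>v x" unfolding affine_flag_eq[OF n0 g] by blast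
  note xc = std_latticeD[OF x(1)]
  have "h *\<^sub>v v = x" unfolding x(2) assoc_mult_mat_vec[OF h g xc, symmetric] hg using xc by simp
  thus "v \<in> carrier_vec n \<and> (\<forall>l<i. lam v l = 0)" using x g by (auto simp: lam_def std_lattice_def)
next
  assume v: "v \<in> carrier_vec n \<and> (\<forall>l<i. lam v l = 0)"
  hence "h *\<^sub>v v \<in> std_lattice n i" using h by (simp add: lam_def std_lattice_def)
  moreover have "g *\<^sub>v (h *\<^sub>v v) = v"
    using assoc_mult_mat_vec[OF g h, of v] v gh by simp
  ultimately show "v \<in> \<Lambda> i" unfolding affine_flag_eq[OF n0 g] by (metis image_eqI)
qed

text \<open>A scalar \<open>a\<close> of \<open>F\<close> spreads $f_l$ over the indices congruent to \<open>l\<close>: the coefficient of $t^k$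
  in \<open>a\<close> appears at \<open>l + k n\<close>.\<close>

lemma lam_smult_f:
  "lam (a \<cdot>\<^sub>v f l) i = (if residue n i = residue n l then fls_nth a ((i - l) div int n) else 0)"
proof (rule index_cases[OF n0, of l], rule index_cases[OF n0, of i])
  fix m k r t assume m: "m < n" "l = index n m k" and r: "r < n" "i = index n r t"
  have one: "h *\<^sub>v f l = periodic_family n (1\<^sub>m n) l"
    unfolding periodic_family_mult[OF n0 h g, symmetric] hg ..
  have "h *\<^sub>v (a \<cdot>\<^sub>v f l) = a \<cdot>\<^sub>v periodic_family n (1\<^sub>m n) l"
    unfolding mult_mat_vec[OF h f_carrier] one ..
  also have "periodic_family n (1\<^sub>m n) l = fls_X_intpow k \<cdot>\<^sub>v (unit_vec n m :: 'k fls vec)"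
    unfolding m(2) periodic_family_index[OF n0 m(1)] using m(1) by simp
  finally have "lam (a \<cdot>\<^sub>v f l) i = fls_nth (a * (fls_X_intpow k * (unit_vec n m $ r))) t"
    unfolding lam_def r(2) coef_index[OF r(1)] using r(1) by simp
  also have "\<dots> = (if r = m then fls_nth a (t - k) else 0)"
    using m(1) r(1) by (auto simp: fls_X_intpow_times_conv_shift)
  also have "\<dots> = (if residue n i = residue n l then fls_nth a ((i - l) div int n) else 0)"
  proof (cases "r = m")
    case True
    have "i - l = (t - k) * int n" unfolding m(2) r(2) index_def True by (simp add: left_diff_distrib)
    thus ?thesis using True m r n0 by (simp add: index_div_mod)
  qed (use m r in \<open>simp add: index_div_mod\<close>)
  finally show ?thesis .
qed

lemma n_nonzero: "int n \<noteq> 0"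
  using n0 by linarith

lemma lam_smult_f_shift: "lam (a \<cdot>\<^sub>v f l) (l + k * int n) = fls_nth a k"
proof -
  have "(l + k * int n - l) div int n = k"
    unfolding add_diff_cancel_left' using n_nonzero by (rule nonzero_mult_div_cancel_right)
  thus ?thesis unfolding lam_smult_f residue_shift[OF n0] by (simp only: if_True simp_thms)
qed

lemma lam_f: "lam (f l) i = (if i = l then 1 else 0)"
proof -
  have "lam (f l) i = lam (1 \<cdot>\<^sub>v f l) i" by simp
  also have "\<dots> = (if i = l then 1 else 0)"
  proof (cases "residue n i = residue n l")
    case True
    then obtain k where k: "i = l + k * int n" using residue_eq_iff[OF n0] by blast
    have "lam (1 \<cdot>\<^sub>v f l) i = fls_nth 1 k" unfolding k by (rule lam_smult_f_shift)
    thus ?thesis using k n_nonzero by auto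
  qed (unfold lam_smult_f, auto)
  finally show ?thesis .
qed

lemma kind_shift:
  assumes "residue n i = residue n j"
  shows "c i = Plus \<longleftrightarrow> c j = Plus" "c i = Minus \<longleftrightarrow> c j = Minus"
    "i < mate c i \<longleftrightarrow> j < mate c j" "mate c i < i \<longleftrightarrow> mate c j < j"
    "residue n (mate c i) = residue n (mate c j)"
proof -
  obtain k where k: "i = j + k * int n" using assms residue_eq_iff[OF n0] by blast
  show "c i = Plus \<longleftrightarrow> c j = Plus" "c i = Minus \<longleftrightarrow> c j = Minus"
    "i < mate c i \<longleftrightarrow> j < mate c j" "mate c i < i \<longleftrightarrow> mate c j < j"
    "residue n (mate c i) = residue n (mate c j)"
    unfolding k mate_shift[OF c] clan_shift_iff[OF c] residue_shift[OF n0] by auto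
qed

lemma sign_cases:
  obtains "c i = Plus" "mate c i = i" "c i \<noteq> Minus" | "c i = Minus" "mate c i = i" "c i \<noteq> Plus"
  | "i < mate c i" "c i \<noteq> Minus" "c i \<noteq> Plus"
  | "mate c i < i" "c i \<noteq> Minus" "c i \<noteq> Plus"
  using mate_eq_self_iff[OF c, of i] by (cases "c i"; cases "mate c i" i rule: linorder_cases) auto

lemma proj_f: "proj_plus p q (f i) = (if c i = Minus then 0\<^sub>v n else f (min i (mate c i)))"
  using ad unfolding adapted_def plus_matrix_vec[OF f_carrier] by blast

text \<open>The coordinates of \<open>P v\<close> when \<open>v\<close> has coordinates \<open>x\<close>: both vectors of a matched pair are sent to
  the one with the smaller index, where their coordinates add up.\<close>

definition proj_coeff :: "(int \<Rightarrow> 'k) \<Rightarrow> int \<Rightarrow> 'k" where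
  "proj_coeff x i = (if c i = Minus \<or> mate c i < i then 0
     else if c i = Plus then x i else x i + x (mate c i))"

lemma lam_proj_smult_f:
  "lam (plus_matrix p q *\<^sub>v (a \<cdot>\<^sub>v f j)) i = proj_coeff (lam (a \<cdot>\<^sub>v f j)) i"
proof -
  have P: "(plus_matrix p q :: 'k fls mat) \<in> carrier_mat n n" by (rule plus_matrix_carrier)
  have S: "lam (a \<cdot>\<^sub>v f l) i = 0" if "residue n i \<noteq> residue n l" for l i
    using that by (simp add: lam_smult_f)
  have proj: "plus_matrix p q *\<^sub>v (a \<cdot>\<^sub>v f j) = (if c j = Minus then 0\<^sub>v n else a \<cdot>\<^sub>v f (min j (mate c j)))"
    unfolding mult_mat_vec[OF P f_carrier] plus_matrix_vec[OF f_carrier] proj_f by (simp add: smult_zero_vec)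
  have mm: "mate c (mate c l) = l" "c (mate c l) = c l" for l
    using mate_mate[OF c] clan_mate_eq[OF c] by auto
  show ?thesis
  proof (cases rule: sign_cases[of j])
    case 1
    have "residue n i \<noteq> residue n j" if "c i \<noteq> Plus" using that 1 kind_shift(1) by blast
    moreover have "residue n (mate c i) \<noteq> residue n j" if "c i \<noteq> Plus"
      using that 1 kind_shift(1)[of "mate c i" j] mm by auto
    ultimately show ?thesis using 1 S mate_sign[of c i] unfolding proj proj_coeff_def by auto
  next
    case 2
    have "residue n i \<noteq> residue n j" if "c i \<noteq> Minus" using that 2 kind_shift(2) by blast
    moreover have "residue n (mate c i) \<noteq> residue n j" if "c i \<noteq> Minus"
      using that 2 kind_shift(2)[of "mate c i" j] mm by auto
    ultimately show ?thesis using 2 S unfolding proj proj_coeff_def by (auto simp: lam_zero)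
  next
    case 3
    have 1: "residue n i \<noteq> residue n j" if "\<not> i < mate c i" using that 3 kind_shift(3) by blast
    have 2: "residue n (mate c i) \<noteq> residue n j" if "i < mate c i"
      using that 3 kind_shift(3)[of "mate c i" j] mm by auto
    show ?thesis
      using 3 S 1 2 mate_sign[of c i] unfolding proj proj_coeff_def
      by (cases rule: sign_cases[of i]) (auto simp: min_def)
  next
    case 4
    have 1: "residue n i \<noteq> residue n j" if "\<not> mate c i < i" using that 4 kind_shift(4) by blast
    have 2: "residue n i \<noteq> residue n (mate c j)" if "\<not> i < mate c i"
      using that 4 kind_shift(3)[of i "mate c j"] mm by auto
    have 3: "lam (a \<cdot>\<^sub>v f (mate c j)) i = lam (a \<cdot>\<^sub>v f j) (mate c i)"
    proof (cases "residue n i = residue n (mate c j)")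
      case True
      then obtain k where k: "i = mate c j + k * int n" using residue_eq_iff[OF n0] by blast
      hence k': "mate c i = j + k * int n" using mate_shift[OF c, of "mate c j" k] mm by simp
      have "lam (a \<cdot>\<^sub>v f (mate c j)) i = fls_nth a k" unfolding k by (rule lam_smult_f_shift)
      moreover have "lam (a \<cdot>\<^sub>v f j) (mate c i) = fls_nth a k" unfolding k' by (rule lam_smult_f_shift)
      ultimately show ?thesis by simp
    next
      case False
      hence "residue n (mate c i) \<noteq> residue n j" using kind_shift(5)[of "mate c i" j] mm by auto
      thus ?thesis using False S by simp
    qed
    show ?thesis
      using 4 1 2 3 S[of i j] S[of i "mate c j"] unfolding proj proj_coeff_def
      by (cases rule: sign_cases[of i]) (auto simp: min_def)
  qed
qed

text \<open>Both sides are additive, so it suffices to treat multiples of the vectors $f_1, \dots, f_n$.\<close>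

lemma lam_proj:
  assumes v: "v \<in> carrier_vec n"
  shows "lam (proj_plus p q v) i = proj_coeff (lam v) i"
proof -
  have P: "(plus_matrix p q :: 'k fls mat) \<in> carrier_mat n n" by (rule plus_matrix_carrier)
  have Pc: "plus_matrix p q *\<^sub>v w \<in> carrier_vec n" if "w \<in> carrier_vec n" for w :: "'k fls vec"
    using mult_mat_vec_carrier[OF P that] .
  have gc: "g *\<^sub>v x \<in> carrier_vec n" if "x \<in> carrier_vec n" for x
    using mult_mat_vec_carrier[OF g that] .
  have "\<forall>i. lam (plus_matrix p q *\<^sub>v (g *\<^sub>v x)) i = proj_coeff (lam (g *\<^sub>v x)) i"
    if x: "x \<in> carrier_vec n" for x
    using x
  proof (induction rule: vec_induct_entries)
    case zero
    show ?case by (simp add: mult_mat_zero_vec[OF g] mult_mat_zero_vec[OF P] lam_zero proj_coeff_def)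
  next
    case (add x y)
    have "proj_coeff (lam (g *\<^sub>v x + g *\<^sub>v y)) i = proj_coeff (lam (g *\<^sub>v x)) i + proj_coeff (lam (g *\<^sub>v y)) i" for i
      using lam_add[OF gc[OF add(1)] gc[OF add(2)]] by (simp add: proj_coeff_def)
    moreover have "plus_matrix p q *\<^sub>v (g *\<^sub>v (x + y)) =
        plus_matrix p q *\<^sub>v (g *\<^sub>v x) + plus_matrix p q *\<^sub>v (g *\<^sub>v y)"
      unfolding mult_add_distrib_mat_vec[OF g add(1,2)] mult_add_distrib_mat_vec[OF P gc[OF add(1)] gc[OF add(2)]] ..
    ultimately show ?case
      using add(3,4) lam_add[OF Pc[OF gc[OF add(1)]] Pc[OF gc[OF add(2)]]]
      unfolding mult_add_distrib_mat_vec[OF g add(1,2)] by simp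
  next
    case (entry m)
    have "g *\<^sub>v unit_vec n m = f (int n - int m)"
      using mat_mult_unit_vec[OF g entry] periodic_family_index[OF n0 entry, of g 0] by (simp add: index_def)
    hence "g *\<^sub>v (x $ m \<cdot>\<^sub>v unit_vec n m) = x $ m \<cdot>\<^sub>v f (int n - int m)"
      unfolding mult_mat_vec[OF g unit_vec_carrier] by simp
    thus ?case using lam_proj_smult_f by simp
  qed
  from this[of "h *\<^sub>v v"] have "lam (plus_matrix p q *\<^sub>v (g *\<^sub>v (h *\<^sub>v v))) i = proj_coeff (lam (g *\<^sub>v (h *\<^sub>v v))) i"
    using mult_mat_vec_carrier[OF h v] by blast
  moreover have "g *\<^sub>v (h *\<^sub>v v) = v" using assoc_mult_mat_vec[OF g h v] gh v by simp
  ultimately show ?thesis using plus_matrix_vec[OF v] by simp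
qed

lemma V_plus_iff: "v \<in> V_plus p q \<longleftrightarrow> v \<in> carrier_vec n \<and> proj_plus p q v = v"
  using plus_matrix_fixes_iff[of v p q] plus_matrix_vec[of v p q] by (auto simp: V_plus_def)

lemma V_minus_iff: "v \<in> V_minus p q \<longleftrightarrow> v \<in> carrier_vec n \<and> proj_plus p q v = 0\<^sub>v n"
  using plus_matrix_kills_iff[of v p q] plus_matrix_vec[of v p q] by (auto simp: V_minus_def)

text \<open>The coordinate at \<open>i\<close> is a functional on the lattice with index \<open>i\<close> whose kernel is the next lattice.\<close>

lemma quotient_dim_flag:
  assumes V: "V = V_plus p q \<or> V = V_minus p q"
  shows "quotient_dim n (\<Lambda> i \<inter> V) (\<Lambda> (i + 1) \<inter> V) =
    (if \<exists>w \<in> \<Lambda> i \<inter> V. lam w i \<noteq> 0 then 1 else 0)"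
proof (rule quotient_dim_functional)
  have Vc: "v \<in> carrier_vec n" if "v \<in> V" for v using V that V_plus_iff V_minus_iff by blast
  show "\<Lambda> i \<inter> V \<subseteq> carrier_vec n" using Vc by blast
  have "0\<^sub>v n \<in> V" using V by (auto simp: V_plus_def V_minus_def)
  thus "0\<^sub>v n \<in> \<Lambda> i \<inter> V" by (simp add: affine_flag_iff lam_zero)
  show "v + w \<in> \<Lambda> i \<inter> V \<and> lam (v + w) i = lam v i + lam w i"
    if vw: "v \<in> \<Lambda> i \<inter> V" "w \<in> \<Lambda> i \<inter> V" for v w
  proof -
    have "v + w \<in> V" using V vw Vc[of v] Vc[of w] by (auto simp: V_plus_def V_minus_def)
    thus ?thesis using vw lam_add[of v w] by (simp add: affine_flag_iff)
  qed
  show "fls_const a \<cdot>\<^sub>v w \<in> \<Lambda> i \<inter> V \<and> lam (fls_const a \<cdot>\<^sub>v w) i = a * lam w i"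
    if w: "w \<in> \<Lambda> i \<inter> V" for a w
  proof -
    have "fls_const a \<cdot>\<^sub>v w \<in> V" using V w Vc[of w] by (auto simp: V_plus_def V_minus_def)
    thus ?thesis using w lam_smult[of w] by (simp add: affine_flag_iff)
  qed
  have "(\<forall>l<i + 1. lam w l = 0) \<longleftrightarrow> (\<forall>l<i. lam w l = 0) \<and> lam w i = 0" for w
    by (metis zless_add1_eq)
  thus "\<Lambda> (i + 1) \<inter> V = {w \<in> \<Lambda> i \<inter> V. lam w i = 0}"
    by (auto simp: affine_flag_iff)
qed

text \<open>A vector of $V_+$ is its own projection, so its coordinates vanish at minusses and larger indices.
  At the other indices $f_i$ itself lies in $V_+$.\<close>

lemma inv_plus_eq: "inv_plus p q \<Lambda> i = (if c i = Plus \<or> i < mate c i then 1 else 0)"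
proof -
  have "(\<exists>w \<in> \<Lambda> i \<inter> V_plus p q. lam w i \<noteq> 0) \<longleftrightarrow> c i = Plus \<or> i < mate c i"
  proof
    assume "\<exists>w \<in> \<Lambda> i \<inter> V_plus p q. lam w i \<noteq> 0"
    then obtain w where w: "w \<in> carrier_vec n" "proj_plus p q w = w" "lam w i \<noteq> 0"
      by (auto simp: V_plus_iff)
    from lam_proj[OF w(1), of i] have "proj_coeff (lam w) i \<noteq> 0" using w by simp
    thus "c i = Plus \<or> i < mate c i"
      by (cases rule: sign_cases[of i]) (auto simp: proj_coeff_def)
  next
    assume "c i = Plus \<or> i < mate c i"
    hence "proj_plus p q (f i) = f i"
      unfolding proj_f by (cases rule: sign_cases[of i]) (auto simp: min_def)
    hence "f i \<in> \<Lambda> i \<inter> V_plus p q" by (auto simp: V_plus_iff affine_flag_iff lam_f f_carrier)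
    moreover have "lam (f i) i \<noteq> 0" by (simp add: lam_f)
    ultimately show "\<exists>w \<in> \<Lambda> i \<inter> V_plus p q. lam w i \<noteq> 0" by blast
  qed
  thus ?thesis unfolding inv_plus_def quotient_dim_flag[OF disjI1[OF refl]] by simp
qed

text \<open>For a vector of $V_-$ the coordinates vanish at plusses, and those at a matched pair sum to zero. At a
  larger index \<open>i\<close> the coordinate is therefore zero for vectors in $\Lambda_i$, since the mate precedes
  \<open>i\<close>. At a smaller index the difference of the two vectors of the pair lies in $V_-$.\<close>

lemma inv_minus_eq: "inv_minus p q \<Lambda> i = (if c i = Minus \<or> i < mate c i then 1 else 0)"
proof -
  have "(\<exists>w \<in> \<Lambda> i \<inter> V_minus p q. lam w i \<noteq> 0) \<longleftrightarrow> c i = Minus \<or> i < mate c i"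
  proof
    assume "\<exists>w \<in> \<Lambda> i \<inter> V_minus p q. lam w i \<noteq> 0"
    then obtain w where w: "w \<in> carrier_vec n" "proj_plus p q w = 0\<^sub>v n" "lam w i \<noteq> 0" "\<And>l. l < i \<Longrightarrow> lam w l = 0"
      by (auto simp: V_minus_iff affine_flag_iff)
    have zero: "proj_coeff (lam w) l = 0" for l using lam_proj[OF w(1), of l] w(2) by (simp add: lam_zero)
    show "c i = Minus \<or> i < mate c i"
    proof (cases rule: sign_cases[of i])
      case 1
      thus ?thesis using zero[of i] w(3) by (simp add: proj_coeff_def)
    next
      case 4
      have "proj_coeff (lam w) (mate c i) = lam w (mate c i) + lam w i"
        using 4 mate_mate[OF c, of i] clan_mate_eq[OF c, of i] by (simp add: proj_coeff_def)
      thus ?thesis using zero[of "mate c i"] w(3) w(4)[OF 4(1)] by simp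
    qed auto
  next
    assume "c i = Minus \<or> i < mate c i"
    thus "\<exists>w \<in> \<Lambda> i \<inter> V_minus p q. lam w i \<noteq> 0"
    proof
      assume "c i = Minus"
      hence "f i \<in> \<Lambda> i \<inter> V_minus p q"
        by (auto simp: V_minus_iff affine_flag_iff lam_f f_carrier proj_f)
      moreover have "lam (f i) i \<noteq> 0" by (simp add: lam_f)
      ultimately show ?thesis by blast
    next
      assume up: "i < mate c i"
      let ?w = "f i - f (mate c i)"
      have wc: "?w \<in> carrier_vec n" using f_carrier by simp
      have lw: "lam ?w l = (if l = i then 1 else 0) - (if l = mate c i then 1 else 0)" for l
        unfolding lam_diff[OF f_carrier f_carrier] lam_f ..
      have "c i \<noteq> Minus" using up mate_sign[of c i] by auto
      hence "proj_plus p q (f i) = f i" "proj_plus p q (f (mate c i)) = f i"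
        unfolding proj_f using up mate_mate[OF c, of i] clan_mate_eq[OF c, of i] by (auto simp: min_def)
      moreover have "proj_plus p q ?w = proj_plus p q (f i) - proj_plus p q (f (mate c i))"
        using carrier_vecD[OF f_carrier] by (intro eq_vecI) (auto simp: proj_plus_def)
      ultimately have "proj_plus p q ?w = 0\<^sub>v n" using f_carrier[of i] by simp
      hence "?w \<in> \<Lambda> i \<inter> V_minus p q" using wc up by (simp add: V_minus_iff affine_flag_iff lw)
      moreover have "lam ?w i \<noteq> 0" using up by (simp add: lw)
      ultimately show ?thesis by blast
    qed
  qed
  thus ?thesis unfolding inv_minus_def quotient_dim_flag[OF disjI2[OF refl]] by simp
qed

lemma flag_sum_iff:
  "v \<in> X <+>\<^bsub>laurent_space n\<^esub> Y \<longleftrightarrow> (\<exists>x \<in> X. \<exists>y \<in> Y. v = x + y)"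
  by (auto simp: set_add_def' module_vec_simps)

text \<open>For \<open>j = mate c i\<close> the vector $f_i$ is the projection of $f_j$, which lies in $\Lambda_{i+1}$.\<close>

lemma splitting_vector_f:
  assumes up: "i < mate c i"
  shows "splitting_vector p q \<Lambda> i (f i)"
  unfolding splitting_vector_def Let_def
proof (intro conjI)
  have "c (mate c i) \<noteq> Minus" using up mate_sign[of c i] clan_mate_eq[OF c, of i] by auto
  hence "f i = proj_plus p q (f (mate c i))"
    unfolding proj_f using up mate_mate[OF c, of i] by (simp add: min_def)
  moreover have "f (mate c i) \<in> \<Lambda> (i + 1)" using up f_carrier by (simp add: affine_flag_iff lam_f)
  ultimately show "f i \<in> proj_plus p q ` \<Lambda> (i + 1)" by blast
  show "f i \<notin> \<Lambda> (i + 1)" by (auto simp: affine_flag_iff lam_f)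
  have lam_kf: "lam (fls_const a \<cdot>\<^sub>v f i) l = (if l = i then a else 0)" for a l
    unfolding lam_smult[OF f_carrier] lam_f by simp
  have kfc: "fls_const a \<cdot>\<^sub>v f i \<in> carrier_vec n" for a using f_carrier by simp
  show "\<Lambda> i = \<Lambda> (i + 1) <+>\<^bsub>laurent_space n\<^esub> {fls_const a \<cdot>\<^sub>v f i |a. True}"
  proof (intro equalityI subsetI)
    fix v assume "v \<in> \<Lambda> i"
    hence v: "v \<in> carrier_vec n" "\<And>l. l < i \<Longrightarrow> lam v l = 0" by (auto simp: affine_flag_iff)
    let ?k = "fls_const (lam v i) \<cdot>\<^sub>v f i"
    have "lam (v - ?k) l = 0" if "l < i + 1" for l
      unfolding lam_diff[OF v(1) kfc] lam_kf using v(2)[of l] that by (cases "l = i") auto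
    hence "v - ?k \<in> \<Lambda> (i + 1)" using v(1) kfc by (simp add: affine_flag_iff)
    moreover have "v = (v - ?k) + ?k" using v(1) carrier_vecD[OF f_carrier] by (intro eq_vecI) auto
    ultimately show "v \<in> \<Lambda> (i + 1) <+>\<^bsub>laurent_space n\<^esub> {fls_const a \<cdot>\<^sub>v f i |a. True}"
      unfolding flag_sum_iff by blast
  next
    fix v assume "v \<in> \<Lambda> (i + 1) <+>\<^bsub>laurent_space n\<^esub> {fls_const a \<cdot>\<^sub>v f i |a. True}"
    then obtain x a where x: "x \<in> \<Lambda> (i + 1)" "v = x + fls_const a \<cdot>\<^sub>v f i"
      unfolding flag_sum_iff by blast
    hence xc: "x \<in> carrier_vec n" by (simp add: affine_flag_iff)
    thus "v \<in> \<Lambda> i"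
      using x kfc[of a] lam_add[OF xc kfc[of a]] lam_kf by (auto simp: affine_flag_iff)
  qed
  show "\<Lambda> (i + 1) \<inter> {fls_const a \<cdot>\<^sub>v f i |a. True} = {0\<^sub>v n}"
  proof (intro equalityI subsetI)
    fix v assume "v \<in> \<Lambda> (i + 1) \<inter> {fls_const a \<cdot>\<^sub>v f i |a. True}"
    then obtain a where a: "v = fls_const a \<cdot>\<^sub>v f i" "lam v i = 0" by (auto simp: affine_flag_iff)
    hence "a = 0" using lam_kf[of a i] by simp
    thus "v \<in> {0\<^sub>v n}" using a(1) carrier_vecD[OF f_carrier] by (auto intro!: eq_vecI)
  next
    fix v :: "'k fls vec" assume "v \<in> {0\<^sub>v n}"
    moreover have "0\<^sub>v n = fls_const 0 \<cdot>\<^sub>v f i" using carrier_vecD[OF f_carrier] by (intro eq_vecI) auto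
    hence "0\<^sub>v n \<in> {fls_const a \<cdot>\<^sub>v f i |a. True}" by blast
    moreover have "0\<^sub>v n \<in> \<Lambda> (i + 1)" by (simp add: affine_flag_iff lam_zero)
    ultimately show "v \<in> \<Lambda> (i + 1) \<inter> {fls_const a \<cdot>\<^sub>v f i |a. True}" by blast
  qed
qed

lemma splitting_vector_lam:
  assumes "splitting_vector p q \<Lambda> i v"
  shows "v \<in> \<Lambda> i" "lam v i \<noteq> 0"
proof -
  have s: "v \<in> proj_plus p q ` \<Lambda> (i + 1)" "v \<notin> \<Lambda> (i + 1)"
    "\<Lambda> i = \<Lambda> (i + 1) <+>\<^bsub>laurent_space n\<^esub> {fls_const a \<cdot>\<^sub>v v |a. True}"
    using assms unfolding splitting_vector_def Let_def by blast+
  have vc: "v \<in> carrier_vec n" using s(1) by (auto simp: proj_plus_def)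
  have "v = 0\<^sub>v n + fls_const 1 \<cdot>\<^sub>v v" using vc by simp
  moreover have "0\<^sub>v n \<in> \<Lambda> (i + 1)" by (simp add: affine_flag_iff lam_zero)
  ultimately show v: "v \<in> \<Lambda> i" unfolding s(3) flag_sum_iff by blast
  show "lam v i \<noteq> 0"
  proof
    assume "lam v i = 0"
    hence "lam v l = 0" if "l < i + 1" for l using v that by (cases "l = i") (auto simp: affine_flag_iff)
    thus False using s(2) vc by (simp add: affine_flag_iff)
  qed
qed

text \<open>Modulo $\Lambda_{i+1}$ only the coordinate at \<open>i\<close> matters. For a projection \<open>P y\<close> with \<open>y\<close> in
  $\Lambda_j$ this is the coordinate of \<open>y\<close> at the mate of \<open>i\<close>, which vanishes as soon as \<open>j\<close>
  exceeds the mate.\<close>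

lemma in_proj_plus_flag_iff:
  assumes up: "i < mate c i" and v: "v \<in> \<Lambda> i" "lam v i \<noteq> 0" and j: "i < j"
  shows "v \<in> proj_plus p q ` \<Lambda> j <+>\<^bsub>laurent_space n\<^esub> \<Lambda> (i + 1) \<longleftrightarrow> j \<le> mate c i"
proof
  have vc: "v \<in> carrier_vec n" using v(1) by (simp add: affine_flag_iff)
  have no_sign: "c i \<noteq> Plus" "c i \<noteq> Minus" using up mate_sign[of c i] by auto
  assume "v \<in> proj_plus p q ` \<Lambda> j <+>\<^bsub>laurent_space n\<^esub> \<Lambda> (i + 1)"
  then obtain y z where y: "y \<in> \<Lambda> j" and z: "z \<in> \<Lambda> (i + 1)"
    and v': "v = proj_plus p q y + z" unfolding flag_sum_iff by blast
  have yc: "y \<in> carrier_vec n" and zc: "z \<in> carrier_vec n" using y z by (auto simp: affine_flag_iff)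
  have pc: "proj_plus p q y \<in> carrier_vec n" by (simp add: proj_plus_def)
  have "lam v i = proj_coeff (lam y) i"
    unfolding v' lam_add[OF pc zc] lam_proj[OF yc] using z by (simp add: affine_flag_iff)
  also have "\<dots> = lam y (mate c i)"
    using y j up no_sign by (simp add: proj_coeff_def affine_flag_iff)
  finally show "j \<le> mate c i" using v(2) y by (auto simp: affine_flag_iff not_less[symmetric])
next
  have vc: "v \<in> carrier_vec n" using v(1) by (simp add: affine_flag_iff)
  assume j: "j \<le> mate c i"
  let ?a = "fls_const (lam v i)"
  let ?y = "?a \<cdot>\<^sub>v f (mate c i)" and ?k = "?a \<cdot>\<^sub>v f i"
  have kc: "?k \<in> carrier_vec n" "?y \<in> carrier_vec n" using f_carrier by auto
  have "lam ?y l = 0" if "l < j" for l using that j unfolding lam_smult[OF f_carrier] lam_f by simp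
  hence y: "?y \<in> \<Lambda> j" using kc by (simp add: affine_flag_iff)
  have "c (mate c i) \<noteq> Minus" using up mate_sign[of c i] clan_mate_eq[OF c, of i] by auto
  hence "proj_plus p q (f (mate c i)) = f i"
    unfolding proj_f using up mate_mate[OF c, of i] by (simp add: min_def)
  moreover have "proj_plus p q ?y = ?a \<cdot>\<^sub>v proj_plus p q (f (mate c i))"
    using carrier_vecD[OF f_carrier] by (intro eq_vecI) (auto simp: proj_plus_def)
  ultimately have py: "proj_plus p q ?y = ?k" by simp
  have "lam (v - ?k) l = 0" if "l < i + 1" for l
    unfolding lam_diff[OF vc kc(1)] lam_smult[OF f_carrier] lam_f using v(1) that
    by (cases "l = i") (auto simp: affine_flag_iff)
  hence z: "v - ?k \<in> \<Lambda> (i + 1)" using vc kc by (simp add: affine_flag_iff)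
  have "v = ?k + (v - ?k)" using vc carrier_vecD[OF f_carrier] by (intro eq_vecI) auto
  thus "v \<in> proj_plus p q ` \<Lambda> j <+>\<^bsub>laurent_space n\<^esub> \<Lambda> (i + 1)"
    unfolding flag_sum_iff using y z py by (metis image_eqI)
qed

lemma partner_eq:
  assumes up: "i < mate c i"
  shows "partner p q \<Lambda> i = mate c i"
  unfolding partner_def
proof (rule the_equality)
  note s = splitting_vector_f[OF up]
  note sl = splitting_vector_lam[OF s]
  show "mate c i > i \<and> (\<exists>v. splitting_vector p q \<Lambda> i v \<and>
     v \<in> proj_plus p q ` \<Lambda> (mate c i) <+>\<^bsub>laurent_space n\<^esub> \<Lambda> (i + 1) \<and>
     v \<notin> proj_plus p q ` \<Lambda> (mate c i + 1) <+>\<^bsub>laurent_space n\<^esub> \<Lambda> (i + 1))"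
    using s in_proj_plus_flag_iff[OF up sl, of "mate c i"] in_proj_plus_flag_iff[OF up sl, of "mate c i + 1"] up
    by (intro conjI exI[of _ "f i"]) auto
next
  fix j assume "j > i \<and> (\<exists>v. splitting_vector p q \<Lambda> i v \<and>
     v \<in> proj_plus p q ` \<Lambda> j <+>\<^bsub>laurent_space n\<^esub> \<Lambda> (i + 1) \<and>
     v \<notin> proj_plus p q ` \<Lambda> (j + 1) <+>\<^bsub>laurent_space n\<^esub> \<Lambda> (i + 1))"
  then obtain v where j: "j > i" and v: "splitting_vector p q \<Lambda> i v"
    and "v \<in> proj_plus p q ` \<Lambda> j <+>\<^bsub>laurent_space n\<^esub> \<Lambda> (i + 1)"
     "v \<notin> proj_plus p q ` \<Lambda> (j + 1) <+>\<^bsub>laurent_space n\<^esub> \<Lambda> (i + 1)" by blast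
  thus "j = mate c i"
    using in_proj_plus_flag_iff[OF up splitting_vector_lam[OF v], of j]
      in_proj_plus_flag_iff[OF up splitting_vector_lam[OF v], of "j + 1"] by auto
qed

end

section \<open>The labelling procedure\<close>

lemma mod_eq_iff_residue:
  assumes "0 < n"
  shows "k mod int n = i mod int n \<longleftrightarrow> residue n k = residue n i"
  unfolding residue_eq_iff[OF assms]
proof
  assume "k mod int n = i mod int n"
  hence "int n dvd k - i" by (simp add: mod_eq_dvd_iff)
  then obtain t where "k - i = int n * t" by (elim dvdE)
  hence "k = i + t * int n" by (simp add: mult.commute)
  thus "\<exists>t. k = i + t * int n" by blast
qed auto

lemma small_multiple:
  fixes d N m r :: int
  assumes "m = r + d * N" "1 \<le> m" "m \<le> N" "1 \<le> r" "r \<le> N"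
  shows "d = 0"
proof (rule ccontr)
  assume "d \<noteq> 0"
  hence "1 \<le> d \<or> d \<le> - 1" by linarith
  hence "1 * N \<le> d * N \<or> d * N \<le> (- 1) * N"
    using mult_right_mono[of 1 d N] mult_right_mono[of d "- 1" N] assms by linarith
  thus False using assms by linarith
qed

context adapted_flag
begin

definition labelled :: "int \<Rightarrow> bool" where
  "labelled i \<longleftrightarrow> c i \<noteq> Plus \<and> c i \<noteq> Minus"

text \<open>Of the two residues of a matched pair the procedure visits the smaller one first; only there a new
  label is introduced.\<close>

definition leader :: "int \<Rightarrow> bool" where
  "leader i \<longleftrightarrow> labelled i \<and> residue n i < residue n (mate c i)"

text \<open>The new label given to the leader \<open>i\<close>: the labels are numbered in the order of the leaders.\<close>

definition rank :: "int \<Rightarrow> int" where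
  "rank i = int (card {l \<in> {1..i}. leader l})"

definition lead :: "int \<Rightarrow> int" where
  "lead k = (if residue n k < residue n (mate c k) then k else mate c k)"

text \<open>The final label: leaders in \<open>{1..n}\<close> carry their rank, and labels are translated together with the
  indices.\<close>

definition label :: "int \<Rightarrow> int" where
  "label k = rank (residue n (lead k)) + (lead k - residue n (lead k))"

definition final_clan :: "int \<Rightarrow> clan_entry" where
  "final_clan k = (if labelled k then Label (label k) else c k)"

lemmas mm = mate_mate[OF c] clan_mate_eq[OF c]

lemma labelled_mate: "labelled (mate c i) \<longleftrightarrow> labelled i"
  by (simp add: labelled_def mm)

lemma labelled_shift:
  assumes "residue n i = residue n j"
  shows "labelled i \<longleftrightarrow> labelled j"
  unfolding labelled_def kind_shift(1,2)[OF assms] ..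

lemma labelled_iff: "labelled i \<longleftrightarrow> mate c i \<noteq> i"
  using mate_eq_self_iff[OF c] by (auto simp: labelled_def)

lemma residue_mate_neq: "labelled i \<Longrightarrow> residue n (mate c i) \<noteq> residue n i"
proof
  assume i: "labelled i" "residue n (mate c i) = residue n i"
  then obtain k where k: "mate c i = i + k * int n" using residue_eq_iff[OF n0] by blast
  hence "k = 0" by (rule mate_not_congruent[OF c n0])
  thus False using k i(1) labelled_iff by simp
qed

lemma lead_mate: "labelled k \<Longrightarrow> lead (mate c k) = lead k"
  using residue_mate_neq[of k] by (auto simp: lead_def mm)

lemma lead_shift: "lead (k + t * int n) = lead k + t * int n"
  unfolding lead_def mate_shift[OF c] residue_shift[OF n0] by simp

lemma lead_cases: "lead k = k \<or> lead k = mate c k"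
  by (simp add: lead_def)

lemma leader_lead: "labelled k \<Longrightarrow> leader (lead k)"
  using residue_mate_neq[of k] by (auto simp: leader_def lead_def labelled_mate mm)

lemma leader_residue: "leader (residue n k) \<longleftrightarrow> leader k"
proof -
  have rr: "residue n (residue n k) = residue n k" using residue_bounds[OF n0] by (intro residue_id)
  show ?thesis unfolding leader_def rr kind_shift(5)[OF rr] labelled_shift[OF rr] ..
qed

lemma residue_lead_le: "residue n (lead k) \<le> residue n k"
  by (simp add: lead_def)

lemma label_mate: "labelled k \<Longrightarrow> label (mate c k) = label k"
  by (simp add: label_def lead_mate)

lemma label_shift': "label (k + t * int n) = label k + t * int n"
  unfolding label_def lead_shift residue_shift[OF n0] by simp

lemma finite_leaders: "finite {l \<in> {1..i}. leader l}"
  by (rule finite_subset[of _ "{1..i}"]) auto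

lemma rank_step:
  assumes "1 \<le> i"
  shows "rank i = rank (i - 1) + (if leader i then 1 else 0)"
proof -
  have "{l \<in> {1..i}. leader l} = (if leader i then insert i {l \<in> {1..i - 1}. leader l} else {l \<in> {1..i - 1}. leader l})"
    using assms by (auto simp: le_less)
  thus ?thesis unfolding rank_def using finite_leaders[of "i - 1"] by auto
qed

lemma rank_mono: "i \<le> j \<Longrightarrow> rank i \<le> rank j"
proof -
  assume "i \<le> j"
  hence "card {l \<in> {1..i}. leader l} \<le> card {l \<in> {1..j}. leader l}"
    by (intro card_mono[OF finite_leaders]) auto
  thus ?thesis by (simp add: rank_def)
qed

lemma rank_le: "0 \<le> i \<Longrightarrow> rank i \<le> i"
proof -
  assume "0 \<le> i"
  have "card {l \<in> {1..i}. leader l} \<le> card {1..i}" by (rule card_mono) auto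
  thus ?thesis using \<open>0 \<le> i\<close> by (simp add: rank_def)
qed

lemma rank_pos: "leader i \<Longrightarrow> 1 \<le> i \<Longrightarrow> 1 \<le> rank i"
  using rank_step[of i] by (simp add: rank_def)

lemma rank_inj:
  assumes "leader i" "leader j" "1 \<le> i" "1 \<le> j" "rank i = rank j"
  shows "i = j"
proof -
  have less: "rank a < rank b" if "a < b" "leader b" "1 \<le> b" for a b
    using rank_step[OF that(3)] rank_mono[of a "b - 1"] that by simp
  show ?thesis using less[of i j] less[of j i] assms by (cases i j rule: linorder_cases) auto
qed

lemma rank_surj:
  assumes "1 \<le> m" "m \<le> rank (int k)"
  shows "\<exists>l \<in> {1..int k}. leader l \<and> rank l = m"
  using assms
proof (induction k)
  case 0
  thus ?case by (simp add: rank_def)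
next
  case (Suc k)
  have step: "rank (int (Suc k)) = rank (int k) + (if leader (int (Suc k)) then 1 else 0)"
    using rank_step[of "int (Suc k)"] by simp
  show ?case
  proof (cases "m \<le> rank (int k)")
    case True
    thus ?thesis using Suc by force
  next
    case False
    hence "leader (int (Suc k))" "rank (int (Suc k)) = m" using step Suc.prems by (auto split: if_splits)
    thus ?thesis by (intro bexI[of _ "int (Suc k)"]) auto
  qed
qed

lemma rank_residue_bounds:
  assumes "labelled k"
  shows "1 \<le> rank (residue n (lead k))" "rank (residue n (lead k)) \<le> int n"
  using rank_pos[of "residue n (lead k)"] leader_lead[OF assms] leader_residue residue_bounds[OF n0, of "lead k"]
    rank_le[of "residue n (lead k)"] by auto

text \<open>The ranks of the leaders in \<open>{1..n}\<close> are different integers between 1 and \<open>n\<close>. A label thus determines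
  the rank, which is its residue, and the translation.\<close>

lemma label_inj:
  assumes k: "labelled k" "labelled k'" "label k = label k'"
  shows "lead k = lead k'"
proof -
  let ?r = "residue n (lead k)" and ?r' = "residue n (lead k')"
  let ?d = "(lead k - 1) div int n" and ?d' = "(lead k' - 1) div int n"
  have l: "lead k = ?r + ?d * int n" "lead k' = ?r' + ?d' * int n" by (rule residue_decomp)+
  have "rank ?r + ?d * int n = rank ?r' + ?d' * int n" using k(3) l unfolding label_def by linarith
  \<comment> \<open>An index determines both of its components; here they encode the rank and the translation.\<close>
  hence "index n (nat (int n - rank ?r)) ?d = index n (nat (int n - rank ?r')) ?d'"
    using rank_residue_bounds[OF k(1)] rank_residue_bounds[OF k(2)] by (simp add: index_def)
  moreover have "nat (int n - rank ?r) < n" "nat (int n - rank ?r') < n"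
    using rank_residue_bounds[OF k(1)] rank_residue_bounds[OF k(2)] by linarith+
  ultimately have "nat (int n - rank ?r) = nat (int n - rank ?r')" and d: "?d = ?d'"
    using index_inject by blast+
  hence "rank ?r = rank ?r'"
    using rank_residue_bounds[OF k(1)] rank_residue_bounds[OF k(2)] by linarith
  hence "?r = ?r'"
    using rank_inj leader_lead[OF k(1)] leader_lead[OF k(2)] leader_residue residue_bounds[OF n0] by blast
  thus ?thesis using l d by simp
qed

lemma label_eq_iff:
  assumes "labelled k"
  shows "labelled l \<and> label l = label k \<longleftrightarrow> l = k \<or> l = mate c k"
proof
  assume l: "labelled l \<and> label l = label k"
  hence "lead l = lead k" using label_inj assms by blast
  thus "l = k \<or> l = mate c k" using lead_cases[of l] lead_cases[of k] mm by metis
qed (use assms label_mate labelled_mate in auto)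

lemma final_clan_sign: "final_clan k = Plus \<longleftrightarrow> c k = Plus" "final_clan k = Minus \<longleftrightarrow> c k = Minus"
  by (auto simp: final_clan_def labelled_def)

lemma final_clan_label: "final_clan k = Label m \<longleftrightarrow> labelled k \<and> label k = m"
  by (cases "c k") (auto simp: final_clan_def labelled_def)

lemma clan_shape_final: "clan_shape n final_clan"
  unfolding clan_shape_def
proof (intro conjI allI impI)
  fix i k m assume "final_clan i = Label m"
  thus "final_clan (i + k * int n) = Label (m + k * int n)"
    unfolding final_clan_label label_shift' using labelled_shift[of "i + k * int n" i] residue_shift[OF n0] by simp
next
  fix i assume "final_clan i \<in> {Plus, Minus}"
  hence i: "c i = Plus \<or> c i = Minus" using final_clan_sign[of i] by auto
  hence "c (i + int n) = c i" using sign_shift[OF c i, of 1] by simp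
  thus "final_clan (i + int n) = final_clan i" using i by (auto simp: final_clan_def labelled_def)
next
  fix m assume "\<exists>i. final_clan i = Label m"
  then obtain k where k: "labelled k" "label k = m" by (auto simp: final_clan_label)
  hence "{i. final_clan i = Label m} = {k, mate c k}"
    unfolding final_clan_label using label_eq_iff[OF k(1)] by auto
  thus "card {i. final_clan i = Label m} = 2" using k(1) by (simp add: labelled_iff)
qed

lemma mate_final: "mate final_clan = mate c"
proof
  fix i
  show "mate final_clan i = mate c i"
  proof (cases "labelled i")
    case True
    have "final_clan i = Label (label i)" "final_clan (mate c i) = Label (label i)"
      using True label_mate labelled_mate by (simp_all add: final_clan_def)
    thus ?thesis using True by (intro mateI[OF clan_shape_final]) (auto simp: labelled_iff)
  next
    case False
    thus ?thesis using mate_sign[of c i] mate_sign[of final_clan i] by (auto simp: final_clan_sign labelled_def)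
  qed
qed

lemma final_clan_equiv:
  assumes "c \<in> affine_clans p q"
  shows "(final_clan, c) \<in> clan_equiv p q"
proof -
  have "final_clan \<in> affine_clans p q"
    using assms clan_shape_final unfolding affine_clans_iff final_clan_sign by blast
  thus ?thesis unfolding clan_equiv_iff using assms by (simp add: final_clan_sign mate_final)
qed

text \<open>The indices that have a value before step \<open>i\<close>. The larger index of a pair also receives its value
  when the residue of the smaller one is visited, but not conversely.\<close>

definition determined :: "int \<Rightarrow> int \<Rightarrow> bool" where
  "determined i k \<longleftrightarrow> residue n k < i \<or> (mate c k < k \<and> residue n (mate c k) < i)"

definition state :: "int \<Rightarrow> int \<Rightarrow> clan_entry option" where
  "state i k = (if determined i k then Some (final_clan k) else None)"

text \<open>Among the labels of the visited indices, those in \<open>{1..n}\<close> are exactly the ranks of the visited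
  leaders: the label of any other visited index is such a rank up to a multiple of \<open>n\<close>.\<close>

lemma new_label_state:
  assumes i: "1 \<le> i" "i \<le> int n"
  shows "new_label n i (state i) = rank (i - 1) + 1"
proof -
  let ?S = "{m \<in> {1..int n}. \<exists>l \<in> {1..<i}. state i l = Some (Label m)}"
  have st: "state i l = Some (Label m) \<longleftrightarrow> labelled l \<and> label l = m" if "l \<in> {1..<i}" for l m
    using that i final_clan_label[of l m] by (simp add: state_def determined_def residue_id)
  have "?S = {1..rank (i - 1)}"
  proof (intro equalityI subsetI)
    fix m assume "m \<in> ?S"
    then obtain l where m: "1 \<le> m" "m \<le> int n" and l: "l \<in> {1..<i}" "labelled l" "label l = m"
      using st by auto
    let ?r = "residue n (lead l)" and ?d = "(lead l - 1) div int n"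
    have lm: "m = rank ?r + ?d * int n" using l(3) residue_decomp[of "lead l" n] unfolding label_def by linarith
    note rb = rank_residue_bounds[OF l(2)]
    have "?d = 0" using small_multiple[OF lm m rb] .
    moreover have "?r \<le> i - 1" using residue_lead_le[of l] residue_id[of l n] l(1) i by auto
    ultimately show "m \<in> {1..rank (i - 1)}" using rank_mono[of ?r "i - 1"] lm m(1) by simp
  next
    fix m assume m: "m \<in> {1..rank (i - 1)}"
    obtain l where l: "l \<in> {1..i - 1}" "leader l" "rank l = m"
      using rank_surj[of m "nat (i - 1)"] m i by auto
    hence lab: "labelled l" and lead: "lead l = l" by (auto simp: leader_def lead_def)
    have "label l = m" unfolding label_def lead using residue_id[of l n] l i by simp
    moreover have "m \<le> int n" using rank_le[of "i - 1"] m i by simp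
    moreover have "l \<in> {1..<i}" using l(1) by simp
    ultimately show "m \<in> ?S" using st lab m by auto
  qed
  hence "new_label n i (state i) =
      (if {1..rank (i - 1)} = {} then 1 else 1 + Max {1..rank (i - 1)})"
    unfolding new_label_def Let_def by (simp only:)
  moreover have "0 \<le> rank (i - 1)" by (simp add: rank_def)
  moreover have "Max {1..rank (i - 1)} = rank (i - 1)" if "1 \<le> rank (i - 1)"
    using that by (intro Max_eqI) auto
  ultimately show ?thesis by auto
qed

lemma state_step:
  "state (i + 1) k = (if residue n k = i \<or> (mate c k < k \<and> residue n (mate c k) = i)
     then Some (final_clan k) else state i k)"
  by (auto simp: state_def determined_def)

text \<open>The cases are those of the procedure. A labelled index \<open>i\<close> that is a leader receives the next rank.
  If it is not, then either it is the larger index of its pair and already has its value, or it copies the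
  label of its mate, whose residue has been visited.\<close>

lemma clan_step_state:
  assumes i: "1 \<le> i" "i \<le> int n"
  shows "clan_step p q \<Lambda> i (state i) = state (i + 1)"
proof -
  have ri: "residue n i = i" using i by (rule residue_id)
  have cong: "k mod int n = i mod int n \<longleftrightarrow> residue n k = i" for k
    unfolding mod_eq_iff_residue[OF n0] ri ..
  note kind = kind_shift[of _ i, unfolded ri]
  note new = new_label_state[OF i] and inv = inv_plus_eq[of i] inv_minus_eq[of i]
  have lower_mate: "mate c (mate c k) = k" for k by (rule mm(1))
  have final_k: "final_clan k = Label (label i + (k - i))" if k: "labelled i" "residue n k = i" for k
  proof -
    obtain t where t: "k = i + t * int n" using k(2) ri residue_eq_iff[OF n0, of k i] by auto
    have "labelled k" using labelled_shift[of k i] k ri by simp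
    moreover have "label k = label i + (k - i)" unfolding t label_shift' by simp
    ultimately show ?thesis by (simp add: final_clan_def)
  qed
  have leader_i: "label i = rank (i - 1) + 1" if "labelled i" "i < residue n (mate c i)"
  proof -
    have "leader i" "lead i = i" using that ri by (simp_all add: leader_def lead_def)
    thus ?thesis using rank_step[OF i(1)] ri by (simp add: label_def)
  qed
  show ?thesis
  proof (cases rule: sign_cases[of i])
    case 1
    have none: "state i i = None" using 1 ri by (simp add: state_def determined_def)
    moreover have "\<not> (mate c k < k \<and> residue n (mate c k) = i)" for k
    proof
      assume k: "mate c k < k \<and> residue n (mate c k) = i"
      hence "c k = Plus" using kind(1)[OF conjunct2[OF k]] 1(1) mm(2)[of k] by simp
      thus False using k mate_sign[of c k] by simp
    qed
    moreover have "final_clan k = Plus" if "residue n k = i" for k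
      using kind(1)[OF that] 1(1) final_clan_sign(1) by blast
    ultimately have "set_sign n i Plus (state i) = state (i + 1)"
      unfolding fun_eq_iff set_sign_def cong state_step by auto
    moreover have "clan_step p q \<Lambda> i (state i) = set_sign n i Plus (state i)"
      unfolding clan_step_def Let_def inv using 1 none by simp
    ultimately show ?thesis by simp
  next
    case 2
    have none: "state i i = None" using 2 ri by (simp add: state_def determined_def)
    moreover have "\<not> (mate c k < k \<and> residue n (mate c k) = i)" for k
    proof
      assume k: "mate c k < k \<and> residue n (mate c k) = i"
      hence "c k = Minus" using kind(2)[OF conjunct2[OF k]] 2(1) mm(2)[of k] by simp
      thus False using k mate_sign[of c k] by simp
    qed
    moreover have "final_clan k = Minus" if "residue n k = i" for k
      using kind(2)[OF that] 2(1) final_clan_sign(2) by blast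
    ultimately have "set_sign n i Minus (state i) = state (i + 1)"
      unfolding fun_eq_iff set_sign_def cong state_step by auto
    moreover have "clan_step p q \<Lambda> i (state i) = set_sign n i Minus (state i)"
      unfolding clan_step_def Let_def inv using 2 none by simp
    ultimately show ?thesis by simp
  next
    case 3
    let ?j = "mate c i"
    have lab: "labelled i" using 3 by (simp add: labelled_def)
    have none: "state i i = None" using 3 ri by (simp add: state_def determined_def)
    have partner: "partner p q \<Lambda> i = ?j" by (rule partner_eq[OF 3(1)])
    have congj: "k mod int n = ?j mod int n \<longleftrightarrow> residue n k = residue n ?j" for k
      by (rule mod_eq_iff_residue[OF n0])
    have lower: "mate c k < k \<and> residue n (mate c k) = i \<longleftrightarrow> residue n k = residue n ?j" for k
    proof
      assume "mate c k < k \<and> residue n (mate c k) = i"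
      hence "residue n (mate c (mate c k)) = residue n ?j" using kind(5) by blast
      thus "residue n k = residue n ?j" unfolding mm(1) .
    next
      assume r: "residue n k = residue n ?j"
      show "mate c k < k \<and> residue n (mate c k) = i"
        using kind_shift(4)[OF r] kind_shift(5)[OF r] 3(1) unfolding mm(1) ri by blast
    qed
    have step: "state (i + 1) k = (if residue n k = i \<or> residue n k = residue n ?j
        then Some (final_clan k) else state i k)" for k
      unfolding state_step lower ..
    show ?thesis
    proof (cases "residue n ?j < i")
      case True
      have sj: "state i k = Some (final_clan k)" if "residue n k = residue n ?j" for k
        using that True by (simp add: state_def determined_def)
      have "final_clan ?j = Label (label i)" using lab label_mate labelled_mate by (simp add: final_clan_def)
      hence "(THE m. state i ?j = Some (Label m)) = label i" using sj[of ?j] by simp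
      moreover have "clan_step p q \<Lambda> i (state i) =
          set_label n i (THE m. state i ?j = Some (Label m)) (state i)"
        unfolding clan_step_def Let_def inv partner using none 3 True by simp
      ultimately have "clan_step p q \<Lambda> i (state i) = set_label n i (label i) (state i)" by simp
      moreover have "set_label n i (label i) (state i) = state (i + 1)"
        unfolding fun_eq_iff set_label_def cong step using final_k[OF lab] sj by simp
      ultimately show ?thesis by simp
    next
      case False
      hence less: "i < residue n ?j" using residue_mate_neq[OF lab] ri by simp
      note li = leader_i[OF lab less]
      have fj: "final_clan k = Label (label i + (k - ?j))" if k: "residue n k = residue n ?j" for k
      proof -
        obtain t where t: "k = ?j + t * int n" using k residue_eq_iff[OF n0] by blast
        have "labelled k" using labelled_shift[OF k] lab labelled_mate by simp
        moreover have "label k = label i + (k - ?j)" unfolding t label_shift' label_mate[OF lab] by simp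
        ultimately show ?thesis by (simp add: final_clan_def)
      qed
      have "clan_step p q \<Lambda> i (state i) =
          set_label n i (label i) (set_label n ?j (label i) (state i))"
        unfolding clan_step_def Let_def inv partner new li using none 3 False by simp
      moreover have "set_label n i (label i) (set_label n ?j (label i) (state i)) = state (i + 1)"
        unfolding fun_eq_iff set_label_def cong congj step using final_k[OF lab] fj less by auto
      ultimately show ?thesis by simp
    qed
  next
    case 4
    have lab: "labelled i" using 4 by (simp add: labelled_def)
    have lower: "\<not> (mate c k < k \<and> residue n (mate c k) = i)" for k
    proof
      assume k: "mate c k < k \<and> residue n (mate c k) = i"
      hence "k < mate c k" using kind(4)[OF conjunct2[OF k]] 4(1) mm(1)[of k] by simp
      thus False using k by simp
    qed
    show ?thesis
    proof (cases "residue n (mate c i) < i")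
      case True
      have "state i k = Some (final_clan k)" if "residue n k = i" for k
        using True 4 kind(4,5)[OF that] by (simp add: state_def determined_def)
      hence "state (i + 1) = state i" using lower by (auto simp: state_step fun_eq_iff)
      moreover have "state i i \<noteq> None" using True 4 by (simp add: state_def determined_def)
      ultimately show ?thesis by (simp add: clan_step_def Let_def)
    next
      case False
      hence less: "i < residue n (mate c i)" using residue_mate_neq[OF lab] ri by simp
      note li = leader_i[OF lab less]
      have none: "state i i = None" using False ri by (simp add: state_def determined_def)
      have "clan_step p q \<Lambda> i (state i) = set_label n i (label i) (state i)"
        unfolding clan_step_def Let_def inv new li using none 4 by simp
      moreover have "set_label n i (label i) (state i) = state (i + 1)"
        unfolding fun_eq_iff set_label_def cong state_step using final_k[OF lab] lower by auto
      ultimately show ?thesis by simp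
    qed
  qed
qed

lemma flag_clan_eq: "flag_clan p q \<Lambda> = final_clan"
proof
  fix k
  have "fold (clan_step p q \<Lambda>) [1..int m] (\<lambda>_. None) = state (int m + 1)" if "m \<le> n" for m
    using that
  proof (induction m)
    case 0
    have "\<not> residue n k < 1" for k using residue_bounds(1)[OF n0, of k] by simp
    thus ?case by (auto simp: state_def determined_def fun_eq_iff)
  next
    case (Suc m)
    have "[1..int (Suc m)] = [1..int m] @ [int (Suc m)]" using upto_rec2[of 1 "int (Suc m)"] by simp
    thus ?case using Suc clan_step_state[of "int (Suc m)"] by (simp add: add.commute)
  qed
  from this[OF order_refl] have "flag_clan p q \<Lambda> k = the (state (int n + 1) k)"
    unfolding flag_clan_def by (simp only:)
  also have "\<dots> = final_clan k"
    using residue_bounds(2)[OF n0, of k] by (simp add: state_def determined_def)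
  finally show "flag_clan p q \<Lambda> k = final_clan k" .
qed

end

lemma flag_clan_adapted:
  fixes g :: "'k :: field fls mat"
  assumes n: "n = p + q" "0 < n" and g: "g \<in> carrier (GL n)"
    and c: "c \<in> affine_clans p q" and ad: "adapted p q g c"
  shows "(flag_clan p q (affine_flag n g), c) \<in> clan_equiv p q"
proof -
  obtain h where "g \<in> carrier_mat n n" "h \<in> carrier_mat n n" "g * h = 1\<^sub>m n" "h * g = 1\<^sub>m n"
    using g by (auto simp: carrier_GL)
  moreover have "clan_shape n c" using c unfolding affine_clans_iff n(1)[symmetric] by blast
  ultimately interpret flag: adapted_flag p q g h c using n ad by unfold_locales simp_all
  show ?thesis unfolding n(1) flag.flag_clan_eq by (rule flag.final_clan_equiv[OF c])
qed

section \<open>The classification of the orbits\<close>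

lemma lcoset_GL: "x <#\<^bsub>GL n\<^esub> X = (\<lambda>y. x * y) ` X"
  by (auto simp: l_coset_def)

lemma one_GL: "1\<^sub>m n \<in> carrier (GL n)"
  unfolding carrier_GL by (intro conjI bexI[of _ "1\<^sub>m n"]) auto

lemma mult_assoc_GL:
  "x \<in> carrier (GL n) \<Longrightarrow> y \<in> carrier (GL n) \<Longrightarrow> z \<in> carrier (GL n) \<Longrightarrow> x * y * z = x * (y * z)"
  by (rule assoc_mult_mat[OF GL_carrier_mat GL_carrier_mat GL_carrier_mat])

abbreviation iwahori_coset :: "nat \<Rightarrow> 'k :: field fls mat \<Rightarrow> 'k fls mat set" where
  "iwahori_coset n g \<equiv> g <#\<^bsub>GL n\<^esub> iwahori n"

lemma lcoset_iwahori_absorb: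
  fixes g b :: "'k :: field fls mat"
  assumes n: "0 < n" and g: "g \<in> carrier (GL n)" and b: "b \<in> iwahori n"
  shows "iwahori_coset n (g * b) = iwahori_coset n g"
proof -
  note bGL = iwahori_GL[OF b]
  obtain b' where b': "b' \<in> carrier_mat n n" "b * b' = 1\<^sub>m n"
    using bGL by (auto simp: carrier_GL)
  note b'I = iwahori_inverse[OF n b b']
  show ?thesis unfolding lcoset_GL
  proof (intro equalityI subsetI)
    fix y assume "y \<in> (\<lambda>y. g * b * y) ` iwahori n"
    then obtain z where z: "z \<in> iwahori n" "y = g * b * z" by blast
    have "y = g * (b * z)" unfolding z(2) by (rule mult_assoc_GL[OF g bGL iwahori_GL[OF z(1)]])
    thus "y \<in> (\<lambda>y. g * y) ` iwahori n" using iwahori_mult[OF n b z(1)] by blast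
  next
    fix y assume "y \<in> (\<lambda>y. g * y) ` iwahori n"
    then obtain z where z: "z \<in> iwahori n" "y = g * z" by blast
    note zGL = iwahori_GL[OF z(1)] and b'GL = iwahori_GL[OF b'I]
    have "b * (b' * z) = z"
      unfolding mult_assoc_GL[OF bGL b'GL zGL, symmetric] b'(2) using GL_carrier_mat[OF zGL] by simp
    hence "y = g * b * (b' * z)"
      unfolding mult_assoc_GL[OF g bGL GL_closed[OF b'GL zGL]] z(2) by simp
    thus "y \<in> (\<lambda>y. g * b * y) ` iwahori n" using iwahori_mult[OF n b'I z(1)] by blast
  qed
qed

lemma K_orbit_iff:
  assumes g: "g \<in> carrier (GL (p + q))"
  shows "X \<in> K_orbit p q (iwahori_coset (p + q) g) \<longleftrightarrow>
    (\<exists>k \<in> block_diagonal p q. X = iwahori_coset (p + q) (k * g))"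
proof -
  have "k <#\<^bsub>GL (p + q)\<^esub> (iwahori_coset (p + q) g) = iwahori_coset (p + q) (k * g)"
    if k: "k \<in> block_diagonal p q" for k
  proof -
    have kGL: "k \<in> carrier (GL (p + q))" using k unfolding block_diagonal_eq by blast
    show ?thesis unfolding lcoset_GL image_image
      by (intro image_cong refl, rule mult_assoc_GL[OF kGL g iwahori_GL, symmetric])
  qed
  thus ?thesis unfolding K_orbit_def orbit_def K_group_def left_translation_def by auto
qed

lemma block_diagonal_mult:
  fixes k k' :: "'k :: field fls mat"
  assumes "k \<in> block_diagonal p q" "k' \<in> block_diagonal p q"
  shows "k * k' \<in> block_diagonal p q"
proof -
  let ?P = "plus_matrix p q :: 'k fls mat"
  have k: "k \<in> carrier (GL (p + q))" "k * ?P = ?P * k" and k': "k' \<in> carrier (GL (p + q))" "k' * ?P = ?P * k'"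
    using assms unfolding block_diagonal_eq by auto
  note c = GL_carrier_mat[OF k(1)] GL_carrier_mat[OF k'(1)] and P = plus_matrix_carrier[of p q, where ?'a = 'k]
  have "k * k' * ?P = k * ?P * k'"
    unfolding assoc_mult_mat[OF c P] k'(2) assoc_mult_mat[OF c(1) P c(2)] ..
  also have "\<dots> = ?P * (k * k')" unfolding k(2) by (rule assoc_mult_mat[OF P c])
  finally show ?thesis unfolding block_diagonal_eq using GL_closed[OF k(1) k'(1)] by blast
qed

lemma one_block_diagonal: "1\<^sub>m (p + q) \<in> (block_diagonal p q :: 'k :: field fls mat set)"
  unfolding block_diagonal_eq
  by (simp add: one_GL left_mult_one_mat[OF plus_matrix_carrier] right_mult_one_mat[OF plus_matrix_carrier])

lemma K_orbit_subset:
  fixes g h :: "'k :: field fls mat"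
  assumes g: "g \<in> carrier (GL (p + q))" and h: "h \<in> carrier (GL (p + q))"
    and mem: "iwahori_coset (p + q) h \<in> K_orbit p q (iwahori_coset (p + q) g)"
  shows "K_orbit p q (iwahori_coset (p + q) h) \<subseteq> K_orbit p q (iwahori_coset (p + q) g)"
proof
  fix X assume "X \<in> K_orbit p q (iwahori_coset (p + q) h)"
  then obtain l where l: "l \<in> block_diagonal p q" "X = iwahori_coset (p + q) (l * h)" using K_orbit_iff[OF h] by blast
  obtain k where k: "k \<in> block_diagonal p q" "iwahori_coset (p + q) h = iwahori_coset (p + q) (k * g)"
    using K_orbit_iff[OF g] mem by blast
  have lGL: "l \<in> carrier (GL (p + q))" and kGL: "k \<in> carrier (GL (p + q))"
    using l(1) k(1) unfolding block_diagonal_eq by auto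
  have assoc: "iwahori_coset (p + q) (x * y) = x <#\<^bsub>GL (p + q)\<^esub> (iwahori_coset (p + q) y)"
    if xy: "x \<in> carrier (GL (p + q))" "y \<in> carrier (GL (p + q))" for x y
    unfolding lcoset_GL image_image by (intro image_cong refl, rule mult_assoc_GL[OF xy iwahori_GL])
  have "X = iwahori_coset (p + q) (l * (k * g))"
    unfolding l(2) assoc[OF lGL h] k(2) assoc[OF lGL GL_closed[OF kGL g]] ..
  also have "l * (k * g) = l * k * g" by (rule mult_assoc_GL[OF lGL kGL g, symmetric])
  finally show "X \<in> K_orbit p q (iwahori_coset (p + q) g)"
    using K_orbit_iff[OF g] block_diagonal_mult[OF l(1) k(1)] by blast
qed

text \<open>Passing from \<open>g\<close> to \<open>g b\<close> does not change the flag.\<close>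

lemma flag_clan_exists:
  fixes g :: "'k :: field fls mat"
  assumes n: "n = p + q" "0 < n" and g: "g \<in> carrier (GL n)"
  obtains b d where "b \<in> iwahori n" "d \<in> affine_clans p q" "adapted p q (g * b) d"
    "(flag_clan p q (affine_flag n g), d) \<in> clan_equiv p q"
proof -
  obtain b d where b: "b \<in> iwahori n" and d: "clan_shape n d" "adapted p q (g * b) d"
    using adapted_exists[OF n g] by blast
  note gb = GL_closed[OF g iwahori_GL[OF b]]
  have dc: "d \<in> affine_clans p q" by (rule adapted_affine_clan[OF n gb d])
  have "(flag_clan p q (affine_flag n (g * b)), d) \<in> clan_equiv p q"
    by (rule flag_clan_adapted[OF n gb dc d(2)])
  thus thesis using that b dc d(2) affine_flag_iwahori[OF n(2) GL_carrier_mat[OF g] b] by simp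
qed

text \<open>If $h = k g b'$ and \<open>g b\<close> is adapted to \<open>d\<close>, then so is \<open>k g b\<close>, which has the same flag as \<open>h\<close>.\<close>

lemma flag_clan_K_orbit:
  fixes g h :: "'k :: field fls mat"
  assumes n: "n = p + q" "0 < n" and g: "g \<in> carrier (GL n)" and h: "h \<in> carrier (GL n)"
    and orbit: "iwahori_coset n h \<in> K_orbit p q (iwahori_coset n g)"
  shows "(flag_clan p q (affine_flag n g), flag_clan p q (affine_flag n h)) \<in> clan_equiv p q"
proof -
  obtain b d where b: "b \<in> iwahori n" and d: "d \<in> affine_clans p q" "adapted p q (g * b) d"
    and gd: "(flag_clan p q (affine_flag n g), d) \<in> clan_equiv p q"
    using flag_clan_exists[OF n g] .
  obtain k where k: "k \<in> block_diagonal p q" "iwahori_coset n h = iwahori_coset n (k * g)"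
    using orbit K_orbit_iff[of g p q] g unfolding n(1) by blast
  have kGL: "k \<in> carrier (GL n)" using k(1) unfolding block_diagonal_eq n(1) by blast
  note kg = GL_closed[OF kGL g]
  have "h \<in> iwahori_coset n h"
    unfolding lcoset_GL
    by (rule image_eqI[where x = "1\<^sub>m n"])
      (simp_all add: one_iwahori[OF n(2)] right_mult_one_mat[OF GL_carrier_mat[OF h]])
  then obtain b' where b': "b' \<in> iwahori n" "h = k * g * b'" unfolding k(2) unfolding lcoset_GL by blast
  have "affine_flag n h = affine_flag n (k * g)"
    unfolding b'(2) by (rule affine_flag_iwahori[OF n(2) GL_carrier_mat[OF kg] b'(1)])
  also have "\<dots> = affine_flag n (k * g * b)"
    by (rule affine_flag_iwahori[OF n(2) GL_carrier_mat[OF kg] b, symmetric])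
  also have "k * g * b = k * (g * b)" by (rule mult_assoc_GL[OF kGL g iwahori_GL[OF b]])
  finally have flag: "affine_flag n h = affine_flag n (k * (g * b))" .
  note gb = GL_closed[OF g iwahori_GL[OF b]]
  have "adapted p q (k * (g * b)) d" by (rule adapted_left_mult[OF n GL_carrier_mat[OF gb] k(1) d(2)])
  hence "(flag_clan p q (affine_flag n h), d) \<in> clan_equiv p q"
    unfolding flag by (rule flag_clan_adapted[OF n GL_closed[OF kGL gb] d(1)])
  thus ?thesis using gd equiv_clan_equiv[of p q] by (meson equivE symE transE)
qed

text \<open>Equivalent clans impose the same conditions on adapted matrices.\<close>

lemma K_orbit_of_flag_clan:
  fixes g h :: "'k :: field fls mat"
  assumes n: "n = p + q" "0 < n" and g: "g \<in> carrier (GL n)" and h: "h \<in> carrier (GL n)"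
    and eq: "(flag_clan p q (affine_flag n g), flag_clan p q (affine_flag n h)) \<in> clan_equiv p q"
  shows "iwahori_coset n h \<in> K_orbit p q (iwahori_coset n g)"
proof -
  obtain b d where b: "b \<in> iwahori n" "adapted p q (g * b) d"
    and gd: "(flag_clan p q (affine_flag n g), d) \<in> clan_equiv p q"
    using flag_clan_exists[OF n g] .
  obtain b' d' where b': "b' \<in> iwahori n" "adapted p q (h * b') d'"
    and hd: "(flag_clan p q (affine_flag n h), d') \<in> clan_equiv p q"
    using flag_clan_exists[OF n h] .
  note gb = GL_closed[OF g iwahori_GL[OF b(1)]] and hb = GL_closed[OF h iwahori_GL[OF b'(1)]]
  have dd: "mate d = mate d'" "d i = Minus \<longleftrightarrow> d' i = Minus" for i
    using gd hd eq unfolding clan_equiv_iff by simp_all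
  obtain k where k: "k \<in> block_diagonal p q" "h * b' = k * (g * b)"
    using adapted_same_orbit[OF n gb hb b(2) b'(2) dd] by blast
  have kGL: "k \<in> carrier (GL n)" using k(1) unfolding block_diagonal_eq n(1) by blast
  have "iwahori_coset n h = iwahori_coset n (h * b')"
    by (rule lcoset_iwahori_absorb[OF n(2) h b'(1), symmetric])
  also have "h * b' = k * g * b" unfolding k(2) by (rule mult_assoc_GL[OF kGL g iwahori_GL[OF b(1)], symmetric])
  also have "iwahori_coset n \<dots> = iwahori_coset n (k * g)"
    by (rule lcoset_iwahori_absorb[OF n(2) GL_closed[OF kGL g] b(1)])
  finally show ?thesis using K_orbit_iff[of g p q] g k(1) unfolding n(1) by blast
qed

theorem theorem1p3:
  fixes p q n :: nat
    and B :: "'k :: field fls mat set"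
    and c :: "'k fls mat \<Rightarrow> int \<Rightarrow> clan_entry"
  assumes char: "CHAR('k) \<noteq> 2"
    and n: "n = p + q" "n > 0"
    and B: "B = iwahori n"
    and c: "\<And>g. c g = flag_clan p q (affine_flag n g)"
  shows "(\<forall>g \<in> carrier (GL n). c g \<in> affine_clans p q) \<and>
    (\<forall>g \<in> carrier (GL n). \<forall>h \<in> carrier (GL n).
       h <#\<^bsub>GL n\<^esub> B \<in> K_orbit p q (g <#\<^bsub>GL n\<^esub> B) \<longrightarrow> (c g, c h) \<in> clan_equiv p q) \<and>
    (\<exists>\<Phi>. bij_betw \<Phi> (K_orbits p q :: 'k fls mat set set set) (affine_clans p q // clan_equiv p q) \<and>
       (\<forall>g \<in> carrier (GL n). \<Phi> (K_orbit p q (g <#\<^bsub>GL n\<^esub> B)) = clan_equiv p q `` {c g}))"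
proof -
  let ?G = "carrier (GL n) :: 'k fls mat set"
  define orb where "orb g = K_orbit p q (g <#\<^bsub>GL n\<^esub> B)" for g :: "'k fls mat"
  note eqv = equiv_clan_equiv[of p q]
  have clan: "c g \<in> affine_clans p q" if g: "g \<in> ?G" for g
    using flag_clan_exists[OF n g] unfolding c clan_equiv_iff by blast
  have const: "(c g, c h) \<in> clan_equiv p q" if "g \<in> ?G" "h \<in> ?G" "h <#\<^bsub>GL n\<^esub> B \<in> orb g" for g h
    using that flag_clan_K_orbit[OF n that(1,2)] unfolding c orb_def B by blast
  have self: "g <#\<^bsub>GL n\<^esub> B \<in> orb g" if g: "g \<in> ?G" for g
  proof -
    have "g <#\<^bsub>GL n\<^esub> B = (1\<^sub>m n * g) <#\<^bsub>GL n\<^esub> B"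
      unfolding left_mult_one_mat[OF GL_carrier_mat[OF g]] ..
    thus ?thesis unfolding orb_def B n(1) K_orbit_iff[OF g[unfolded n(1)]]
      by (rule bexI[OF _ one_block_diagonal])
  qed
  have sep: "orb g = orb h" if g: "g \<in> ?G" and h: "h \<in> ?G" and eq: "(c g, c h) \<in> clan_equiv p q" for g h
  proof -
    have eq': "(c h, c g) \<in> clan_equiv p q" using eq eqv by (meson equivE symE)
    have "h <#\<^bsub>GL n\<^esub> B \<in> orb g" "g <#\<^bsub>GL n\<^esub> B \<in> orb h"
      unfolding orb_def B using K_orbit_of_flag_clan[OF n g h] K_orbit_of_flag_clan[OF n h g] eq eq'
      unfolding c by blast+
    thus ?thesis unfolding orb_def B using K_orbit_subset[of g p q h] K_orbit_subset[of h p q g] g h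
      unfolding n(1) by blast
  qed
  have orbits: "(K_orbits p q :: 'k fls mat set set set) = orb ` ?G"
    unfolding K_orbits_def orbits_def affine_flag_variety_def LCOSETS_def orb_def K_orbit_def n(1) B by auto
  define \<Phi> where "\<Phi> X = clan_equiv p q `` {c (SOME g. g \<in> ?G \<and> orb g = X)}" for X
  have \<Phi>: "\<Phi> (orb g) = clan_equiv p q `` {c g}" if g: "g \<in> ?G" for g
  proof -
    define g' where "g' = (SOME g'. g' \<in> ?G \<and> orb g' = orb g)"
    have g': "g' \<in> ?G \<and> orb g' = orb g" unfolding g'_def by (rule someI[of _ g]) (use g in simp)
    hence "(c g, c g') \<in> clan_equiv p q" using const[OF g, of g'] self[of g'] by simp
    thus ?thesis unfolding \<Phi>_def g'_def[symmetric] using equiv_class_eq[OF eqv] by blast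
  qed
  have "bij_betw \<Phi> (K_orbits p q) (affine_clans p q // clan_equiv p q)"
    unfolding bij_betw_def orbits
  proof
    show "inj_on \<Phi> (orb ` ?G)"
    proof (rule inj_onI)
      fix X Y assume "X \<in> orb ` ?G" "Y \<in> orb ` ?G" and eq: "\<Phi> X = \<Phi> Y"
      then obtain g h where gh: "g \<in> ?G" "X = orb g" "h \<in> ?G" "Y = orb h" by blast
      hence "(c g, c h) \<in> clan_equiv p q"
        using eq \<Phi>[OF gh(1)] \<Phi>[OF gh(3)] eq_equiv_class[OF _ eqv clan[OF gh(3)]] by simp
      thus "X = Y" using sep gh by blast
    qed
    show "\<Phi> ` orb ` ?G = affine_clans p q // clan_equiv p q"
    proof (intro equalityI subsetI)
      fix Z assume "Z \<in> \<Phi> ` orb ` ?G"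
      then obtain g where "g \<in> ?G" "Z = clan_equiv p q `` {c g}" using \<Phi> by blast
      thus "Z \<in> affine_clans p q // clan_equiv p q" using clan by (auto intro: quotientI)
    next
      fix Z assume "Z \<in> affine_clans p q // clan_equiv p q"
      then obtain d where d: "d \<in> affine_clans p q" "Z = clan_equiv p q `` {d}" by (rule quotientE)
      obtain g :: "'k fls mat" where g: "g \<in> ?G" "adapted p q g d" using clan_realised[OF n d(1)] by blast
      have "(c g, d) \<in> clan_equiv p q" unfolding c by (rule flag_clan_adapted[OF n g(1) d(1) g(2)])
      hence "Z = \<Phi> (orb g)" unfolding \<Phi>[OF g(1)] d(2) using equiv_class_eq[OF eqv] by blast
      thus "Z \<in> \<Phi> ` orb ` ?G" using g(1) by blast
    qed
  qed
  thus ?thesis using clan const \<Phi> unfolding orb_def by blast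
qed

end
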